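(* Let $n\ge 3$. Let $S$ be the monoid given by the presentation in the context and let $\mathcal{PIP}_n$ be the partial dual inverse symmetric monoid. Let $\varphi:S\to\mathcal{PIP}_n$ be the monoid homomorphism extending the assignment $\sigma_i\mapsto s_i$, $\lambda_i\mapsto l_i$, $\rho_i\mapsto r_i$ ($1\le i\le n-1$); this assignment does extend to a (surjective) homomorphism. Then $\varphi$ is an isomorphism.
   Context: **The monoid $\mathcal{PIP}_n$.** For a set $X$ let $X'=\{x'\}_{x\in X}$ be a disjoint copy of $X$; put $(x')'=x$. A subset $A\subseteq X\cup X'$ is a *line* if $A\cap X\neq\varnothing$ and $A\cap X'\ne\varnothing$, and a *point* if $|A|=1$. $\mathcal{IP}_X$ is the set of all partitions of $X\cup X'$ into lines, and $\mathcal{PIP}_X$ is the set of all partitions of $X\cup X'$ into lines and points. For a partition $a$ write $u\equiv_a v$ if $u,v$ lie in the same block of $a$. Multiplication on $\mathcal{IP}_X$: for $a,b\in\mathcal{IP}_X$, $a\cdot b$ is the partition into classes of the equivalence relation $\equiv$ on $X\cup X'$ defined, for $x,y\in X$, by: - $x\equiv y$ iff $x\equiv_a y$ or there are $c_1,\dots,c_{2s}\in X$, $s\ge1$, with $x\equiv_a c_1'$, $c_1\equiv_b c_2$, $c_2'\equiv_a c_3'$, $\dots$, $c_{2s-1}\equiv_b c_{2s}$, $c_{2s}'\equiv_a y$; - $x'\equiv y'$ iff $x'\equiv_b y'$ or there are $c_1,\dots,c_{2s}\in X$, $s\ge1$, with $x'\equiv_b c_1$, $c_1'\equiv_a c_2'$,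 $c_2\equiv_b c_3$, $\dots$, $c_{2s-1}'\equiv_a c_{2s}'$, $c_{2s}\equiv_b y'$; - $x\equiv y'$ iff $y'\equiv x$ iff there are $c_1,\dots,c_{2s-1}\in X$, $s\ge 1$, with $x\equiv_a c_1'$, $c_1\equiv_b c_2$, $c_2'\equiv_a c_3'$, $\dots$, $c_{2s-2}'\equiv_a c_{2s-1}'$, $c_{2s-1}\equiv_b y'$. Multiplication on $\mathcal{PIP}_X$: let $0\notin X$, $Y=X\cup\{0\}$. For $a\in\mathcal{PIP}_X$ let $\hat a\in\mathcal{IP}_Y$ consist of all lines of $a$ together with one extra block consisting of $0$, $0'$ and all elements of $X\cup X'$ that are points of $a$. The map $a\mapsto\hat a$ is a bijection from $\mathcal{PIP}_X$ onto the set of elements of $\mathcal{IP}_Y$ in which $0$ and $0'$ lie in the same block, and this set is a subsemigroup of $\mathcal{IP}_Y$. The product on $\mathcal{PIP}_X$ is defined by $\widehat{a\cdot b}=\hat a\cdot\hat b$. For $X=\{1,\dots,n\}$ write $\mathcal{PIP}_n$; it is a monoid with identity $\{\{t,t'\}\}_{t\in X}$. Elements of $\mathcal{PIP}_n$, for $1\le i\le n-1$: $s_i=\{\{i,(i+1)'\},\{i',i+1\},\{t,t'\}_{t\ne i,i+1}\}$, $r_i=\{\{i,i+1,i'\},\{(i+1)'\},\{t,t'\}_{t\neq i,i+1}\}$, $l_i=\{\{i,i',(i+1)'\},\{i+1\},\{t,t'\}_{t\ne i,i+1}\}$. **The monoid $S$.** $S$ is the monoid with identity $e$ generated by $\sigma_1,\dots,\sigma_{n-1}$,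 $\lambda_1,\dots,\lambda_{n-1}$, $\rho_1,\dots,\rho_{n-1}$, $e_1,\dots,e_n$ subject to the following relations (for all indices for which every symbol occurring is defined, subject to the stated restrictions): - $\sigma_i^2=e$; $\sigma_i\sigma_j=\sigma_j\sigma_i$ for $|i-j|>1$; $\sigma_i\sigma_j\sigma_i=\sigma_j\sigma_i\sigma_j$ for $|i-j|=1$; - $\lambda_i\lambda_j=\lambda_j\lambda_i$, $\rho_i\rho_j=\rho_j\rho_i$, $\rho_i\lambda_j=\lambda_j\rho_i$ for $|i-j|>1$; - $\lambda_i\rho_{i+1}=\sigma_{i+1}\rho_i\lambda_ie_{i+2}=\sigma_i\rho_{i+1}\sigma_i\lambda_i$, $\ \lambda_{i+1}\rho_i=e_{i+2}\rho_i\lambda_i\sigma_{i+1}=\rho_i\sigma_i\lambda_{i+1}\sigma_i$; - $\rho_i\lambda_{i+1}=\rho_ie_{i+2}$, $\rho_{i+1}\lambda_i=e_{i+2}\lambda_i$; - $\lambda_i\rho_i\lambda_i=\lambda_i$, $\rho_i\lambda_i\rho_i=\rho_i$; - $\sigma_i\lambda_j\sigma_i=\sigma_j\lambda_i\sigma_j$, $\sigma_i\rho_j\sigma_i=\sigma_j\rho_i\sigma_j$ for $|i-j|=1$; - $\lambda_i\sigma_i=\lambda_i$, $\sigma_i\rho_i=\rho_i$; - $\sigma_i\lambda_j=\lambda_j\sigma_i$, $\sigma_i\rho_j=\rho_j\sigma_i$ for $|i-j|>1$; - $\lambda_i\lambda_{i+1}=\lambda_i\lambda_{i+1}\sigma_i=\sigma_{i+1}\lambda_i\lambda_{i+1}$,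 $\ \rho_{i+1}\rho_i=\sigma_i\rho_{i+1}\rho_i=\rho_{i+1}\rho_i\sigma_{i+1}$; - $\sigma_{i+1}\lambda_{i+1}\lambda_i=\lambda_{i+1}\lambda_i=\lambda_ie_{i+2}$, $\ \rho_i\rho_{i+1}\sigma_{i+1}=\rho_i\rho_{i+1}=e_{i+2}\rho_i$; - $e_i=\lambda_{i-1}\rho_{i-1}$ for $i\ge2$, $e_1=\sigma_1e_2\sigma_1$; - $e_i^2=e_i$, $\ e_ie_{i+1}=e_{i+1}e_i=\lambda_i^2=\rho_i^2=\rho_i\sigma_i\lambda_i$; - $e_i\sigma_j=\sigma_je_i$ for $j\ne i,i-1$, $\ e_i\sigma_i=\sigma_ie_{i+1}$, $\sigma_ie_i=e_{i+1}\sigma_i$; - $e_i\lambda_j=\lambda_je_i$ for $j\neq i,i-1$, $\ e_{i+1}\lambda_i=\lambda_i$, $\ e_i\lambda_i=\lambda_ie_{i+1}=\lambda_ie_i=e_ie_{i+1}$; - $e_i\rho_j=\rho_je_i$ for $j\ne i,i-1$, $\ \rho_ie_{i+1}=\rho_i$, $\ \rho_ie_i=e_{i+1}\rho_i=e_i\rho_i=e_ie_{i+1}$. (By the relations, $S$ is generated by the $\sigma_i,\lambda_i,\rho_i$ alone.) *)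

theory Defs
  imports "HOL-Algebra.Group" "HOL-Library.Disjoint_Sets"
begin

section \<open>Partitions of \<open>X \<union> X'\<close> into lines and points\<close>

text \<open>The disjoint union of \<open>X\<close> and its copy \<open>X'\<close> is \<open>X <+> X\<close>: the element \<open>x\<close> is \<open>Inl x\<close> and
  the element \<open>x'\<close> is \<open>Inr x\<close>.\<close>

definition is_line :: "('a + 'a) set \<Rightarrow> bool" where
  "is_line A \<longleftrightarrow> A \<inter> range Inl \<noteq> {} \<and> A \<inter> range Inr \<noteq> {}"

definition is_point :: "('a + 'a) set \<Rightarrow> bool" where
  "is_point A \<longleftrightarrow> card A = 1"

definition IP :: "'a set \<Rightarrow> ('a + 'a) set set set" where
  "IP X = {a. partition_on (X <+> X) a \<and> (\<forall>A\<in>a. is_line A)}"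

definition PIP :: "'a set \<Rightarrow> ('a + 'a) set set set" where
  "PIP X = {a. partition_on (X <+> X) a \<and> (\<forall>A\<in>a. is_line A \<or> is_point A)}"

definition same_block :: "('a + 'a) set set \<Rightarrow> 'a + 'a \<Rightarrow> 'a + 'a \<Rightarrow> bool" where
  "same_block a u v \<longleftrightarrow> (\<exists>A\<in>a. u \<in> A \<and> v \<in> A)"

text \<open>In each of the following three definitions the sequence \<open>c 1, c 2, \<dots>\<close> is relevant only up to
  the stated length (\<open>2 * s\<close>, \<open>2 * s\<close> and \<open>2 * s - 1\<close>, respectively).\<close>

definition upper_chain ::
    "'a set \<Rightarrow> ('a + 'a) set set \<Rightarrow> ('a + 'a) set set \<Rightarrow> 'a \<Rightarrow> 'a \<Rightarrow> bool" where
  "upper_chain X a b x y \<longleftrightarrow>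
     (\<exists>(s::nat) (c :: nat \<Rightarrow> 'a). s \<ge> 1 \<and> (\<forall>k\<in>{1..2 * s}. c k \<in> X) \<and>
        same_block a (Inl x) (Inr (c 1)) \<and>
        (\<forall>k\<in>{1..s}. same_block b (Inl (c (2 * k - 1))) (Inl (c (2 * k)))) \<and>
        (\<forall>k\<in>{1..<s}. same_block a (Inr (c (2 * k))) (Inr (c (2 * k + 1)))) \<and>
        same_block a (Inr (c (2 * s))) (Inl y))"

definition lower_chain ::
    "'a set \<Rightarrow> ('a + 'a) set set \<Rightarrow> ('a + 'a) set set \<Rightarrow> 'a \<Rightarrow> 'a \<Rightarrow> bool" where
  "lower_chain X a b x y \<longleftrightarrow>
     (\<exists>(s::nat) (c :: nat \<Rightarrow> 'a). s \<ge> 1 \<and> (\<forall>k\<in>{1..2 * s}. c k \<in> X) \<and>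
        same_block b (Inr x) (Inl (c 1)) \<and>
        (\<forall>k\<in>{1..s}. same_block a (Inr (c (2 * k - 1))) (Inr (c (2 * k)))) \<and>
        (\<forall>k\<in>{1..<s}. same_block b (Inl (c (2 * k))) (Inl (c (2 * k + 1)))) \<and>
        same_block b (Inl (c (2 * s))) (Inr y))"

definition cross_chain ::
    "'a set \<Rightarrow> ('a + 'a) set set \<Rightarrow> ('a + 'a) set set \<Rightarrow> 'a \<Rightarrow> 'a \<Rightarrow> bool" where
  "cross_chain X a b x y \<longleftrightarrow>
     (\<exists>(s::nat) (c :: nat \<Rightarrow> 'a). s \<ge> 1 \<and> (\<forall>k\<in>{1..2 * s - 1}. c k \<in> X) \<and>
        same_block a (Inl x) (Inr (c 1)) \<and>
        (\<forall>k\<in>{1..<s}. same_block b (Inl (c (2 * k - 1))) (Inl (c (2 * k))) \<and>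
                      same_block a (Inr (c (2 * k))) (Inr (c (2 * k + 1)))) \<and>
        same_block b (Inl (c (2 * s - 1))) (Inr y))"

fun ip_rel ::
    "'a set \<Rightarrow> ('a + 'a) set set \<Rightarrow> ('a + 'a) set set \<Rightarrow> 'a + 'a \<Rightarrow> 'a + 'a \<Rightarrow> bool" where
  "ip_rel X a b (Inl x) (Inl y) \<longleftrightarrow> same_block a (Inl x) (Inl y) \<or> upper_chain X a b x y"
| "ip_rel X a b (Inr x) (Inr y) \<longleftrightarrow> same_block b (Inr x) (Inr y) \<or> lower_chain X a b x y"
| "ip_rel X a b (Inl x) (Inr y) \<longleftrightarrow> cross_chain X a b x y"
| "ip_rel X a b (Inr y) (Inl x) \<longleftrightarrow> cross_chain X a b x y"

definition ip_mult ::
    "'a set \<Rightarrow> ('a + 'a) set set \<Rightarrow> ('a + 'a) set set \<Rightarrow> ('a + 'a) set set" where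
  "ip_mult X a b =
     (X <+> X) // {(u, v). u \<in> X <+> X \<and> v \<in> X <+> X \<and> ip_rel X a b u v}"

text \<open>The extra element \<open>0\<close> is the natural number \<open>0\<close>, so the next two definitions are only
  meaningful for ground sets \<open>X\<close> with \<open>0 \<notin> X\<close>.\<close>

definition pip_hat :: "(nat + nat) set set \<Rightarrow> (nat + nat) set set" where
  "pip_hat a = {A \<in> a. is_line A} \<union> {{Inl 0, Inr 0} \<union> {u. {u} \<in> a}}"

definition pip_mult ::
    "nat set \<Rightarrow> (nat + nat) set set \<Rightarrow> (nat + nat) set set \<Rightarrow> (nat + nat) set set" where
  "pip_mult X a b =
     (THE c. c \<in> PIP X \<and> pip_hat c = ip_mult (insert 0 X) (pip_hat a) (pip_hat b))"

definition PIP_monoid :: "nat \<Rightarrow> (nat + nat) set set monoid" where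
  "PIP_monoid n =
     \<lparr>carrier = PIP {1..n},
      mult = pip_mult {1..n},
      one = {{Inl t, Inr t} | t. t \<in> {1..n}}\<rparr>"

definition other_lines :: "nat \<Rightarrow> nat \<Rightarrow> (nat + nat) set set" where
  "other_lines n i = {{Inl t, Inr t} | t. t \<in> {1..n} \<and> t \<noteq> i \<and> t \<noteq> i + 1}"

definition s_elt :: "nat \<Rightarrow> nat \<Rightarrow> (nat + nat) set set" where
  "s_elt n i = {{Inl i, Inr (i + 1)}, {Inr i, Inl (i + 1)}} \<union> other_lines n i"

definition r_elt :: "nat \<Rightarrow> nat \<Rightarrow> (nat + nat) set set" where
  "r_elt n i = {{Inl i, Inl (i + 1), Inr i}, {Inr (i + 1)}} \<union> other_lines n i"

definition l_elt :: "nat \<Rightarrow> nat \<Rightarrow> (nat + nat) set set" where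
  "l_elt n i = {{Inl i, Inr i, Inr (i + 1)}, {Inl (i + 1)}} \<union> other_lines n i"


section \<open>Monoid presentations\<close>

text \<open>The least congruence on the free monoid \<open>lists A\<close> containing those pairs of \<open>R\<close> both of whose
  sides are words over \<open>A\<close>.\<close>

inductive pres_cong :: "'g set \<Rightarrow> ('g list \<Rightarrow> 'g list \<Rightarrow> bool) \<Rightarrow> 'g list \<Rightarrow> 'g list \<Rightarrow> bool"
  for A :: "'g set" and R :: "'g list \<Rightarrow> 'g list \<Rightarrow> bool" where
  base: "R u v \<Longrightarrow> u \<in> lists A \<Longrightarrow> v \<in> lists A \<Longrightarrow> pres_cong A R u v"
| refl: "u \<in> lists A \<Longrightarrow> pres_cong A R u u"
| sym: "pres_cong A R u v \<Longrightarrow> pres_cong A R v u"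
| trans: "pres_cong A R u v \<Longrightarrow> pres_cong A R v w \<Longrightarrow> pres_cong A R u w"
| append: "pres_cong A R u v \<Longrightarrow> pres_cong A R u' v' \<Longrightarrow> pres_cong A R (u @ u') (v @ v')"

definition pres_class :: "'g set \<Rightarrow> ('g list \<Rightarrow> 'g list \<Rightarrow> bool) \<Rightarrow> 'g list \<Rightarrow> 'g list set" where
  "pres_class A R w = {v. pres_cong A R w v}"

definition presented_monoid ::
    "'g set \<Rightarrow> ('g list \<Rightarrow> 'g list \<Rightarrow> bool) \<Rightarrow> 'g list set monoid" where
  "presented_monoid A R =
     \<lparr>carrier = lists A // {(u, v). pres_cong A R u v},
      mult = (\<lambda>P Q. \<Union>u\<in>P. \<Union>v\<in>Q. pres_class A R (u @ v)),
      one = pres_class A R []\<rparr>"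


section \<open>The monoid \<open>S\<close>\<close>

datatype gen = Sig nat | Lam nat | Rho nat | Idp nat

text \<open>\<open>Sig i\<close>, \<open>Lam i\<close>, \<open>Rho i\<close> and \<open>Idp i\<close> stand for the generators \<open>\<sigma>\<close>, \<open>\<lambda>\<close>, \<open>\<rho>\<close> and \<open>e\<close> with
  index \<open>i\<close>.\<close>

definition S_gens :: "nat \<Rightarrow> gen set" where
  "S_gens n = Sig ` {1..n - 1} \<union> Lam ` {1..n - 1} \<union> Rho ` {1..n - 1} \<union> Idp ` {1..n}"

text \<open>The indices below range over all natural numbers. Relations in which some symbol is undefined
  for the given \<open>n\<close> are discarded by \<open>pres_cong\<close>. A chain of equalities is split into its successive
  equalities; in each chain the same indices make all symbols defined in every link.  The condition
  \<open>j + 1 \<noteq> i\<close> renders \<open>j \<noteq> i - 1\<close> without truncated subtraction.\<close>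

inductive S_rel :: "gen list \<Rightarrow> gen list \<Rightarrow> bool" (infix "\<doteq>" 50) where
  "[Sig i, Sig i] \<doteq> []"
| "\<bar>int i - int j\<bar> > 1 \<Longrightarrow> [Sig i, Sig j] \<doteq> [Sig j, Sig i]"
| "\<bar>int i - int j\<bar> = 1 \<Longrightarrow> [Sig i, Sig j, Sig i] \<doteq> [Sig j, Sig i, Sig j]"

| "\<bar>int i - int j\<bar> > 1 \<Longrightarrow> [Lam i, Lam j] \<doteq> [Lam j, Lam i]"
| "\<bar>int i - int j\<bar> > 1 \<Longrightarrow> [Rho i, Rho j] \<doteq> [Rho j, Rho i]"
| "\<bar>int i - int j\<bar> > 1 \<Longrightarrow> [Rho i, Lam j] \<doteq> [Lam j, Rho i]"

| "[Lam i, Rho (i+1)] \<doteq> [Sig (i+1), Rho i, Lam i, Idp (i+2)]"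
| "[Sig (i+1), Rho i, Lam i, Idp (i+2)] \<doteq> [Sig i, Rho (i+1), Sig i, Lam i]"
| "[Lam (i+1), Rho i] \<doteq> [Idp (i+2), Rho i, Lam i, Sig (i+1)]"
| "[Idp (i+2), Rho i, Lam i, Sig (i+1)] \<doteq> [Rho i, Sig i, Lam (i+1), Sig i]"

| "[Rho i, Lam (i+1)] \<doteq> [Rho i, Idp (i+2)]"
| "[Rho (i+1), Lam i] \<doteq> [Idp (i+2), Lam i]"

| "[Lam i, Rho i, Lam i] \<doteq> [Lam i]"
| "[Rho i, Lam i, Rho i] \<doteq> [Rho i]"

| "\<bar>int i - int j\<bar> = 1 \<Longrightarrow> [Sig i, Lam j, Sig i] \<doteq> [Sig j, Lam i, Sig j]"
| "\<bar>int i - int j\<bar> = 1 \<Longrightarrow> [Sig i, Rho j, Sig i] \<doteq> [Sig j, Rho i, Sig j]"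

| "[Lam i, Sig i] \<doteq> [Lam i]"
| "[Sig i, Rho i] \<doteq> [Rho i]"

| "\<bar>int i - int j\<bar> > 1 \<Longrightarrow> [Sig i, Lam j] \<doteq> [Lam j, Sig i]"
| "\<bar>int i - int j\<bar> > 1 \<Longrightarrow> [Sig i, Rho j] \<doteq> [Rho j, Sig i]"

| "[Lam i, Lam (i+1)] \<doteq> [Lam i, Lam (i+1), Sig i]"
| "[Lam i, Lam (i+1), Sig i] \<doteq> [Sig (i+1), Lam i, Lam (i+1)]"
| "[Rho (i+1), Rho i] \<doteq> [Sig i, Rho (i+1), Rho i]"
| "[Sig i, Rho (i+1), Rho i] \<doteq> [Rho (i+1), Rho i, Sig (i+1)]"

| "[Sig (i+1), Lam (i+1), Lam i] \<doteq> [Lam (i+1), Lam i]"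
| "[Lam (i+1), Lam i] \<doteq> [Lam i, Idp (i+2)]"
| "[Rho i, Rho (i+1), Sig (i+1)] \<doteq> [Rho i, Rho (i+1)]"
| "[Rho i, Rho (i+1)] \<doteq> [Idp (i+2), Rho i]"

| "i \<ge> 2 \<Longrightarrow> [Idp i] \<doteq> [Lam (i-1), Rho (i-1)]"
| "[Idp 1] \<doteq> [Sig 1, Idp 2, Sig 1]"

| "[Idp i, Idp i] \<doteq> [Idp i]"
| "[Idp i, Idp (i+1)] \<doteq> [Idp (i+1), Idp i]"
| "[Idp (i+1), Idp i] \<doteq> [Lam i, Lam i]"
| "[Lam i, Lam i] \<doteq> [Rho i, Rho i]"
| "[Rho i, Rho i] \<doteq> [Rho i, Sig i, Lam i]"

| "j \<noteq> i \<Longrightarrow> j + 1 \<noteq> i \<Longrightarrow> [Idp i, Sig j] \<doteq> [Sig j, Idp i]"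
| "[Idp i, Sig i] \<doteq> [Sig i, Idp (i+1)]"
| "[Sig i, Idp i] \<doteq> [Idp (i+1), Sig i]"

| "j \<noteq> i \<Longrightarrow> j + 1 \<noteq> i \<Longrightarrow> [Idp i, Lam j] \<doteq> [Lam j, Idp i]"
| "[Idp (i+1), Lam i] \<doteq> [Lam i]"
| "[Idp i, Lam i] \<doteq> [Lam i, Idp (i+1)]"
| "[Lam i, Idp (i+1)] \<doteq> [Lam i, Idp i]"
| "[Lam i, Idp i] \<doteq> [Idp i, Idp (i+1)]"

| "j \<noteq> i \<Longrightarrow> j + 1 \<noteq> i \<Longrightarrow> [Idp i, Rho j] \<doteq> [Rho j, Idp i]"
| "[Rho i, Idp (i+1)] \<doteq> [Rho i]"
| "[Rho i, Idp i] \<doteq> [Idp (i+1), Rho i]"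
| "[Idp (i+1), Rho i] \<doteq> [Idp i, Rho i]"
| "[Idp i, Rho i] \<doteq> [Idp i, Idp (i+1)]"

definition S_monoid :: "nat \<Rightarrow> gen list set monoid" where
  "S_monoid n = presented_monoid (S_gens n) S_rel"

definition S_elt :: "nat \<Rightarrow> gen \<Rightarrow> gen list set" where
  "S_elt n g = pres_class (S_gens n) S_rel [g]"

definition extends_assignment :: "nat \<Rightarrow> (gen list set \<Rightarrow> (nat + nat) set set) \<Rightarrow> bool" where
  "extends_assignment n \<phi> \<longleftrightarrow>
     \<phi> \<in> hom (S_monoid n) (PIP_monoid n) \<and>
     \<phi> \<one>\<^bsub>S_monoid n\<^esub> = \<one>\<^bsub>PIP_monoid n\<^esub> \<and>
     (\<forall>i\<in>{1..n - 1}. \<phi> (S_elt n (Sig i)) = s_elt n i \<and>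
                     \<phi> (S_elt n (Lam i)) = l_elt n i \<and>
                     \<phi> (S_elt n (Rho i)) = r_elt n i)"

end

theory Submission
  imports Defs "HOL-Combinatorics.Permutations"
begin

text \<open>The proof rests on a normal form. In \<open>S\<close> the \<open>\<sigma>\<close>'s satisfy the Coxeter relations, so every
  permutation \<open>p\<close> has a value \<open>P p\<close>, and conjugating \<open>\<rho>\<close> and \<open>\<lambda>\<close> with index 1 by permutations gives
  elements \<open>ro i j\<close> (merge \<open>j\<close> into \<open>i\<close>) and \<open>la i j\<close> for all \<open>i \<noteq> j\<close>. Each relation of the
  presentation, read at its smallest indices, is transported by conjugation to all indices. A
  word then reduces to \<open>R r \<cdot> P p \<cdot> L s\<close>, where \<open>R r\<close> is a commuting product of merges and of \<open>e\<close>'s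
  encoded by an idempotent map \<open>r\<close>, and \<open>L s\<close> is the analogous product of splittings: these
  elements are closed under right multiplication by the generators.

  On the other side, a partition \<open>a\<close> acts as a partial injection on the subsets of \<open>X\<close>: a set \<open>A\<close> is
  mapped to \<open>B\<close> if the union of \<open>A\<close> and \<open>B'\<close> is a union of lines of \<open>a\<close>. This action is faithful and
  turns products into composition, so the relations can be checked on subsets. The partial
  injection of a normal form determines the fibres of \<open>r\<close> and \<open>s\<close> and, once representatives are
  fixed, \<open>p\<close> on the image of \<open>r\<close>; hence equal partial injections force equal elements of \<open>S\<close>.\<close>

section \<open>Words in the generators and the symmetric group\<close>

text \<open>Apart from commutations of distant generators, the relations speak of neighbouring
  indices, and \<rho> and \<lambda> always give up the larger one. Conjugation removes this
  asymmetry; it is well defined because the stabiliser of 1 and 2 in the symmetric group is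
  generated by the \<sigma>'s with index at least 3, which commute with \<rho> and \<lambda> of
  index 1. Idempotence of the encoding map makes the order of the factors irrelevant: the target of
  a merge is never itself merged. A normal form is ambiguous in two ways: the representatives of the
  blocks are a choice, and the permutation is arbitrary off the representatives. Both ambiguities
  are absorbed inside S, by transpositions of two points of one block and by
  \<open>e i \<cdot> e j \<cdot> P (transpose i j) = e i \<cdot> e j\<close>. Subsets carry the
  action because a merge has no value on a single element of a block: a set has to contain the block
  or miss it, and points of the partition are always missed. Normal forms are kept as words, so that
  one and the same word is evaluated in S and on subsets.\<close>

primrec word_val :: "('m \<Rightarrow> 'm \<Rightarrow> 'm) \<Rightarrow> 'm \<Rightarrow> (gen \<Rightarrow> 'm) \<Rightarrow> gen list \<Rightarrow> 'm" where
  "word_val f z g [] = z"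
| "word_val f z g (x # w) = f (g x) (word_val f z g w)"

text \<open>The first letter acts first, so concatenation of words becomes composition in reverse
  order. This agrees with \<open>run\<close>, which also processes words from the left.\<close>

primrec wperm :: "nat list \<Rightarrow> nat \<Rightarrow> nat" where
  "wperm [] = id"
| "wperm (i # u) = wperm u \<circ> transpose i (Suc i)"

lemma wperm_append [simp]: "wperm (u @ v) = wperm v \<circ> wperm u"
  by (induction u) (auto simp: comp_assoc)

lemma wperm_rev: "wperm u \<circ> wperm (rev u) = id" "wperm (rev u) \<circ> wperm u = id"
proof -
  show "wperm (rev u) \<circ> wperm u = id" for u
    by (induction u) (auto simp: fun_eq_iff)
  from this [of "rev u"] show "wperm u \<circ> wperm (rev u) = id" by simp
qed

lemma wperm_permutes: "u \<in> lists {a..<b} \<Longrightarrow> wperm u permutes {a..<Suc b}"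
proof (induction u)
  case (Cons i u)
  then have "transpose i (Suc i) permutes {a..<Suc b}"
    by (intro permutes_swap_id) auto
  moreover have "wperm u permutes {a..<Suc b}" using Cons by simp
  ultimately show ?case unfolding wperm.simps by (rule permutes_compose)
qed (simp add: permutes_id)

text \<open>The words \<open>downw m k\<close> represent the cosets of the symmetric group on \<open>1, \<dots>, m\<close> in that on
  \<open>1, \<dots>, m + 1\<close>; the coset is determined by the image \<open>k\<close> of \<open>m + 1\<close>.\<close>

definition downw :: "nat \<Rightarrow> nat \<Rightarrow> nat list" where
  "downw m k = rev [k..<Suc m]"

lemma downw_lists: "a \<le> k \<Longrightarrow> downw m k \<in> lists {a..<Suc m}"
  by (auto simp: downw_def)

lemma downw_Suc: "k \<le> m \<Longrightarrow> downw m k = downw m (Suc k) @ [k]"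
  by (simp add: downw_def upt_conv_Cons del: upt_Suc)

lemma downw_empty [simp]: "downw m (Suc m) = []"
  by (simp add: downw_def)

lemma downw_split: "k \<le> j \<Longrightarrow> j \<le> Suc m \<Longrightarrow> downw m k = downw m j @ rev [k..<j]"
  unfolding downw_def by (metis rev_append upt_add_eq_append le_iff_add)

lemma wperm_downw: "k \<le> Suc m \<Longrightarrow> wperm (downw m k) (Suc m) = k"
proof (induction "Suc m - k" arbitrary: k)
  case (Suc d)
  then have "k \<le> m" by simp
  with Suc show ?case by (simp add: downw_Suc)
qed simp

text \<open>Induction on the number of points: the coset word \<open>downw m k\<close> for the image
  \<open>k\<close> of the top point is split off, and what remains fixes the top point. The lower
  bound \<open>a\<close> stays variable because \<open>cj_fixes\<close> needs words in the letters
  from 3 on.\<close>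

lemma permutes_upt_wperm:
  "p permutes {a..<Suc b} \<Longrightarrow> \<exists>u\<in>lists {a..<b}. wperm u = p"
proof (induction b arbitrary: p)
  case 0
  then have "p permutes {0::nat} \<or> p permutes {}" by (cases a) (auto simp: atLeastLessThanSuc)
  then have "p = id" by (auto simp: permutes_sing)
  then show ?case by (intro bexI [of _ "[]"]) auto
next
  case (Suc m)
  show ?case
  proof (cases "a \<le> Suc m")
    case False
    then have "p = id" using Suc.prems by simp
    then show ?thesis by (intro bexI [of _ "[]"]) auto
  next
    case True
    define k where "k = p (Suc m)"
    have k: "a \<le> k" "k \<le> Suc m"
      using permutes_in_image [OF Suc.prems, of "Suc m"] True by (auto simp: k_def)
    let ?d = "downw m k"
    have d: "?d \<in> lists {a..<Suc m}" using k downw_lists by simp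
    have dr: "wperm (rev ?d) permutes {a..<Suc (Suc m)}"
      by (intro wperm_permutes) (use d in auto)
    have q: "wperm (rev ?d) \<circ> p permutes {a..<Suc (Suc m)}"
      using permutes_compose [OF Suc.prems dr] .
    have "wperm (rev ?d) k = Suc m"
      using wperm_rev(2) [of ?d] wperm_downw [of k m] k by (metis comp_apply id_apply)
    then have "(wperm (rev ?d) \<circ> p) (Suc m) = Suc m" by (simp add: k_def)
    then have "wperm (rev ?d) \<circ> p permutes {a..<Suc m}"
      by (intro permutes_superset [OF q]) (auto simp: less_Suc_eq)
    from Suc.IH [OF this] obtain u where u: "u \<in> lists {a..<m}" "wperm u = wperm (rev ?d) \<circ> p"
      by blast
    have "wperm (u @ ?d) = p"
      using wperm_rev(1) [of ?d] by (simp add: u(2) comp_assoc [symmetric])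
    moreover have "u @ ?d \<in> lists {a..<Suc m}" using u d by fastforce
    ultimately show ?thesis by blast
  qed
qed

text \<open>An arbitrary choice of a word; by \<open>coxeter\<close> its value in the monoid does
  not depend on the choice.\<close>

definition permword :: "nat \<Rightarrow> (nat \<Rightarrow> nat) \<Rightarrow> nat list" where
  "permword n p = (SOME u. u \<in> lists {1..<n} \<and> wperm u = p)"

lemma permword:
  assumes "p permutes {1..n}"
  shows "permword n p \<in> lists {1..<n}" "wperm (permword n p) = p"
proof -
  have "{1..n} = {1..<Suc n}" by auto
  then have "\<exists>u. u \<in> lists {1..<n} \<and> wperm u = p"
    using permutes_upt_wperm [of p 1 n] assms by auto
  from someI_ex [OF this] show "permword n p \<in> lists {1..<n}" "wperm (permword n p) = p"
    unfolding permword_def by blast+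
qed

text \<open>The complements of \<open>A\<close> and of its image have equally many elements in
  \<open>S\<close>, so a bijection between them completes the injection \<open>f\<close>.\<close>

lemma permutes_extend:
  assumes "inj_on f A" "A \<subseteq> S" "f ` A \<subseteq> S" "finite S"
  obtains q where "q permutes S" "\<And>x. x \<in> A \<Longrightarrow> q x = f x"
proof -
  have fin: "finite A" "finite (f ` A)" using assms finite_subset by auto
  have "card (S - A) = card (S - f ` A)"
    using assms fin by (simp add: card_Diff_subset card_image)
  then obtain h where h: "bij_betw h (S - A) (S - f ` A)"
    using finite_same_card_bij [of "S - A" "S - f ` A"] assms by auto
  define q where "q x = (if x \<in> A then f x else if x \<in> S then h x else x)" for x
  have "bij_betw q A (f ` A)"
    using assms(1) by (intro bij_betw_imageI) (auto simp: q_def inj_on_def)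
  moreover have "bij_betw q (S - A) (S - f ` A)"
    using h by (rule bij_betw_cong [THEN iffD1, rotated]) (auto simp: q_def)
  ultimately have "bij_betw q (A \<union> (S - A)) (f ` A \<union> (S - f ` A))"
    by (rule bij_betw_combine) auto
  then have "bij_betw q S S" using assms by (simp add: Un_absorb1)
  then have "q permutes S" using assms by (intro bij_imp_permutes) (auto simp: q_def)
  then show ?thesis using that by (simp add: q_def)
qed

text \<open>A monoid on a whole type in which the defining relations hold. Working on a type instead
  of a carrier set keeps rewriting free of membership conditions; the instance used in the end
  consists of all functions on \<open>gen list set\<close>, with right multiplications as
  generators.\<close>

locale S_model =
  fixes n :: nat and mul :: "'m \<Rightarrow> 'm \<Rightarrow> 'm" (infixl "\<cdot>" 70) and unit :: 'm ("\<epsilon>")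
    and g :: "gen \<Rightarrow> 'm"
  assumes n3: "n \<ge> 3"
    and assoc: "(x \<cdot> y) \<cdot> z = x \<cdot> (y \<cdot> z)"
    and unit_left [simp]: "\<epsilon> \<cdot> x = x"
    and unit_right [simp]: "x \<cdot> \<epsilon> = x"
    and rel: "S_rel u v \<Longrightarrow> u \<in> lists (S_gens n) \<Longrightarrow> v \<in> lists (S_gens n) \<Longrightarrow>
      word_val (\<cdot>) \<epsilon> g u = word_val (\<cdot>) \<epsilon> g v"
begin

abbreviation val :: "gen list \<Rightarrow> 'm" where
  "val \<equiv> word_val (\<cdot>) \<epsilon> g"

lemma val_append [simp]: "val (u @ v) = val u \<cdot> val v"
  by (induction u) (simp_all add: assoc)

section \<open>The Coxeter presentation of the symmetric group\<close>

abbreviation sval :: "nat list \<Rightarrow> 'm" where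
  "sval u \<equiv> val (map Sig u)"

text \<open>Value and permutation are tracked together: the reduction of a word to coset form must
  preserve both, since triviality of the permutation is what forces the coset word to be
  empty.\<close>

definition eqv :: "nat list \<Rightarrow> nat list \<Rightarrow> bool" (infix "\<approx>" 50) where
  "u \<approx> v \<longleftrightarrow> sval u = sval v \<and> wperm u = wperm v"

lemma eqv_refl [simp, intro]: "u \<approx> u"
  by (simp add: eqv_def)

lemma eqv_trans [trans]: "u \<approx> v \<Longrightarrow> v \<approx> w \<Longrightarrow> u \<approx> w"
  by (simp add: eqv_def)

lemma eqv_append: "u \<approx> v \<Longrightarrow> u' \<approx> v' \<Longrightarrow> u @ u' \<approx> v @ v'"
  by (simp add: eqv_def)

lemma eqv_sq: "i \<in> {1..<n} \<Longrightarrow> [i, i] \<approx> []"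
  using rel [OF S_rel.intros(1) [of i]] by (auto simp: eqv_def S_gens_def)

lemma eqv_comm: "i \<in> {1..<n} \<Longrightarrow> j \<in> {1..<n} \<Longrightarrow> Suc i < j \<or> Suc j < i \<Longrightarrow> [i, j] \<approx> [j, i]"
  using rel [OF S_rel.intros(2) [of i j]]
  by (auto simp: eqv_def S_gens_def fun_eq_iff transpose_def)

lemma eqv_braid: "i \<in> {1..<n} \<Longrightarrow> Suc i \<in> {1..<n} \<Longrightarrow> [Suc i, i, Suc i] \<approx> [i, Suc i, i]"
  using rel [OF S_rel.intros(3) [of "Suc i" i]]
  by (auto simp: eqv_def S_gens_def fun_eq_iff transpose_def)

lemma eqv_comm_word:
  assumes "j \<in> {1..<n}" "set u \<subseteq> {1..<n}" "\<And>i. i \<in> set u \<Longrightarrow> Suc i < j \<or> Suc j < i"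
  shows "u @ [j] \<approx> [j] @ u"
  using assms(2,3)
proof (induction u)
  case (Cons i u)
  then have "u @ [j] \<approx> [j] @ u" by auto
  then have "[i] @ (u @ [j]) \<approx> [i] @ ([j] @ u)" by (rule eqv_append [OF eqv_refl])
  also have "[i] @ ([j] @ u) = [i, j] @ u" by simp
  also have "[i, j] @ u \<approx> [j, i] @ u"
    using Cons.prems assms(1) by (intro eqv_append eqv_comm) auto
  finally show ?case by simp
qed simp

text \<open>Coset enumeration. A letter far below the last letter \<open>k\<close> commutes to the
  front, \<open>j = k - 1\<close> lengthens the coset word, \<open>j = k\<close> cancels, and a
  letter above \<open>k\<close> is turned into \<open>j - 1\<close> by one braid relation in the
  middle and then commutes to the front.\<close>

lemma downw_step:
  assumes "Suc m < n" "j \<in> {1..Suc m}" "k \<in> {1..Suc (Suc m)}"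
  shows "\<exists>u'\<in>lists {1..<Suc m}. \<exists>k'\<in>{1..Suc (Suc m)}. downw (Suc m) k @ [j] \<approx> u' @ downw (Suc m) k'"
proof -
  let ?d = "downw (Suc m)"
  consider "Suc j < k" | "k = Suc j" | "j = k" | "k < j" by linarith
  then show ?thesis
  proof cases
    case 1
    have "?d k @ [j] \<approx> [j] @ ?d k"
      using assms 1 by (intro eqv_comm_word) (auto simp: downw_def)
    moreover have "[j] \<in> lists {1..<Suc m}" using 1 assms by auto
    ultimately show ?thesis using assms(3) by blast
  next
    case 2
    have "?d k @ [j] = [] @ ?d j" using assms 2 by (simp add: downw_Suc [of j])
    moreover have "j \<in> {1..Suc (Suc m)}" using assms by auto
    ultimately show ?thesis by (metis eqv_refl lists.Nil)
  next
    case 3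
    have "?d k @ [j] = ?d (Suc k) @ [k, k]" using assms 3 by (simp add: downw_Suc [of k])
    also have "?d (Suc k) @ [k, k] \<approx> ?d (Suc k) @ []"
      using assms 3 by (intro eqv_append eqv_sq) auto
    finally have "?d k @ [j] \<approx> [] @ ?d (Suc k)" by simp
    moreover have "Suc k \<in> {1..Suc (Suc m)}" using assms 3 by auto
    ultimately show ?thesis by blast
  next
    case 4
    then obtain i where i: "j = Suc i" "k \<le> i" by (cases j) auto
    have "[k..<Suc j] = [k..<i] @ [i, j]"
      using i by (simp add: upt_Suc_append)
    \<comment> \<open>Around the pair \<open>j, i\<close> the word splits into letters above
      \<open>j\<close>, which commute with \<open>i\<close>, and letters below \<open>i\<close>,
      which commute with \<open>j\<close>.\<close>
    then have split: "?d k = ?d (Suc j) @ [j, i] @ rev [k..<i]"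
      using downw_split [of k "Suc j" "Suc m"] 4 assms by simp
    have "?d k @ [j] = (?d (Suc j) @ [j, i]) @ (rev [k..<i] @ [j])" by (simp add: split)
    also have "\<dots> \<approx> (?d (Suc j) @ [j, i]) @ ([j] @ rev [k..<i])"
      by (rule eqv_append, simp, rule eqv_comm_word) (use i assms in auto)
    also have "\<dots> = ?d (Suc j) @ [j, i, j] @ rev [k..<i]" by simp
    also have "\<dots> \<approx> ?d (Suc j) @ [i, j, i] @ rev [k..<i]"
      unfolding i(1) by (intro eqv_append eqv_refl eqv_braid) (use i assms in auto)
    also have "\<dots> = (?d (Suc j) @ [i]) @ ([j, i] @ rev [k..<i])" by simp
    also have "\<dots> \<approx> ([i] @ ?d (Suc j)) @ ([j, i] @ rev [k..<i])"
      by (rule eqv_append [OF eqv_comm_word]) (use i assms in \<open>auto simp: downw_def\<close>)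
    also have "\<dots> = [i] @ ?d k" by (simp add: split)
    finally have "?d k @ [j] \<approx> [i] @ ?d k" .
    moreover have "[i] \<in> lists {1..<Suc m}" using i assms by auto
    ultimately show ?thesis using assms(3) by blast
  qed
qed

lemma downw_factor:
  assumes "Suc m < n" "u \<in> lists {1..Suc m}"
  shows "\<exists>u'\<in>lists {1..<Suc m}. \<exists>k\<in>{1..Suc (Suc m)}. u \<approx> u' @ downw (Suc m) k"
  using assms(2)
proof (induction u rule: rev_induct)
  case Nil
  have "[] \<approx> [] @ downw (Suc m) (Suc (Suc m))" by simp
  then show ?case by (intro bexI [of _ "[]"] bexI [of _ "Suc (Suc m)"]) auto
next
  case (snoc j u)
  then obtain u' k where u': "u' \<in> lists {1..<Suc m}" "k \<in> {1..Suc (Suc m)}"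
    "u \<approx> u' @ downw (Suc m) k" by (metis append_in_lists_conv)
  have "j \<in> {1..Suc m}" using snoc by auto
  from downw_step [OF assms(1) this u'(2)] obtain v k' where v: "v \<in> lists {1..<Suc m}"
    "k' \<in> {1..Suc (Suc m)}" "downw (Suc m) k @ [j] \<approx> v @ downw (Suc m) k'" by blast
  have "u @ [j] \<approx> u' @ (downw (Suc m) k @ [j])"
    using eqv_append [OF u'(3) eqv_refl [of "[j]"]] by simp
  also have "\<dots> \<approx> u' @ (v @ downw (Suc m) k')" by (intro eqv_append v(3)) simp
  finally have "u @ [j] \<approx> (u' @ v) @ downw (Suc m) k'" by simp
  moreover have "u' @ v \<in> lists {1..<Suc m}" using u' v by auto
  ultimately show ?case using v(2) by blast
qed

text \<open>The word equals a prefix without the largest letter followed by a coset word. A trivial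
  permutation fixes the largest point, so the coset word is empty and the induction hypothesis
  applies to the prefix.\<close>

lemma coxeter_trivial:
  "m < n \<Longrightarrow> u \<in> lists {1..m} \<Longrightarrow> wperm u = id \<Longrightarrow> sval u = \<epsilon>"
proof (induction m arbitrary: u)
  case (Suc m)
  from downw_factor [OF Suc.prems(1,2)] obtain u' k where u': "u' \<in> lists {1..<Suc m}"
    "k \<in> {1..Suc (Suc m)}" "u \<approx> u' @ downw (Suc m) k" by blast
  have "wperm u' (Suc (Suc m)) = Suc (Suc m)"
    using wperm_permutes [OF u'(1)] by (rule permutes_not_in) simp
  moreover have "wperm (u' @ downw (Suc m) k) = id" using u'(3) Suc.prems(3) by (metis eqv_def)
  ultimately have "wperm (downw (Suc m) k) (Suc (Suc m)) = Suc (Suc m)"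
    by (metis comp_apply id_apply wperm_append)
  then have k: "k = Suc (Suc m)" using u'(2) by (simp add: wperm_downw)
  have "u \<approx> u'" using u'(3) by (simp add: k)
  moreover have "sval u' = \<epsilon>"
    using Suc.IH [of u'] Suc.prems u'(1) \<open>u \<approx> u'\<close> by (auto simp: eqv_def atLeastLessThanSuc_atLeastAtMost)
  ultimately show ?case by (simp add: eqv_def)
qed auto

lemma sval_rev: "u \<in> lists {1..<n} \<Longrightarrow> sval (rev u) \<cdot> sval u = \<epsilon>"
proof (induction u)
  case (Cons i u)
  have "g (Sig i) \<cdot> g (Sig i) = \<epsilon>" using eqv_sq [of i] Cons.prems by (auto simp: eqv_def)
  then have "g (Sig i) \<cdot> (g (Sig i) \<cdot> x) = x" for x by (simp flip: assoc)
  with Cons show ?case by (auto simp: assoc)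
qed simp

lemma coxeter:
  assumes "u \<in> lists {1..<n}" "v \<in> lists {1..<n}" "wperm u = wperm v"
  shows "sval u = sval v"
proof -
  have "sval (u @ rev v) = \<epsilon>"
  proof (rule coxeter_trivial)
    show "n - 1 < n" using n3 by simp
    show "u @ rev v \<in> lists {1..n - 1}" using assms by fastforce
    show "wperm (u @ rev v) = id" using assms(3) wperm_rev(2) [of v] by simp
  qed
  then have "sval u \<cdot> sval (rev v) \<cdot> sval v = sval v" by simp
  then show ?thesis using sval_rev [OF assms(2)] by (simp add: assoc)
qed

end

section \<open>The relations in symmetric form\<close>

text \<open>The notation \<open>inv\<close> is taken by group inverses.\<close>

abbreviation pinv :: "('a \<Rightarrow> 'b) \<Rightarrow> 'b \<Rightarrow> 'a" where
  "pinv f \<equiv> inv_into UNIV f"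

text \<open>The conjugate of the letter \<open>w\<close> by some permutation that carries 1, 2 to
  \<open>i\<close>, \<open>j\<close>, kept as a word so that both the monoid and \<open>run\<close>
  can evaluate it. Independence of the chosen permutation is \<open>pr_eq\<close>.\<close>

definition pairw :: "nat \<Rightarrow> gen \<Rightarrow> nat \<Rightarrow> nat \<Rightarrow> gen list" where
  "pairw n w i j = (let q = SOME q. q permutes {1..n} \<and> q 1 = i \<and> q 2 = j
     in map Sig (permword n (pinv q)) @ [w] @ map Sig (permword n q))"

section \<open>Conjugation by permutations\<close>

context S_model
begin

definition P :: "(nat \<Rightarrow> nat) \<Rightarrow> 'm" where
  "P p = sval (permword n p)"

definition cj :: "(nat \<Rightarrow> nat) \<Rightarrow> 'm \<Rightarrow> 'm" where
  "cj q x = P (pinv q) \<cdot> x \<cdot> P q"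

definition pr :: "gen \<Rightarrow> nat \<Rightarrow> nat \<Rightarrow> 'm" where
  "pr w i j = val (pairw n w i j)"

lemma wperm_permutes': "u \<in> lists {1..<n} \<Longrightarrow> wperm u permutes {1..n}"
  using wperm_permutes [of u 1 n] by (simp add: atLeastLessThanSuc_atLeastAtMost)

lemma sval_eq_P: "u \<in> lists {1..<n} \<Longrightarrow> sval u = P (wperm u)"
  unfolding P_def using permword [OF wperm_permutes'] by (intro coxeter) auto

lemma P_id [simp]: "P id = \<epsilon>"
  using sval_eq_P [of "[]"] by simp

text \<open>Words act from their left end, hence the reversed composition. As a consequence
  \<open>cj\<close> is a left action of the permutations, see \<open>cj_cj\<close>.\<close>

lemma P_comp: "p permutes {1..n} \<Longrightarrow> q permutes {1..n} \<Longrightarrow> P p \<cdot> P q = P (q \<circ> p)"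
  using sval_eq_P [of "permword n p @ permword n q"] permword [of p n] permword [of q n]
  by (simp add: P_def)

lemma P_inv: "p permutes {1..n} \<Longrightarrow> P (pinv p) \<cdot> P p = \<epsilon>" "p permutes {1..n} \<Longrightarrow> P p \<cdot> P (pinv p) = \<epsilon>"
  by (simp_all add: P_comp permutes_inv permutes_inv_o)

lemma P_inv_left: "p permutes {1..n} \<Longrightarrow> P (pinv p) \<cdot> (P p \<cdot> x) = x"
  "p permutes {1..n} \<Longrightarrow> P p \<cdot> (P (pinv p) \<cdot> x) = x"
  by (simp_all add: P_inv flip: assoc)

lemma P_Sig: "i \<in> {1..<n} \<Longrightarrow> g (Sig i) = P (transpose i (Suc i))"
  using sval_eq_P [of "[i]"] by simp

lemma cj_mul: "q permutes {1..n} \<Longrightarrow> cj q (x \<cdot> y) = cj q x \<cdot> cj q y"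
  by (simp add: cj_def assoc P_inv_left)

lemma cj_id [simp]: "cj id x = x"
  by (simp add: cj_def)

lemma cj_cj:
  assumes "p permutes {1..n}" "q permutes {1..n}"
  shows "cj p (cj q x) = cj (p \<circ> q) x"
proof -
  have "cj p (cj q x) = (P (pinv p) \<cdot> P (pinv q)) \<cdot> x \<cdot> (P q \<cdot> P p)"
    by (simp add: cj_def assoc)
  also have "\<dots> = cj (p \<circ> q) x"
    using assms by (simp add: P_comp permutes_inv cj_def o_inv_distrib permutes_bij)
  finally show ?thesis .
qed

text \<open>The first form transports relations between indices; the second moves \<open>P q\<close>
  to the left across an element of a product.\<close>

lemma cj_swap: "cj q x = y \<longleftrightarrow> x \<cdot> P q = P q \<cdot> y" if "q permutes {1..n}"
proof
  assume "cj q x = y"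
  then show "x \<cdot> P q = P q \<cdot> y"
    using that by (auto simp: cj_def assoc P_inv_left)
next
  assume "x \<cdot> P q = P q \<cdot> y"
  then show "cj q x = y"
    using that by (simp add: cj_def assoc P_inv_left)
qed

lemma cj_P: "q permutes {1..n} \<Longrightarrow> p permutes {1..n} \<Longrightarrow> cj q (P p) = P (q \<circ> p \<circ> pinv q)"
  by (simp add: cj_def P_comp permutes_inv permutes_compose comp_assoc)

lemma transpose_permutes: "i \<in> {1..n} \<Longrightarrow> j \<in> {1..n} \<Longrightarrow> transpose i j permutes {1..n}"
  by (rule permutes_swap_id)

lemma cj_transpose: "i \<in> {1..<n} \<Longrightarrow> cj (transpose i (Suc i)) x = g (Sig i) \<cdot> x \<cdot> g (Sig i)"
  by (simp add: cj_def P_Sig)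

text \<open>A permutation that fixes 1 and 2 is a product of adjacent transpositions with index at
  least 3, and each of these commutes with \<open>x\<close>.\<close>

lemma cj_fixes:
  assumes "\<And>j. j \<in> {3..<n} \<Longrightarrow> x \<cdot> g (Sig j) = g (Sig j) \<cdot> x"
    and "p permutes {1..n}" "p 1 = 1" "p 2 = 2"
  shows "cj p x = x"
proof -
  have "p permutes {3..<Suc n}"
  proof (rule permutes_superset [OF assms(2)])
    fix y assume "y \<in> {1..n} - {3..<Suc n}"
    then have "y = 1 \<or> y = 2" by auto
    then show "p y = y" using assms(3,4) by auto
  qed
  from permutes_upt_wperm [OF this] obtain u where u: "u \<in> lists {3..<n}" "wperm u = p"
    by auto
  have "x \<cdot> sval u = sval u \<cdot> x"
    using u(1) by (induction u) (auto simp: assms(1) assoc simp flip: assoc [of x])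
  moreover have "u \<in> lists {1..<n}" using u(1) by auto
  ultimately have "x \<cdot> P p = P p \<cdot> x" using sval_eq_P u(2) by metis
  then show ?thesis using cj_swap [OF assms(2)] by simp
qed

lemma rep_perm:
  assumes "distinct [i,j,k,l]" "{i,j,k,l} \<subseteq> {1..n}" "n \<ge> 4"
  obtains q where "q permutes {1..n}" "q 1 = i" "q 2 = j" "q 3 = k" "q 4 = l"
proof -
  let ?f = "\<lambda>x::nat. if x = 1 then i else if x = 2 then j else if x = 3 then k else l"
  have "inj_on ?f {1,2,3,4}" using assms by (auto simp: inj_on_def)
  from permutes_extend [OF this, of "{1..n}"] obtain q where q: "q permutes {1..n}"
    "\<And>x. x \<in> {1,2,3,4} \<Longrightarrow> q x = ?f x" using assms by auto
  then show ?thesis using that [OF q(1)] by auto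
qed

lemma rep_perm3:
  assumes "distinct [i,j,k]" "{i,j,k} \<subseteq> {1..n}"
  obtains q where "q permutes {1..n}" "q 1 = i" "q 2 = j" "q 3 = k"
proof -
  let ?f = "\<lambda>x::nat. if x = 1 then i else if x = 2 then j else k"
  have "inj_on ?f {1,2,3}" using assms by (auto simp: inj_on_def)
  from permutes_extend [OF this, of "{1..n}"] obtain q where q: "q permutes {1..n}"
    "\<And>x. x \<in> {1,2,3} \<Longrightarrow> q x = ?f x" using assms n3 by auto
  then show ?thesis using that [OF q(1)] by auto
qed

lemma rep_perm2:
  assumes "i \<noteq> j" "{i,j} \<subseteq> {1..n}"
  obtains q where "q permutes {1..n}" "q 1 = i" "q 2 = j"
proof -
  let ?f = "\<lambda>x::nat. if x = 1 then i else j"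
  have "inj_on ?f {1,2}" using assms by (auto simp: inj_on_def)
  from permutes_extend [OF this, of "{1..n}"] obtain q where q: "q permutes {1..n}"
    "\<And>x. x \<in> {1,2} \<Longrightarrow> q x = ?f x" using assms n3 by auto
  then show ?thesis using that [OF q(1)] by auto
qed

text \<open>The hypothesis of \<open>cj_fixes\<close> for a generator; it turns
  \<open>pr w i j\<close> into a function of the pair of indices alone.\<close>

definition stable :: "gen \<Rightarrow> bool" where
  "stable w \<longleftrightarrow> (\<forall>j\<in>{3..<n}. g w \<cdot> g (Sig j) = g (Sig j) \<cdot> g w)"

text \<open>Two permutations with the same values at 1 and 2 differ by one that fixes both, and
  \<open>cj_fixes\<close> removes it.\<close>

lemma pr_eq:
  assumes "stable w" "q permutes {1..n}"
  shows "pr w (q 1) (q 2) = cj q (g w)"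
proof -
  define q' where "q' = (SOME q'. q' permutes {1..n} \<and> q' 1 = q 1 \<and> q' 2 = q 2)"
  have q': "q' permutes {1..n}" "q' 1 = q 1" "q' 2 = q 2"
    using someI_ex [of "\<lambda>q'. q' permutes {1..n} \<and> q' 1 = q 1 \<and> q' 2 = q 2"] assms(2)
    unfolding q'_def by blast+
  have "pr w (q 1) (q 2) = cj q' (g w)"
    unfolding pr_def pairw_def Let_def q'_def [symmetric] by (simp add: cj_def P_def assoc)
  also have "q' = q \<circ> (pinv q \<circ> q')"
    using permutes_inv_o [OF assms(2)] by (simp flip: comp_assoc)
  also have "cj \<dots> (g w) = cj q (cj (pinv q \<circ> q') (g w))"
    using assms(2) q' by (simp add: cj_cj permutes_inv permutes_compose)
  also have "cj (pinv q \<circ> q') (g w) = g w"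
    by (rule cj_fixes) (use assms q' in \<open>auto simp: stable_def permutes_inv permutes_compose
      permutes_inverses\<close>)
  finally show ?thesis .
qed

lemma cj_pr:
  assumes "stable w" "p permutes {1..n}" "i \<noteq> j" "{i,j} \<subseteq> {1..n}"
  shows "cj p (pr w i j) = pr w (p i) (p j)"
proof -
  obtain q where q: "q permutes {1..n}" "q 1 = i" "q 2 = j"
    using rep_perm2 assms by blast
  have "cj p (pr w i j) = cj p (cj q (g w))" using pr_eq [OF assms(1) q(1)] q by simp
  also have "\<dots> = cj (p \<circ> q) (g w)" using assms q by (simp add: cj_cj)
  also have "\<dots> = pr w ((p \<circ> q) 1) ((p \<circ> q) 2)"
    using assms q by (intro pr_eq [symmetric]) (auto intro: permutes_compose)
  finally show ?thesis using q by simp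
qed

section \<open>Relations at the smallest indices and their conjugates\<close>

declare One_nat_def [simp del]

abbreviation "ro \<equiv> pr (Rho 1)"
abbreviation "la \<equiv> pr (Lam 1)"
abbreviation "e i \<equiv> g (Idp i)"

lemma rel':
  assumes "S_rel u v" "set u \<subseteq> S_gens n" "set v \<subseteq> S_gens n"
  shows "val u = val v"
  using assms by (intro rel) (auto simp: in_lists_conv_set)

lemma gens [simp]:
  "Sig i \<in> S_gens n \<longleftrightarrow> 1 \<le> i \<and> i < n" "Lam i \<in> S_gens n \<longleftrightarrow> 1 \<le> i \<and> i < n"
  "Rho i \<in> S_gens n \<longleftrightarrow> 1 \<le> i \<and> i < n" "Idp i \<in> S_gens n \<longleftrightarrow> 1 \<le> i \<and> i \<le> n"
  using n3 by (auto simp: S_gens_def)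

lemma stable_Rho: "stable (Rho 1)"
  unfolding stable_def
proof
  fix j assume "j \<in> {3..<n}"
  with n3 rel' [OF S_rel.intros(20) [of j 1]]
  show "g (Rho 1) \<cdot> g (Sig j) = g (Sig j) \<cdot> g (Rho 1)" by simp
qed

lemma stable_Lam: "stable (Lam 1)"
  unfolding stable_def
proof
  fix j assume "j \<in> {3..<n}"
  with n3 rel' [OF S_rel.intros(19) [of j 1]]
  show "g (Lam 1) \<cdot> g (Sig j) = g (Sig j) \<cdot> g (Lam 1)" by simp
qed

text \<open>Joins the commutation of \<open>e i\<close> with distant \<sigma>'s and the two exchange
  relations into one equivariance law.\<close>

lemma e_Sig:
  assumes "i \<in> {1..n}" "j \<in> {1..<n}"
  shows "e i \<cdot> g (Sig j) = g (Sig j) \<cdot> e (transpose j (Suc j) i)"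
proof -
  consider "i = j" | "i = Suc j" | "j \<noteq> i" "j + 1 \<noteq> i" by force
  then show ?thesis
  proof cases
    case 1 then show ?thesis using rel' [OF S_rel.intros(37) [of i]] assms by (simp add: Suc_eq_plus1)
  next
    case 2 then show ?thesis using rel' [OF S_rel.intros(38) [of j]] assms by (simp add: Suc_eq_plus1)
  next
    case 3 then show ?thesis using rel' [OF S_rel.intros(36) [of j i]] assms by simp
  qed
qed

lemma e_sval:
  "u \<in> lists {1..<n} \<Longrightarrow> i \<in> {1..n} \<Longrightarrow> e i \<cdot> sval u = sval u \<cdot> e (wperm u i)"
proof (induction u arbitrary: i)
  case (Cons j u)
  then have "transpose j (Suc j) i \<in> {1..n}" by (auto simp: transpose_def)
  with Cons show ?case by (simp add: e_Sig assoc flip: assoc [of "e i"])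
qed simp

lemma cj_e: "q permutes {1..n} \<Longrightarrow> i \<in> {1..n} \<Longrightarrow> cj q (e i) = e (q i)"
  using e_sval [of "permword n q" i] permword [of q n] by (simp add: cj_swap P_def)

lemma cj_ro: "p permutes {1..n} \<Longrightarrow> i \<noteq> j \<Longrightarrow> i \<in> {1..n} \<Longrightarrow> j \<in> {1..n} \<Longrightarrow>
    cj p (ro i j) = ro (p i) (p j)"
  using cj_pr [OF stable_Rho] by simp

lemma cj_la: "p permutes {1..n} \<Longrightarrow> i \<noteq> j \<Longrightarrow> i \<in> {1..n} \<Longrightarrow> j \<in> {1..n} \<Longrightarrow>
    cj p (la i j) = la (p i) (p j)"
  using cj_pr [OF stable_Lam] by simp

lemma cj_P_transpose:
  assumes "q permutes {1..n}" "i \<in> {1..n}" "j \<in> {1..n}"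
  shows "cj q (P (transpose i j)) = P (transpose (q i) (q j))"
proof -
  have "q \<circ> transpose i j \<circ> pinv q = transpose (q i) (q j)"
    using permutes_inverses [OF assms(1)] by (auto simp: fun_eq_iff transpose_def)
  then show ?thesis using assms by (simp add: cj_P transpose_permutes)
qed

lemmas cj_simps = cj_mul cj_e cj_ro cj_la cj_P_transpose

text \<open>The conjugation relation for neighbouring indices is solved for the generator with the
  larger index. The two transpositions together carry the pair \<open>i, i + 1\<close> to
  \<open>i + 1, i + 2\<close>.\<close>

lemma Rho_Suc: "i \<in> {1..<n} \<Longrightarrow> Suc i \<in> {1..<n} \<Longrightarrow>
    g (Rho (Suc i)) = cj (transpose i (Suc i)) (cj (transpose (Suc i) (Suc (Suc i))) (g (Rho i)))"
  and Lam_Suc: "i \<in> {1..<n} \<Longrightarrow> Suc i \<in> {1..<n} \<Longrightarrow>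
    g (Lam (Suc i)) = cj (transpose i (Suc i)) (cj (transpose (Suc i) (Suc (Suc i))) (g (Lam i)))"
proof -
  assume i: "i \<in> {1..<n}" "Suc i \<in> {1..<n}"
  have sq: "g (Sig i) \<cdot> g (Sig i) = \<epsilon>" "g (Sig i) \<cdot> (g (Sig i) \<cdot> x) = x" for x
    using eqv_sq [of i] i by (simp_all add: eqv_def flip: assoc)
  have *: "y = g (Sig i) \<cdot> z \<cdot> g (Sig i)" if "g (Sig i) \<cdot> y \<cdot> g (Sig i) = z" for y z
    unfolding that [symmetric] by (simp add: assoc sq)
  show "g (Rho (Suc i)) = cj (transpose i (Suc i)) (cj (transpose (Suc i) (Suc (Suc i))) (g (Rho i)))"
    using rel' [OF S_rel.intros(16) [of i "Suc i"]] i
    unfolding cj_transpose [OF i(1)] cj_transpose [OF i(2)] by (intro *) (simp add: assoc)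
  show "g (Lam (Suc i)) = cj (transpose i (Suc i)) (cj (transpose (Suc i) (Suc (Suc i))) (g (Lam i)))"
    using rel' [OF S_rel.intros(15) [of i "Suc i"]] i
    unfolding cj_transpose [OF i(1)] cj_transpose [OF i(2)] by (intro *) (simp add: assoc)
qed

lemma Rho_eq: "1 \<le> i \<Longrightarrow> i < n \<Longrightarrow> g (Rho i) = ro i (Suc i)"
proof (induction i rule: nat_induct_at_least)
  case base
  show ?case using pr_eq [OF stable_Rho permutes_id] by simp
next
  case (Suc i)
  then show ?case by (subst Rho_Suc) (auto simp: cj_ro transpose_permutes)
qed

lemma Lam_eq: "1 \<le> i \<Longrightarrow> i < n \<Longrightarrow> g (Lam i) = la i (Suc i)"
proof (induction i rule: nat_induct_at_least)
  case base
  show ?case using pr_eq [OF stable_Lam permutes_id] by simp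
next
  case (Suc i)
  then show ?case by (subst Lam_Suc) (auto simp: cj_la transpose_permutes)
qed

lemma gens_small:
  "g (Rho 1) = ro 1 2" "g (Lam 1) = la 1 2" "g (Rho 2) = ro 2 3" "g (Lam 2) = la 2 3"
  "g (Sig 1) = P (transpose 1 2)" "g (Sig 2) = P (transpose 2 3)"
  using n3 Rho_eq [of 1] Lam_eq [of 1] Rho_eq [of 2] Lam_eq [of 2] P_Sig [of 1] P_Sig [of 2]
  by (simp_all add: numeral_2_eq_2 numeral_3_eq_3)

lemma e_idem: "i \<in> {1..n} \<Longrightarrow> e i \<cdot> e i = e i"
  using rel' [OF S_rel.intros(31) [of i]] by simp

lemma ee_12: "e 1 \<cdot> e 2 = e 2 \<cdot> e 1" "e 2 \<cdot> e 1 = la 1 2 \<cdot> la 1 2"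
  using rel' [OF S_rel.intros(32) [of 1]] rel' [OF S_rel.intros(33) [of 1]] n3
  by (simp_all add: gens_small)

lemma base_12:
  "ro 1 2 \<cdot> e 2 = ro 1 2" "e 2 \<cdot> la 1 2 = la 1 2"
  "ro 1 2 \<cdot> e 1 = e 1 \<cdot> e 2" "e 1 \<cdot> ro 1 2 = e 1 \<cdot> e 2" "e 2 \<cdot> ro 1 2 = e 1 \<cdot> e 2"
  "e 1 \<cdot> la 1 2 = e 1 \<cdot> e 2" "la 1 2 \<cdot> e 1 = e 1 \<cdot> e 2" "la 1 2 \<cdot> e 2 = e 1 \<cdot> e 2"
  "P (transpose 1 2) \<cdot> ro 1 2 = ro 1 2"
  "la 1 2 \<cdot> P (transpose 1 2) = la 1 2"
  using rel' [OF S_rel.intros(45) [of 1]] rel' [OF S_rel.intros(40) [of 1]]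
    rel' [OF S_rel.intros(46) [of 1]] rel' [OF S_rel.intros(47) [of 1]]
    rel' [OF S_rel.intros(48) [of 1]] rel' [OF S_rel.intros(41) [of 1]]
    rel' [OF S_rel.intros(42) [of 1]] rel' [OF S_rel.intros(43) [of 1]]
    rel' [OF S_rel.intros(18) [of 1]]
    rel' [OF S_rel.intros(17) [of 1]] n3
  by (simp_all add: gens_small)

lemma LR_base: "la 1 2 \<cdot> ro 1 2 = e 2"
  using rel' [OF S_rel.intros(29) [of 2]] n3 by (simp add: gens_small flip: One_nat_def)

text \<open>The following families are the images of their instances at the indices 1, 2, 3, 4 under
  conjugation by permutations.\<close>

lemma rels_2:
  assumes "i \<noteq> j" "i \<in> {1..n}" "j \<in> {1..n}"
  shows "e i \<cdot> e j = e j \<cdot> e i" "e i \<cdot> e j \<cdot> P (transpose i j) = e i \<cdot> e j"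
    "ro i j \<cdot> e j = ro i j" "e j \<cdot> la i j = la i j"
    "ro i j \<cdot> e i = e i \<cdot> e j" "e i \<cdot> ro i j = e i \<cdot> e j" "e j \<cdot> ro i j = e i \<cdot> e j"
    "e i \<cdot> la i j = e i \<cdot> e j" "la i j \<cdot> e i = e i \<cdot> e j" "la i j \<cdot> e j = e i \<cdot> e j"
    "la i j \<cdot> ro i j = e j" "P (transpose i j) \<cdot> ro i j = ro i j"
    "la i j \<cdot> P (transpose i j) = la i j"
proof -
  obtain q where q: "q permutes {1..n}" "q 1 = i" "q 2 = j"
    using rep_perm2 assms by blast
  \<comment> \<open>\<open>e 1 \<cdot> e 2\<close> is the square of \<open>la 1 2\<close>, which
    absorbs the transposition on its right.\<close>
  have ee: "e 1 \<cdot> e 2 \<cdot> P (transpose 1 2) = e 1 \<cdot> e 2"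
    unfolding ee_12 assoc base_12 ..
  note * = arg_cong [of _ _ "cj q"]
  show "e i \<cdot> e j = e j \<cdot> e i" "e i \<cdot> e j \<cdot> P (transpose i j) = e i \<cdot> e j"
    "ro i j \<cdot> e j = ro i j" "e j \<cdot> la i j = la i j"
    "ro i j \<cdot> e i = e i \<cdot> e j" "e i \<cdot> ro i j = e i \<cdot> e j" "e j \<cdot> ro i j = e i \<cdot> e j"
    "e i \<cdot> la i j = e i \<cdot> e j" "la i j \<cdot> e i = e i \<cdot> e j" "la i j \<cdot> e j = e i \<cdot> e j"
    "la i j \<cdot> ro i j = e j" "P (transpose i j) \<cdot> ro i j = ro i j"
    "la i j \<cdot> P (transpose i j) = la i j"
    using base_12 [THEN *] ee_12(1) [THEN *] ee [THEN *] LR_base [THEN *] n3 q(1)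
    by (simp_all add: cj_simps q)
qed

lemma comm_P: "q permutes {1..n} \<Longrightarrow> i \<noteq> j \<Longrightarrow> i \<in> {1..n} \<Longrightarrow> j \<in> {1..n} \<Longrightarrow>
    ro i j \<cdot> P q = P q \<cdot> ro (q i) (q j)"
  "q permutes {1..n} \<Longrightarrow> i \<noteq> j \<Longrightarrow> i \<in> {1..n} \<Longrightarrow> j \<in> {1..n} \<Longrightarrow>
    la i j \<cdot> P q = P q \<cdot> la (q i) (q j)"
  "q permutes {1..n} \<Longrightarrow> i \<in> {1..n} \<Longrightarrow> e i \<cdot> P q = P q \<cdot> e (q i)"
  by (simp_all add: cj_swap [symmetric] cj_simps)

text \<open>Moving the transposition across the factor exchanges the two indices, and the new factor
  absorbs it.\<close>

lemma rels_2':
  assumes "i \<noteq> j" "i \<in> {1..n}" "j \<in> {1..n}"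
  shows "ro i j \<cdot> P (transpose i j) = ro j i" "P (transpose i j) \<cdot> la i j = la j i"
  using comm_P(1) [of "transpose i j" i j] comm_P(2) [of "transpose i j" j i]
    rels_2(12,13) [of j i] assms
  by (simp_all add: transpose_permutes transpose_commute)

lemma base_13:
  "P (transpose 1 2) \<cdot> ro 2 3 = ro 1 3 \<cdot> P (transpose 1 2)"
  "ro 1 2 \<cdot> P (transpose 2 3) = P (transpose 2 3) \<cdot> ro 1 3"
  "la 2 3 \<cdot> P (transpose 1 2) = P (transpose 1 2) \<cdot> la 1 3"
  "P (transpose 1 2) \<cdot> la 2 3 = la 1 3 \<cdot> P (transpose 1 2)"
  "P (transpose 2 3) \<cdot> la 1 2 = la 1 3 \<cdot> P (transpose 2 3)"
  using n3 comm_P(1) [of "transpose 1 2" 1 3] comm_P(1) [of "transpose 2 3" 1 2]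
   comm_P(2) [of "transpose 1 2" 2 3] comm_P(2) [of "transpose 1 2" 1 3] comm_P(2) [of "transpose 2 3" 1 3]
  by (simp_all add: transpose_permutes)

lemma swap_sq: "i \<in> {1..n} \<Longrightarrow> j \<in> {1..n} \<Longrightarrow> P (transpose i j) \<cdot> P (transpose i j) = \<epsilon>"
  by (simp add: P_comp transpose_permutes)

text \<open>The product on the left absorbs the transposition of 1 and 2 in front. Pushed to the
  right, the transposition renames 2 to 1 in the first factor and is absorbed by the second.\<close>

lemma R8_base: "ro 2 3 \<cdot> ro 1 2 = ro 1 3 \<cdot> ro 1 2"
proof -
  have "ro 2 3 \<cdot> ro 1 2 = P (transpose 1 2) \<cdot> ro 2 3 \<cdot> ro 1 2"
    using rel' [OF S_rel.intros(23) [of 1]] n3 by (simp add: gens_small assoc)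
  then show ?thesis by (simp add: base_13 assoc base_12)
qed

lemma L8_base: "la 1 2 \<cdot> la 2 3 = la 1 2 \<cdot> la 1 3"
proof -
  have "la 1 2 \<cdot> la 2 3 = la 1 2 \<cdot> (la 2 3 \<cdot> P (transpose 1 2))"
    using rel' [OF S_rel.intros(21) [of 1]] n3 by (simp add: gens_small assoc)
  also have "\<dots> = la 1 2 \<cdot> P (transpose 1 2) \<cdot> la 1 3" using base_13(3) by (simp add: assoc)
  finally show ?thesis by (simp add: base_12)
qed

lemma M1_base: "la 2 3 \<cdot> ro 1 2 = ro 1 2 \<cdot> la 1 3"
proof -
  have "la 2 3 \<cdot> ro 1 2 = ro 1 2 \<cdot> (P (transpose 1 2) \<cdot> la 2 3 \<cdot> P (transpose 1 2))"
    using rel' [OF S_rel.intros(9) [of 1]] rel' [OF S_rel.intros(10) [of 1]] n3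
    by (simp add: gens_small assoc)
  also have "P (transpose 1 2) \<cdot> la 2 3 \<cdot> P (transpose 1 2) = la 1 3"
    using n3 by (simp add: base_13(4) assoc swap_sq)
  finally show ?thesis .
qed

text \<open>The presentation gives \<open>la 1 2 \<cdot> ro 2 3 = ro 1 3 \<cdot> la 1 2\<close>,
  with the index 2 where 1 is wanted. Since \<open>la 1 2\<close> absorbs the transposition of 1 and
  2 on its right, that transposition can be inserted, moved past the \<rho> and cancelled.\<close>

lemma M2_base: "la 1 2 \<cdot> ro 1 3 = ro 1 3 \<cdot> la 1 2"
proof -
  have "la 1 2 \<cdot> ro 2 3 = P (transpose 1 2) \<cdot> ro 2 3 \<cdot> P (transpose 1 2) \<cdot> la 1 2"
    using rel' [OF S_rel.intros(7) [of 1]] rel' [OF S_rel.intros(8) [of 1]] n3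
    by (simp add: gens_small assoc)
  also have "P (transpose 1 2) \<cdot> ro 2 3 \<cdot> P (transpose 1 2) = ro 1 3"
    using n3 by (simp add: base_13(1) assoc swap_sq)
  finally have *: "la 1 2 \<cdot> ro 2 3 = ro 1 3 \<cdot> la 1 2" .
  have "la 1 2 \<cdot> ro 2 3 = la 1 2 \<cdot> P (transpose 1 2) \<cdot> ro 2 3" by (simp add: base_12)
  also have "\<dots> = la 1 2 \<cdot> ro 1 3 \<cdot> P (transpose 1 2)" by (simp add: assoc base_13)
  finally have "ro 1 3 \<cdot> la 1 2 \<cdot> P (transpose 1 2) =
    la 1 2 \<cdot> ro 1 3 \<cdot> (P (transpose 1 2) \<cdot> P (transpose 1 2))"
    by (simp add: * assoc)
  then show ?thesis using n3 by (simp add: swap_sq assoc base_12)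
qed

lemma rels_3:
  assumes "distinct [i,j,k]" "{i,j,k} \<subseteq> {1..n}"
  shows "ro j k \<cdot> ro i j = ro i k \<cdot> ro i j" "la i j \<cdot> la j k = la i j \<cdot> la i k"
    "la j k \<cdot> ro i j = ro i j \<cdot> la i k" "la i j \<cdot> ro i k = ro i k \<cdot> la i j"
    "e k \<cdot> ro i j = ro i j \<cdot> e k" "e k \<cdot> la i j = la i j \<cdot> e k"
proof -
  have e: "e 3 \<cdot> ro 1 2 = ro 1 2 \<cdot> e 3" "e 3 \<cdot> la 1 2 = la 1 2 \<cdot> e 3"
    using rel' [OF S_rel.intros(44) [of 1 3]] rel' [OF S_rel.intros(39) [of 1 3]] n3
    by (simp_all add: gens_small)
  obtain q where q: "q permutes {1..n}" "q 1 = i" "q 2 = j" "q 3 = k"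
    using rep_perm3 [OF assms] by metis
  note * = arg_cong [of _ _ "cj q"]
  show "ro j k \<cdot> ro i j = ro i k \<cdot> ro i j" "la i j \<cdot> la j k = la i j \<cdot> la i k"
    "la j k \<cdot> ro i j = ro i j \<cdot> la i k" "la i j \<cdot> ro i k = ro i k \<cdot> la i j"
    "e k \<cdot> ro i j = ro i j \<cdot> e k" "e k \<cdot> la i j = la i j \<cdot> e k"
    using R8_base [THEN *] L8_base [THEN *] M1_base [THEN *] M2_base [THEN *] e [THEN *] n3 q(1)
    by (simp_all add: cj_simps q)
qed

text \<open>The transposition of 2 and 3 is absorbed on the right of
  \<open>ro 2 3 \<cdot> ro 1 2\<close>. Pulled to the left it turns the product into
  \<open>ro 3 2 \<cdot> ro 1 3\<close>, to which \<open>rels_3\<close> applies at the indices 1, 3,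
  2.\<close>

lemma R7_base: "ro 1 3 \<cdot> ro 1 2 = ro 1 2 \<cdot> ro 1 3"
proof -
  have "ro 2 3 \<cdot> ro 1 2 = ro 2 3 \<cdot> (ro 1 2 \<cdot> P (transpose 2 3))"
    using rel' [OF S_rel.intros(23) [of 1]] rel' [OF S_rel.intros(24) [of 1]] n3
    by (simp add: gens_small assoc)
  also have "\<dots> = ro 2 3 \<cdot> P (transpose 2 3) \<cdot> ro 1 3" by (simp only: base_13 assoc)
  also have "\<dots> = ro 3 2 \<cdot> ro 1 3" using n3 by (simp add: rels_2')
  also have "\<dots> = ro 1 2 \<cdot> ro 1 3" using n3 by (intro rels_3) auto
  finally show ?thesis by (simp add: R8_base)
qed

lemma L7_base: "la 1 3 \<cdot> la 1 2 = la 1 2 \<cdot> la 1 3"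
proof -
  have "la 1 2 \<cdot> la 2 3 = P (transpose 2 3) \<cdot> la 1 2 \<cdot> la 2 3"
    using rel' [OF S_rel.intros(21) [of 1]] rel' [OF S_rel.intros(22) [of 1]] n3
    by (simp add: gens_small assoc)
  also have "\<dots> = la 1 3 \<cdot> (P (transpose 2 3) \<cdot> la 2 3)" by (simp only: base_13 assoc)
  also have "\<dots> = la 1 3 \<cdot> la 3 2" using n3 by (simp add: rels_2')
  also have "\<dots> = la 1 3 \<cdot> la 1 2" using n3 by (intro rels_3) auto
  finally show ?thesis by (simp add: L8_base)
qed

lemma rels_3':
  assumes "distinct [i,j,k]" "{i,j,k} \<subseteq> {1..n}"
  shows "ro i k \<cdot> ro i j = ro i j \<cdot> ro i k" "la i k \<cdot> la i j = la i j \<cdot> la i k"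
proof -
  obtain q where q: "q permutes {1..n}" "q 1 = i" "q 2 = j" "q 3 = k"
    using rep_perm3 [OF assms] by metis
  note * = arg_cong [of _ _ "cj q"]
  show "ro i k \<cdot> ro i j = ro i j \<cdot> ro i k" "la i k \<cdot> la i j = la i j \<cdot> la i k"
    using R7_base [THEN *] L7_base [THEN *] n3 q(1) by (simp_all add: cj_simps q)
qed

lemma rels_4:
  assumes "distinct [i,j,k,l]" "{i,j,k,l} \<subseteq> {1..n}"
  shows "ro i j \<cdot> ro k l = ro k l \<cdot> ro i j" "la i j \<cdot> la k l = la k l \<cdot> la i j"
    "ro i j \<cdot> la k l = la k l \<cdot> ro i j"
proof -
  have "card {i,j,k,l} \<le> card {1..n}" using assms(2) by (intro card_mono) auto
  \<comment> \<open>Four distinct indices guarantee that the generators with index 3 exist.\<close>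
  then have n4: "n \<ge> 4" using assms(1) by simp
  then have g4: "g (Rho 3) = ro 3 4" "g (Lam 3) = la 3 4"
    using Rho_eq [of 3] Lam_eq [of 3] by (simp_all)
  have b: "ro 1 2 \<cdot> ro 3 4 = ro 3 4 \<cdot> ro 1 2" "la 1 2 \<cdot> la 3 4 = la 3 4 \<cdot> la 1 2"
    "ro 1 2 \<cdot> la 3 4 = la 3 4 \<cdot> ro 1 2"
    using rel' [OF S_rel.intros(5) [of 1 3]] rel' [OF S_rel.intros(4) [of 1 3]]
      rel' [OF S_rel.intros(6) [of 1 3]] n4 by (simp_all add: gens_small g4)
  obtain q where q: "q permutes {1..n}" "q 1 = i" "q 2 = j" "q 3 = k" "q 4 = l"
    using rep_perm [OF assms n4] by metis
  note * = arg_cong [of _ _ "cj q"]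
  show "ro i j \<cdot> ro k l = ro k l \<cdot> ro i j" "la i j \<cdot> la k l = la k l \<cdot> la i j"
    "ro i j \<cdot> la k l = la k l \<cdot> ro i j"
    using b [THEN *] n4 q(1) by (simp_all add: cj_simps q)
qed

end

section \<open>Normal forms\<close>

text \<open>A map \<open>r\<close> encodes a partial partition: \<open>r x\<close> is the chosen representative of the block of \<open>x\<close>,
  and \<open>r x = 0\<close> means that \<open>x\<close> is a point.\<close>

definition repw :: "nat \<Rightarrow> gen \<Rightarrow> (nat \<Rightarrow> nat) \<Rightarrow> nat \<Rightarrow> gen list" where
  "repw n w r x = (if r x = x then [] else if r x = 0 then [Idp x] else pairw n w (r x) x)"

text \<open>Merges come before the permutation and splittings after it. The element depends on
  \<open>p\<close> only through its values on the representatives of \<open>r\<close>, see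
  \<open>nfv_eq\<close>.\<close>

definition nfw :: "nat \<Rightarrow> (nat \<Rightarrow> nat) \<Rightarrow> (nat \<Rightarrow> nat) \<Rightarrow> (nat \<Rightarrow> nat) \<Rightarrow> gen list" where
  "nfw n r p s = concat (map (repw n (Rho 1) r) [1..<Suc n]) @ map Sig (permword n p) @
     concat (map (repw n (Lam 1) s) [1..<Suc n])"

definition idem_map :: "nat \<Rightarrow> (nat \<Rightarrow> nat) \<Rightarrow> bool" where
  "idem_map n r \<longleftrightarrow> (\<forall>x\<in>{1..n}. r x \<le> n \<and> (r x \<noteq> 0 \<longrightarrow> r (r x) = r x))"

definition reps :: "nat \<Rightarrow> (nat \<Rightarrow> nat) \<Rightarrow> nat set" where
  "reps n r = {x \<in> {1..n}. r x = x}"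

text \<open>The condition on images says that \<open>p\<close> matches upper and lower halves of
  lines through their representatives.\<close>

definition good :: "nat \<Rightarrow> (nat \<Rightarrow> nat) \<Rightarrow> (nat \<Rightarrow> nat) \<Rightarrow> (nat \<Rightarrow> nat) \<Rightarrow> bool" where
  "good n r p s \<longleftrightarrow> idem_map n r \<and> idem_map n s \<and> p permutes {1..n} \<and> p ` reps n r = reps n s"

definition rerep :: "nat \<Rightarrow> (nat \<Rightarrow> nat) \<Rightarrow> nat \<Rightarrow> nat" where
  "rerep y r x = (if r x = r y then y else r x)"

definition kill :: "nat \<Rightarrow> (nat \<Rightarrow> nat) \<Rightarrow> nat \<Rightarrow> nat" where
  "kill z r x = (if r x = z then 0 else r x)"

lemma idem_mapD: "idem_map n r \<Longrightarrow> x \<in> {1..n} \<Longrightarrow> r x \<noteq> 0 \<Longrightarrow> r x \<in> {1..n} \<and> r (r x) = r x"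
  by (auto simp: idem_map_def)

section \<open>Ordered products in a monoid\<close>

context S_model
begin

definition lprod :: "('b \<Rightarrow> 'm) \<Rightarrow> 'b list \<Rightarrow> 'm" where
  "lprod f xs = foldr (\<lambda>x m. f x \<cdot> m) xs \<epsilon>"

lemma lprod_simps [simp]: "lprod f [] = \<epsilon>" "lprod f (x # xs) = f x \<cdot> lprod f xs"
  by (simp_all add: lprod_def)

lemma lprod_append [simp]: "lprod f (xs @ ys) = lprod f xs \<cdot> lprod f ys"
  by (induction xs) (simp_all add: assoc)

lemma lprod_map: "lprod f (map h xs) = lprod (\<lambda>x. f (h x)) xs"
  by (induction xs) simp_all

lemma lprod_cong: "(\<And>x. x \<in> set xs \<Longrightarrow> f x = f' x) \<Longrightarrow> lprod f xs = lprod f' xs"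
  by (induction xs) simp_all

lemma val_concat: "val (concat (map w xs)) = lprod (\<lambda>x. val (w x)) xs"
  by (induction xs) simp_all

lemma lprod_pass:
  "(\<And>x. x \<in> set xs \<Longrightarrow> f x \<cdot> t = t \<cdot> f' x) \<Longrightarrow> lprod f xs \<cdot> t = t \<cdot> lprod f' xs"
proof (induction xs)
  case (Cons x xs)
  then have "lprod f (x # xs) \<cdot> t = f x \<cdot> (t \<cdot> lprod f' xs)" by (simp add: assoc)
  also have "\<dots> = (f x \<cdot> t) \<cdot> lprod f' xs" by (simp add: assoc)
  also have "f x \<cdot> t = t \<cdot> f' x" using Cons.prems by simp
  finally show ?case by (simp add: assoc)
qed simp

text \<open>The element \<open>t\<close> travels to the left through the tail that has already been
  replaced, licenses the replacement at the next factor, and travels back.\<close>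

lemma lprod_subst:
  "(\<And>x. x \<in> set xs \<Longrightarrow> f x \<cdot> t = f' x \<cdot> t \<and> f' x \<cdot> t = t \<cdot> f' x) \<Longrightarrow>
   lprod f xs \<cdot> t = lprod f' xs \<cdot> t"
proof (induction xs)
  case (Cons x xs)
  have "lprod f' xs \<cdot> t = t \<cdot> lprod f' xs" using Cons.prems by (intro lprod_pass) simp
  moreover have "f x \<cdot> t = f' x \<cdot> t" using Cons.prems by simp
  ultimately show ?case using Cons by (simp add: assoc) (simp flip: assoc)
qed simp

lemma lprod_subst_left:
  "(\<And>x. x \<in> set xs \<Longrightarrow> t \<cdot> f x = t \<cdot> f' x \<and> f' x \<cdot> t = t \<cdot> f' x) \<Longrightarrow>
   t \<cdot> lprod f xs = t \<cdot> lprod f' xs"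
proof (induction xs)
  case (Cons x xs)
  have c: "t \<cdot> f x = f' x \<cdot> t" using Cons.prems by simp
  have "t \<cdot> lprod f (x # xs) = (t \<cdot> f x) \<cdot> lprod f xs" by (simp add: assoc)
  also have "\<dots> = f' x \<cdot> (t \<cdot> lprod f xs)" unfolding c by (simp add: assoc)
  also have "\<dots> = f' x \<cdot> (t \<cdot> lprod f' xs)" using Cons by simp
  also have "\<dots> = t \<cdot> lprod f' (x # xs)" using Cons.prems [of x] by (simp flip: assoc)
  finally show ?case .
qed simp

text \<open>\<open>t\<close> commutes past the later factors and is absorbed by the single factor at
  \<open>y\<close>.\<close>

lemma lprod_replace:
  assumes "distinct xs" "y \<in> set xs" "\<And>x. x \<in> set xs \<Longrightarrow> x \<noteq> y \<Longrightarrow> f x \<cdot> t = t \<cdot> f x" "f y \<cdot> t = f' y"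
    "\<And>x. x \<in> set xs \<Longrightarrow> x \<noteq> y \<Longrightarrow> f x = f' x"
  shows "lprod f xs \<cdot> t = lprod f' xs"
proof -
  obtain as bs where xs: "xs = as @ y # bs" using assms(2) by (auto simp: in_set_conv_decomp)
  have "lprod f as = lprod f' as" "lprod f bs = lprod f' bs"
    using assms(1,5) by (auto intro!: lprod_cong simp: xs)
  moreover have "lprod f bs \<cdot> t = t \<cdot> lprod f bs" using assms(1,3) by (intro lprod_pass) (auto simp: xs)
  ultimately show ?thesis by (simp add: xs assoc flip: assms(4))
qed

lemma lprod_replace_left:
  assumes "distinct xs" "y \<in> set xs" "\<And>x. x \<in> set xs \<Longrightarrow> x \<noteq> y \<Longrightarrow> f x \<cdot> t = t \<cdot> f x" "t \<cdot> f y = f' y"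
    "\<And>x. x \<in> set xs \<Longrightarrow> x \<noteq> y \<Longrightarrow> f x = f' x"
  shows "t \<cdot> lprod f xs = lprod f' xs"
proof -
  obtain as bs where xs: "xs = as @ y # bs" using assms(2) by (auto simp: in_set_conv_decomp)
  have *: "lprod f as = lprod f' as" "lprod f bs = lprod f' bs"
    using assms(1,5) by (auto intro!: lprod_cong simp: xs)
  moreover have "lprod f as \<cdot> t = t \<cdot> lprod f as" using assms(1,3) by (intro lprod_pass) (auto simp: xs)
  ultimately have "t \<cdot> lprod f xs = lprod f' as \<cdot> (t \<cdot> f y) \<cdot> lprod f' bs"
    by (simp add: xs assoc) (simp flip: assoc)
  then show ?thesis by (simp add: assms(4) xs assoc)
qed

text \<open>The factor at \<open>y\<close> can be brought to the end, where it swallows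
  \<open>t\<close>.\<close>

lemma lprod_absorb:
  assumes "y \<in> set xs" "\<And>x. x \<in> set xs \<Longrightarrow> f x \<cdot> f y = f y \<cdot> f x" "f y \<cdot> t = f y"
  shows "lprod f xs \<cdot> t = lprod f xs"
proof -
  obtain as bs where xs: "xs = as @ y # bs" using assms(1) by (auto simp: in_set_conv_decomp)
  have "lprod f bs \<cdot> f y = f y \<cdot> lprod f bs" using assms(2) by (intro lprod_pass) (auto simp: xs)
  then have "lprod f xs = lprod f as \<cdot> lprod f bs \<cdot> f y" by (simp add: xs assoc)
  then show ?thesis by (simp add: assoc assms(3))
qed

lemma lprod_absorb_left:
  assumes "y \<in> set xs" "\<And>x. x \<in> set xs \<Longrightarrow> f x \<cdot> f y = f y \<cdot> f x" "t \<cdot> f y = f y"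
  shows "t \<cdot> lprod f xs = lprod f xs"
proof -
  obtain as bs where xs: "xs = as @ y # bs" using assms(1) by (auto simp: in_set_conv_decomp)
  have "lprod f as \<cdot> f y = f y \<cdot> lprod f as" using assms(2) by (intro lprod_pass) (auto simp: xs)
  then have "lprod f xs = f y \<cdot> (lprod f as \<cdot> lprod f bs)" by (simp add: xs flip: assoc)
  then show ?thesis by (simp add: assms(3) flip: assoc)
qed

lemma lprod_perm:
  assumes "\<And>x y. x \<in> set xs \<Longrightarrow> y \<in> set xs \<Longrightarrow> f x \<cdot> f y = f y \<cdot> f x" "mset xs = mset ys"
  shows "lprod f xs = lprod f ys"
  using assms
proof (induction xs arbitrary: ys)
  case (Cons x xs)
  from Cons.prems(2) have "x \<in> set ys" by (metis list.set_intros(1) set_mset_mset)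
  then obtain as bs where ys: "ys = as @ x # bs" by (auto simp: in_set_conv_decomp)
  have "mset xs = mset (as @ bs)" using Cons.prems(2) ys by simp
  then have "lprod f xs = lprod f (as @ bs)" using Cons.prems(1) by (intro Cons.IH) auto
  moreover have "lprod f as \<cdot> f x = f x \<cdot> lprod f as"
    using Cons.prems mset_eq_setD [OF Cons.prems(2)] ys by (intro lprod_pass) auto
  ultimately show ?case by (simp add: ys) (simp flip: assoc)
qed simp

section \<open>The products of merges and of splittings\<close>

definition FR :: "(nat \<Rightarrow> nat) \<Rightarrow> nat \<Rightarrow> 'm" where
  "FR r x = (if r x = x then \<epsilon> else if r x = 0 then e x else ro (r x) x)"

definition FL :: "(nat \<Rightarrow> nat) \<Rightarrow> nat \<Rightarrow> 'm" where
  "FL r x = (if r x = x then \<epsilon> else if r x = 0 then e x else la (r x) x)"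

definition ixs :: "nat list" where "ixs = [1..<Suc n]"

definition R :: "(nat \<Rightarrow> nat) \<Rightarrow> 'm" where "R r = lprod (FR r) ixs"
definition L :: "(nat \<Rightarrow> nat) \<Rightarrow> 'm" where "L r = lprod (FL r) ixs"

definition nfv :: "(nat \<Rightarrow> nat) \<Rightarrow> (nat \<Rightarrow> nat) \<Rightarrow> (nat \<Rightarrow> nat) \<Rightarrow> 'm" where
  "nfv r p s = R r \<cdot> P p \<cdot> L s"

lemma val_nfw: "val (nfw n r p s) = nfv r p s"
proof -
  have "(\<lambda>x. val (repw n (Rho 1) r x)) = FR r" "(\<lambda>x. val (repw n (Lam 1) s x)) = FL s"
    by (auto simp: fun_eq_iff repw_def FR_def FL_def pr_def)
  then show ?thesis by (simp add: nfw_def nfv_def val_concat R_def L_def ixs_def P_def assoc del: upt_Suc)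
qed

lemma set_ixs [simp]: "x \<in> set ixs \<longleftrightarrow> x \<in> {1..n}" "set ixs = {1..n}" "distinct ixs"
  by (auto simp: ixs_def)

lemma R_cong: "(\<And>x. x \<in> {1..n} \<Longrightarrow> r x = r' x) \<Longrightarrow> R r = R r'"
  unfolding R_def by (intro lprod_cong) (auto simp: FR_def)

lemma L_cong: "(\<And>x. x \<in> {1..n} \<Longrightarrow> r x = r' x) \<Longrightarrow> L r = L r'"
  unfolding L_def by (intro lprod_cong) (auto simp: FL_def)

lemma e_comm: "i \<in> {1..n} \<Longrightarrow> j \<in> {1..n} \<Longrightarrow> e i \<cdot> e j = e j \<cdot> e i"
  by (cases "i = j") (auto intro: rels_2(1))

lemma e_ro_comm: "distinct [i,j,k] \<Longrightarrow> i \<in> {1..n} \<Longrightarrow> j \<in> {1..n} \<Longrightarrow> k \<in> {1..n} \<Longrightarrow> e k \<cdot> ro i j = ro i j \<cdot> e k"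
  using rels_3(5) [of i j k] by simp

lemma e_la_comm: "distinct [i,j,k] \<Longrightarrow> i \<in> {1..n} \<Longrightarrow> j \<in> {1..n} \<Longrightarrow> k \<in> {1..n} \<Longrightarrow> e k \<cdot> la i j = la i j \<cdot> e k"
  using rels_3(6) [of i j k] by simp

lemma ro_ro_comm: "i \<noteq> j \<Longrightarrow> k \<noteq> l \<Longrightarrow> i \<noteq> l \<Longrightarrow> k \<noteq> j \<Longrightarrow> j \<noteq> l \<Longrightarrow> {i,j,k,l} \<subseteq> {1..n} \<Longrightarrow> ro i j \<cdot> ro k l = ro k l \<cdot> ro i j"
proof (cases "i = k")
  case True
  assume "i \<noteq> j" "k \<noteq> l" "i \<noteq> l" "k \<noteq> j" "j \<noteq> l" "{i,j,k,l} \<subseteq> {1..n}"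
  with True show ?thesis using rels_3'(1) [of i l j] by simp
next
  case False
  assume "i \<noteq> j" "k \<noteq> l" "i \<noteq> l" "k \<noteq> j" "j \<noteq> l" "{i,j,k,l} \<subseteq> {1..n}"
  with False show ?thesis using rels_4(1) [of i j k l] by simp
qed

lemma la_la_comm: "i \<noteq> j \<Longrightarrow> k \<noteq> l \<Longrightarrow> i \<noteq> l \<Longrightarrow> k \<noteq> j \<Longrightarrow> j \<noteq> l \<Longrightarrow> {i,j,k,l} \<subseteq> {1..n} \<Longrightarrow> la i j \<cdot> la k l = la k l \<cdot> la i j"
proof (cases "i = k")
  case True
  assume "i \<noteq> j" "k \<noteq> l" "i \<noteq> l" "k \<noteq> j" "j \<noteq> l" "{i,j,k,l} \<subseteq> {1..n}"
  with True show ?thesis using rels_3'(2) [of i l j] by simp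
next
  case False
  assume "i \<noteq> j" "k \<noteq> l" "i \<noteq> l" "k \<noteq> j" "j \<noteq> l" "{i,j,k,l} \<subseteq> {1..n}"
  with False show ?thesis using rels_4(2) [of i j k l] by simp
qed

lemma la_ro_comm: "i \<noteq> j \<Longrightarrow> k \<noteq> l \<Longrightarrow> i \<noteq> l \<Longrightarrow> k \<noteq> j \<Longrightarrow> j \<noteq> l \<Longrightarrow> {i,j,k,l} \<subseteq> {1..n} \<Longrightarrow> la i j \<cdot> ro k l = ro k l \<cdot> la i j"
proof (cases "i = k")
  case True
  assume "i \<noteq> j" "k \<noteq> l" "i \<noteq> l" "k \<noteq> j" "j \<noteq> l" "{i,j,k,l} \<subseteq> {1..n}"
  with True show ?thesis using rels_3(4) [of i j l] by simp
next
  case False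
  assume "i \<noteq> j" "k \<noteq> l" "i \<noteq> l" "k \<noteq> j" "j \<noteq> l" "{i,j,k,l} \<subseteq> {1..n}"
  with False show ?thesis using rels_4(3) [of k l i j] by simp
qed

lemma FR_cases:
  assumes "idem_map n r" "x \<in> {1..n}"
  obtains "FR r x = \<epsilon>" | "FR r x = e x" "r x \<noteq> x"
    | z where "FR r x = ro z x" "r x \<noteq> x" "r z = z" "z \<in> {1..n}" "r x = z"
  using idem_mapD [OF assms] unfolding FR_def by metis

text \<open>The target of a merge is a fixed point of \<open>r\<close> and its source is not, so the
  source of one factor is never the target of another. For such factors the symmetric relations are
  commutations.\<close>

lemma FR_comm:
  assumes "idem_map n r" "x \<in> {1..n}" "y \<in> {1..n}"
  shows "FR r x \<cdot> FR r y = FR r y \<cdot> FR r x"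
proof (cases "x = y")
  case False
  show ?thesis
  proof (rule FR_cases [OF assms(1,2)]; rule FR_cases [OF assms(1,3)])
    assume "FR r x = e x" "FR r y = e y"
    then show ?thesis using assms by (simp add: e_comm)
  next
    fix z assume "FR r x = e x" "r x \<noteq> x" "FR r y = ro z y" "r y \<noteq> y" "r z = z" "z \<in> {1..n}" "r y = z"
    moreover from this have "z \<noteq> x" "z \<noteq> y" by metis+
    ultimately show ?thesis using assms False e_ro_comm [of z y x] by simp
  next
    fix z assume "FR r x = ro z x" "r x \<noteq> x" "r z = z" "z \<in> {1..n}" "r x = z" "FR r y = e y" "r y \<noteq> y"
    moreover from this have "z \<noteq> x" "z \<noteq> y" by metis+
    ultimately show ?thesis using assms False e_ro_comm [of z x y] by simp
  next
    fix z z' assume "FR r x = ro z x" "r x \<noteq> x" "r z = z" "z \<in> {1..n}" "r x = z"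
      "FR r y = ro z' y" "r y \<noteq> y" "r z' = z'" "z' \<in> {1..n}" "r y = z'"
    moreover from this have "z \<noteq> x" "z \<noteq> y" "z' \<noteq> x" "z' \<noteq> y" by metis+
    ultimately show ?thesis using assms False ro_ro_comm [of z x z' y] by simp
  qed simp_all
qed simp

lemma FL_cases:
  assumes "idem_map n r" "x \<in> {1..n}"
  obtains "FL r x = \<epsilon>" | "FL r x = e x" "r x \<noteq> x"
    | z where "FL r x = la z x" "r x \<noteq> x" "r z = z" "z \<in> {1..n}" "r x = z"
  using idem_mapD [OF assms] unfolding FL_def by metis

lemma FL_comm:
  assumes "idem_map n r" "x \<in> {1..n}" "y \<in> {1..n}"
  shows "FL r x \<cdot> FL r y = FL r y \<cdot> FL r x"
proof (cases "x = y")
  case False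
  show ?thesis
  proof (rule FL_cases [OF assms(1,2)]; rule FL_cases [OF assms(1,3)])
    assume "FL r x = e x" "FL r y = e y"
    then show ?thesis using assms by (simp add: e_comm)
  next
    fix z assume "FL r x = e x" "r x \<noteq> x" "FL r y = la z y" "r y \<noteq> y" "r z = z" "z \<in> {1..n}" "r y = z"
    moreover from this have "z \<noteq> x" "z \<noteq> y" by metis+
    ultimately show ?thesis using assms False e_la_comm [of z y x] by simp
  next
    fix z assume "FL r x = la z x" "r x \<noteq> x" "r z = z" "z \<in> {1..n}" "r x = z" "FL r y = e y" "r y \<noteq> y"
    moreover from this have "z \<noteq> x" "z \<noteq> y" by metis+
    ultimately show ?thesis using assms False e_la_comm [of z x y] by simp
  next
    fix z z' assume "FL r x = la z x" "r x \<noteq> x" "r z = z" "z \<in> {1..n}" "r x = z"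
      "FL r y = la z' y" "r y \<noteq> y" "r z' = z'" "z' \<in> {1..n}" "r y = z'"
    moreover from this have "z \<noteq> x" "z \<noteq> y" "z' \<noteq> x" "z' \<noteq> y" by metis+
    ultimately show ?thesis using assms False la_la_comm [of z x z' y] by simp
  qed simp_all
qed simp

lemma R_absorb: "idem_map n r \<Longrightarrow> y \<in> {1..n} \<Longrightarrow> FR r y \<cdot> t = FR r y \<Longrightarrow> R r \<cdot> t = R r"
  unfolding R_def by (rule lprod_absorb) (auto intro: FR_comm)

lemma R_absorb_left: "idem_map n r \<Longrightarrow> y \<in> {1..n} \<Longrightarrow> t \<cdot> FR r y = FR r y \<Longrightarrow> t \<cdot> R r = R r"
  unfolding R_def by (rule lprod_absorb_left) (auto intro: FR_comm)

lemma L_absorb: "idem_map n r \<Longrightarrow> y \<in> {1..n} \<Longrightarrow> FL r y \<cdot> t = FL r y \<Longrightarrow> L r \<cdot> t = L r"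
  unfolding L_def by (rule lprod_absorb) (auto intro: FL_comm)

lemma L_absorb_left: "idem_map n r \<Longrightarrow> y \<in> {1..n} \<Longrightarrow> t \<cdot> FL r y = FL r y \<Longrightarrow> t \<cdot> L r = L r"
  unfolding L_def by (rule lprod_absorb_left) (auto intro: FL_comm)

lemma idem_kill: "idem_map n r \<Longrightarrow> idem_map n (kill z r)"
  by (auto simp: idem_map_def kill_def)

lemma FR_e_comm:
  assumes "idem_map n r" "w \<in> {1..n}" "r w = w" "x \<in> {1..n}" "r x \<noteq> w"
  shows "FR r x \<cdot> e w = e w \<cdot> FR r x"
proof (rule FR_cases [OF assms(1,4)])
  assume "FR r x = e x"
  then show ?thesis using e_comm assms by simp
next
  fix z assume z: "FR r x = ro z x" "r x \<noteq> x" "r z = z" "z \<in> {1..n}" "r x = z"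
  then have "z \<noteq> x" "z \<noteq> w" "w \<noteq> x" using assms by auto
  then show ?thesis using e_ro_comm [of z x w] z assms by simp
qed simp

text \<open>Discarding a representative discards its block, because
  \<open>ro w x \<cdot> e w = e w \<cdot> e x\<close> for every \<open>x\<close> merged into
  \<open>w\<close>.\<close>

lemma R_e:
  assumes "idem_map n r" "w \<in> {1..n}" "r w = w"
  shows "R r \<cdot> e w = R (kill w r)"
proof -
  have "FR r x \<cdot> e w = FR (kill w r) x \<cdot> e w \<and> FR (kill w r) x \<cdot> e w = e w \<cdot> FR (kill w r) x"
    if x: "x \<in> {1..n}" for x
  proof -
    consider "x = w" | "x \<noteq> w" "r x = w" | "r x \<noteq> w" using assms(3) by auto
    then show ?thesis
    proof cases
      case 1 then show ?thesis using assms by (simp add: FR_def kill_def e_idem)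
    next
      case 2
      then have "FR r x = ro w x" "FR (kill w r) x = e x" using x assms(2) by (auto simp: FR_def kill_def)
      then show ?thesis using 2 x assms(2) rels_2(1,5) [of w x] by simp
    next
      case 3
      then have "FR (kill w r) x = FR r x" by (simp add: FR_def kill_def)
      then show ?thesis using FR_e_comm [OF assms x 3] by simp
    qed
  qed
  then have "R r \<cdot> e w = R (kill w r) \<cdot> e w"
    unfolding R_def by (intro lprod_subst) simp
  also have "\<dots> = R (kill w r)"
    using assms by (intro R_absorb [of _ w] idem_kill) (auto simp: FR_def kill_def e_idem)
  finally show ?thesis .
qed

text \<open>If \<open>x\<close> is attached to \<open>w\<close>, both products collapse to
  \<open>e w \<cdot> e x\<close>; the other cases are commutations of disjoint indices.\<close>

lemma FL_e_comm:
  assumes "idem_map n s" "w \<in> {1..n}" "x \<in> {1..n}" "x \<noteq> w"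
  shows "FL s x \<cdot> e w = e w \<cdot> FL s x"
proof (rule FL_cases [OF assms(1,3)])
  assume "FL s x = e x"
  then show ?thesis using e_comm assms by simp
next
  fix z assume z: "FL s x = la z x" "s x \<noteq> x" "s z = z" "z \<in> {1..n}" "s x = z"
  then have "z \<noteq> x" by auto
  show ?thesis
  proof (cases "z = w")
    case True then show ?thesis using z assms \<open>z \<noteq> x\<close> rels_2(8,9) [of z x] by simp
  next
    case False then show ?thesis using e_la_comm [of z x w] z assms \<open>z \<noteq> x\<close> by simp
  qed
qed simp

lemma L_e_left:
  assumes "idem_map n s" "z \<in> {1..n}" "s z = z"
  shows "e z \<cdot> L s = L (kill z s)"
proof -
  have "e z \<cdot> FL s x = e z \<cdot> FL (kill z s) x \<and> FL (kill z s) x \<cdot> e z = e z \<cdot> FL (kill z s) x"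
    if x: "x \<in> {1..n}" for x
  proof -
    consider "x = z" | "x \<noteq> z" "s x = z" | "s x \<noteq> z" using assms(3) by auto
    then show ?thesis
    proof cases
      case 1 then show ?thesis using assms by (simp add: FL_def kill_def e_idem)
    next
      case 2
      then have "FL s x = la z x" "FL (kill z s) x = e x" using x assms(2) by (auto simp: FL_def kill_def)
      then show ?thesis using 2 x assms(2) rels_2(1,8) [of z x] by simp
    next
      case 3
      then have "FL (kill z s) x = FL s x" by (simp add: FL_def kill_def)
      moreover have "x \<noteq> z" using 3 assms(3) by auto
      ultimately show ?thesis using FL_e_comm [OF assms(1,2) x] by simp
    qed
  qed
  then have "e z \<cdot> L s = e z \<cdot> L (kill z s)"
    unfolding L_def by (intro lprod_subst_left) simp
  also have "\<dots> = L (kill z s)"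
    using assms by (intro L_absorb_left [of _ z] idem_kill) (auto simp: FL_def kill_def e_idem)
  finally show ?thesis .
qed

text \<open>Discarding one element of a lower block is the same as discarding its representative
  beforehand: \<open>la z y \<cdot> e y\<close> and \<open>e z \<cdot> la z y\<close> both equal
  \<open>e z \<cdot> e y\<close>.\<close>

lemma L_e:
  assumes "idem_map n s" "y \<in> {1..n}" "s y \<noteq> 0"
  shows "L s \<cdot> e y = e (s y) \<cdot> L s"
proof -
  define z where "z = s y"
  have z: "z \<in> {1..n}" "s z = z" "s y = z" using idem_mapD [OF assms] by (auto simp: z_def)
  have zc: "FL s x \<cdot> e z = e z \<cdot> FL s x" if "x \<in> {1..n}" for x
  proof (cases "x = z")
    case True then show ?thesis using z by (simp add: FL_def)
  next
    case False then show ?thesis using FL_e_comm [OF assms(1) z(1) that] by simp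
  qed
  have "L s \<cdot> e y = e z \<cdot> L s"
  proof (cases "z = y")
    case True
    show ?thesis using zc unfolding L_def True by (intro lprod_pass) simp
  next
    case False
    then have y: "FL s y = la z y" using z by (auto simp: FL_def)
    let ?f = "(FL s)(y := e z \<cdot> e y)"
    have "L s \<cdot> e y = lprod ?f ixs" unfolding L_def
    proof (rule lprod_replace)
      fix x assume x: "x \<in> set ixs" "x \<noteq> y"
      show "FL s x \<cdot> e y = e y \<cdot> FL s x"
      proof (rule FL_cases [OF assms(1), of x])
        assume "FL s x = e x"
        then show ?thesis using e_comm assms x by simp
      next
        fix v assume v: "FL s x = la v x" "s x \<noteq> x" "s v = v" "v \<in> {1..n}" "s x = v"
        moreover have "v \<noteq> y" using v z False by auto
        moreover have "v \<noteq> x" using v by auto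
        ultimately show ?thesis using e_la_comm [of v x y] assms x by simp
      qed (use x in auto)
    qed (use False z assms rels_2(10) [of z y] y in auto)
    also have "\<dots> = e z \<cdot> L s" unfolding L_def
      by (rule lprod_replace_left [symmetric])
        (use False z assms rels_2(8) [of z y] y zc in auto)
    finally show ?thesis .
  qed
  then show ?thesis by (simp add: z_def)
qed

text \<open>The marker 0 for points lies outside the permuted set, so conjugation of an encoding
  respects it.\<close>

lemma perm_zero: "q permutes {1..n} \<Longrightarrow> q 0 = 0"
  by (rule permutes_not_in) auto

lemma perm_zero_iff: "q permutes {1..n} \<Longrightarrow> q x = 0 \<longleftrightarrow> x = 0"
  using perm_zero permutes_inj [of q] by (metis injD)

lemma mset_map_ixs:
  assumes "q permutes {1..n}"
  shows "mset (map q ixs) = mset ixs"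
proof -
  have "distinct (map q ixs)"
    using permutes_inj [OF assms] by (auto simp: distinct_map inj_on_def inj_def)
  moreover have "set (map q ixs) = set ixs" using permutes_image [OF assms] by simp
  ultimately show ?thesis using set_eq_iff_mset_eq_distinct [of "map q ixs" ixs] by simp
qed

lemma idem_conj: "idem_map n r \<Longrightarrow> q permutes {1..n} \<Longrightarrow> idem_map n (q \<circ> r \<circ> pinv q)"
  unfolding idem_map_def
proof (intro ballI conjI impI)
  fix x assume *: "\<forall>x\<in>{1..n}. r x \<le> n \<and> (r x \<noteq> 0 \<longrightarrow> r (r x) = r x)" "q permutes {1..n}" "x \<in> {1..n}"
  then have y: "pinv q x \<in> {1..n}" using permutes_in_image [OF permutes_inv] by metis
  show "(q \<circ> r \<circ> pinv q) x \<le> n"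
    using *(1) y permutes_in_image [OF *(2), of "r (pinv q x)"] perm_zero [OF *(2)]
    by (cases "r (pinv q x) = 0") auto
  assume "(q \<circ> r \<circ> pinv q) x \<noteq> 0"
  then have "r (pinv q x) \<noteq> 0" using perm_zero_iff [OF *(2)] by auto
  then show "(q \<circ> r \<circ> pinv q) ((q \<circ> r \<circ> pinv q) x) = (q \<circ> r \<circ> pinv q) x"
    using *(1) y permutes_inverses [OF *(2)] by auto
qed

text \<open>Each factor is relabelled by \<open>q\<close>, which leaves the factors in the order
  given by \<open>q\<close>; their commutation restores the standard order.\<close>

lemma R_P:
  assumes "idem_map n r" "q permutes {1..n}"
  shows "R r \<cdot> P q = P q \<cdot> R (q \<circ> r \<circ> pinv q)"
proof -
  let ?r = "q \<circ> r \<circ> pinv q"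
  have "R r \<cdot> P q = P q \<cdot> lprod (\<lambda>x. FR ?r (q x)) ixs"
    unfolding R_def
  proof (rule lprod_pass)
    fix x assume x: "x \<in> set ixs"
    have "?r (q x) = q (r x)" by (simp add: permutes_inverses [OF assms(2)])
    then have F: "FR ?r (q x) = (if r x = x then \<epsilon> else if r x = 0 then e (q x) else ro (q (r x)) (q x))"
      unfolding FR_def by (simp add: perm_zero_iff [OF assms(2)] inj_eq [OF permutes_inj [OF assms(2)]])
    show "FR r x \<cdot> P q = P q \<cdot> FR ?r (q x)"
    proof (cases "r x = x \<or> r x = 0")
      case True
      then have "FR r x = \<epsilon> \<and> FR ?r (q x) = \<epsilon> \<or> FR r x = e x \<and> FR ?r (q x) = e (q x)"
        unfolding F unfolding FR_def by argo
      then show ?thesis using x comm_P(3) [OF assms(2), of x] by (elim disjE) simp_all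
    next
      case False
      then have F': "FR r x = ro (r x) x" "FR ?r (q x) = ro (q (r x)) (q x)"
        unfolding F unfolding FR_def by simp_all
      have x': "x \<in> {1..n}" using x by simp
      have "r x \<noteq> x" "r x \<in> {1..n}" using False idem_mapD [OF assms(1) x'] by blast+
      with x' show ?thesis unfolding F' by (intro comm_P(1) [OF assms(2)])
    qed
  qed
  also have "lprod (\<lambda>x. FR ?r (q x)) ixs = lprod (FR ?r) (map q ixs)"
    by (simp add: lprod_map)
  also have "\<dots> = lprod (FR ?r) ixs"
  proof (rule lprod_perm)
    fix x y assume "x \<in> set (map q ixs)" "y \<in> set (map q ixs)"
    then show "FR ?r x \<cdot> FR ?r y = FR ?r y \<cdot> FR ?r x"
      by (intro FR_comm idem_conj assms) (simp_all only: set_map set_ixs permutes_image [OF assms(2)])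
  qed (simp only: mset_map_ixs [OF assms(2)])
  finally show ?thesis by (simp add: R_def)
qed

lemma L_P:
  assumes "idem_map n r" "q permutes {1..n}"
  shows "L r \<cdot> P q = P q \<cdot> L (q \<circ> r \<circ> pinv q)"
proof -
  let ?r = "q \<circ> r \<circ> pinv q"
  have "L r \<cdot> P q = P q \<cdot> lprod (\<lambda>x. FL ?r (q x)) ixs"
    unfolding L_def
  proof (rule lprod_pass)
    fix x assume x: "x \<in> set ixs"
    have "?r (q x) = q (r x)" by (simp add: permutes_inverses [OF assms(2)])
    then have F: "FL ?r (q x) = (if r x = x then \<epsilon> else if r x = 0 then e (q x) else la (q (r x)) (q x))"
      unfolding FL_def by (simp add: perm_zero_iff [OF assms(2)] inj_eq [OF permutes_inj [OF assms(2)]])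
    show "FL r x \<cdot> P q = P q \<cdot> FL ?r (q x)"
    proof (cases "r x = x \<or> r x = 0")
      case True
      then have "FL r x = \<epsilon> \<and> FL ?r (q x) = \<epsilon> \<or> FL r x = e x \<and> FL ?r (q x) = e (q x)"
        unfolding F unfolding FL_def by argo
      then show ?thesis using x comm_P(3) [OF assms(2), of x] by (elim disjE) simp_all
    next
      case False
      then have F': "FL r x = la (r x) x" "FL ?r (q x) = la (q (r x)) (q x)"
        unfolding F unfolding FL_def by simp_all
      have x': "x \<in> {1..n}" using x by simp
      have "r x \<noteq> x" "r x \<in> {1..n}" using False idem_mapD [OF assms(1) x'] by blast+
      with x' show ?thesis unfolding F' by (intro comm_P(2) [OF assms(2)])
    qed
  qed
  also have "lprod (\<lambda>x. FL ?r (q x)) ixs = lprod (FL ?r) (map q ixs)"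
    by (simp add: lprod_map)
  also have "\<dots> = lprod (FL ?r) ixs"
  proof (rule lprod_perm)
    fix x y assume "x \<in> set (map q ixs)" "y \<in> set (map q ixs)"
    then show "FL ?r x \<cdot> FL ?r y = FL ?r y \<cdot> FL ?r x"
      by (intro FL_comm idem_conj assms) (simp_all only: set_map set_ixs permutes_image [OF assms(2)])
  qed (simp only: mset_map_ixs [OF assms(2)])
  finally show ?thesis by (simp add: L_def)
qed

text \<open>Conjugation by the transposition of the old and the new representative changes nothing
  but the representative of that block. The equation is claimed on the indices
  \<open>{1..n}\<close>, which is what \<open>R_cong\<close> and \<open>L_cong\<close> ask
  for.\<close>

lemma rerep_conj:
  assumes "idem_map n r" "y \<in> {1..n}" "r y \<noteq> 0" "x \<in> {1..n}"
  shows "(transpose (r y) y \<circ> r \<circ> pinv (transpose (r y) y)) x = rerep y r x"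
proof -
  have z: "r (r y) = r y" using idem_mapD [OF assms(1-3)] by simp
  have nz: "r x \<noteq> y" if "r y \<noteq> y" using that idem_mapD [OF assms(1,4)] assms(2) by auto
  have "transpose (r y) y (r (transpose (r y) y x)) = rerep y r x"
  proof -
    consider "x = r y" | "x = y" | "x \<noteq> r y" "x \<noteq> y" "r x = r y" | "x \<noteq> r y" "x \<noteq> y" "r x \<noteq> r y"
      by blast
    then show ?thesis
    proof cases
      case 4
      then show ?thesis using nz by (cases "r y = y") (simp_all add: rerep_def transpose_def)
    qed (simp_all add: rerep_def z)
  qed
  then show ?thesis by simp
qed

lemma idem_rerep: "idem_map n r \<Longrightarrow> y \<in> {1..n} \<Longrightarrow> r y \<noteq> 0 \<Longrightarrow> idem_map n (rerep y r)"
  by (auto simp: idem_map_def rerep_def)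

text \<open>\<open>L r\<close> absorbs on the right the transposition of two elements of one block.
  Moving it to the left across the product conjugates the encoding, that is, changes the
  representative.\<close>

lemma L_rerep:
  assumes "idem_map n r" "y \<in> {1..n}" "r y \<noteq> 0"
  shows "L r = P (transpose (r y) y) \<cdot> L (rerep y r)"
proof -
  have z: "r y \<in> {1..n}" "r (r y) = r y" using idem_mapD [OF assms] by auto
  have "L r \<cdot> P (transpose (r y) y) = L r"
    by (rule L_absorb [OF assms(1,2)])
      (use assms z rels_2(13) [of "r y" y] in \<open>auto simp: FL_def\<close>)
  moreover have "L r \<cdot> P (transpose (r y) y) = P (transpose (r y) y) \<cdot> L (rerep y r)"
    unfolding L_P [OF assms(1) transpose_permutes [OF z(1) assms(2)]]
    by (subst L_cong [OF rerep_conj [OF assms]]) simp_all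
  ultimately show ?thesis by simp
qed

text \<open>Mirror image of \<open>L_rerep\<close>: the transposition is absorbed on the left, by
  the product with the new representative, so a second copy is multiplied on the right to cancel the
  first.\<close>

lemma R_rerep:
  assumes "idem_map n r" "y \<in> {1..n}" "r y \<noteq> 0"
  shows "R r = R (rerep y r) \<cdot> P (transpose (r y) y)"
proof -
  have z: "r y \<in> {1..n}" "r (r y) = r y" using idem_mapD [OF assms] by auto
  let ?P = "P (transpose (r y) y)"
  have "?P \<cdot> R (rerep y r) = R (rerep y r)"
    by (rule R_absorb_left [OF idem_rerep [OF assms] z(1)])
      (use assms z rels_2(12) [of y "r y"] in \<open>auto simp: FR_def rerep_def transpose_commute\<close>)
  moreover have "R r \<cdot> ?P = ?P \<cdot> R (rerep y r)"
    unfolding R_P [OF assms(1) transpose_permutes [OF z(1) assms(2)]]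
    by (subst R_cong [OF rerep_conj [OF assms]]) simp_all
  ultimately have "R r \<cdot> (?P \<cdot> ?P) = R (rerep y r) \<cdot> ?P" by (simp flip: assoc)
  then show ?thesis using swap_sq z assms by simp
qed

end

section \<open>Closure of normal forms under right multiplication\<close>

definition merge :: "nat \<Rightarrow> nat \<Rightarrow> (nat \<Rightarrow> nat) \<Rightarrow> nat \<Rightarrow> nat" where
  "merge x y r c = (if r c = y then x else r c)"

lemma idem_merge: "idem_map n r \<Longrightarrow> x \<in> {1..n} \<Longrightarrow> r x = x \<Longrightarrow> x \<noteq> y \<Longrightarrow> idem_map n (merge x y r)"
  by (auto simp: idem_map_def merge_def)

lemma idem_upd0:
  assumes "idem_map n r" "\<And>c. c \<in> {1..n} \<Longrightarrow> c \<noteq> y \<Longrightarrow> r c \<noteq> y"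
  shows "idem_map n (r(y := 0))"
  using assms by (auto simp: idem_map_def)

lemma idem_upd: "idem_map n r \<Longrightarrow> r y = 0 \<Longrightarrow> y \<in> {1..n} \<Longrightarrow> r x = x \<Longrightarrow> x \<in> {1..n} \<Longrightarrow> idem_map n (r(y := x))"
  unfolding idem_map_def by (metis fun_upd_apply atLeastAtMost_iff not_one_le_zero)

lemma reps_kill: "reps n (kill z r) = reps n r - {z}"
  by (auto simp: reps_def kill_def)

lemma reps_merge: "x \<noteq> y \<Longrightarrow> r x = x \<Longrightarrow> reps n (merge x y r) = reps n r - {y}"
  by (auto simp: reps_def merge_def)

lemma reps_rerep:
  assumes "idem_map n r" "y \<in> {1..n}" "r y \<noteq> 0"
  shows "reps n (rerep y r) = transpose (r y) y ` reps n r"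
proof -
  have z: "r y \<in> {1..n}" "r (r y) = r y" using idem_mapD [OF assms] by blast+
  have *: "reps n r = insert (r y) {x \<in> {1..n}. r x = x \<and> x \<noteq> r y}"
    "reps n (rerep y r) = insert y {x \<in> {1..n}. r x = x \<and> x \<noteq> r y}"
    using z assms(2) by (auto simp: reps_def rerep_def)
  have "transpose (r y) y ` {x \<in> {1..n}. r x = x \<and> x \<noteq> r y} = (\<lambda>x. x) ` {x \<in> {1..n}. r x = x \<and> x \<noteq> r y}"
    by (rule image_cong) (auto simp: transpose_def)
  then show ?thesis unfolding * by simp
qed

text \<open>The two encodings describe the same partial partition, possibly with different
  representatives.\<close>

definition same_fibres ::  "nat \<Rightarrow> (nat \<Rightarrow> nat) \<Rightarrow> (nat \<Rightarrow> nat) \<Rightarrow> bool" where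
  "same_fibres n r r' \<longleftrightarrow> (\<forall>x\<in>{1..n}. r x = 0 \<longleftrightarrow> r' x = 0) \<and>
     (\<forall>x\<in>{1..n}. \<forall>y\<in>{1..n}. r x = r y \<longleftrightarrow> r' x = r' y)"

context S_model
begin

lemma FR_ro_comm:
  assumes "idem_map n r" "c \<in> {1..n}" "x \<in> {1..n}" "y \<in> {1..n}" "x \<noteq> y" "r x = x" "r c \<noteq> y" "c \<noteq> y"
  shows "FR r c \<cdot> ro x y = ro x y \<cdot> FR r c"
proof (rule FR_cases [OF assms(1,2)])
  assume "FR r c = e c" "r c \<noteq> c"
  moreover from this have "c \<noteq> x" using assms by blast
  ultimately show ?thesis using e_ro_comm [of x y c] assms by simp
next
  fix z assume z: "FR r c = ro z c" "r c \<noteq> c" "r z = z" "z \<in> {1..n}" "r c = z"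
  then have "z \<noteq> c" "c \<noteq> x" "z \<noteq> y" using assms by blast+
  then show ?thesis using z assms by (simp add: ro_ro_comm)
qed simp

lemma FL_ro_comm:
  assumes "idem_map n r" "c \<in> {1..n}" "x \<in> {1..n}" "y \<in> {1..n}" "x \<noteq> y" "r x = x" "r c \<noteq> y" "c \<noteq> y"
  shows "FL r c \<cdot> ro x y = ro x y \<cdot> FL r c"
proof (rule FL_cases [OF assms(1,2)])
  assume "FL r c = e c" "r c \<noteq> c"
  moreover from this have "c \<noteq> x" using assms by blast
  ultimately show ?thesis using e_ro_comm [of x y c] assms by simp
next
  fix z assume z: "FL r c = la z c" "r c \<noteq> c" "r z = z" "z \<in> {1..n}" "r c = z"
  then have "z \<noteq> c" "c \<noteq> x" "z \<noteq> y" using assms by blast+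
  then show ?thesis using z assms by (simp add: la_ro_comm)
qed simp

lemma FL_la_comm:
  assumes "idem_map n r" "c \<in> {1..n}" "x \<in> {1..n}" "y \<in> {1..n}" "x \<noteq> y" "r x = x" "r c \<noteq> y" "c \<noteq> y"
  shows "FL r c \<cdot> la x y = la x y \<cdot> FL r c"
proof (rule FL_cases [OF assms(1,2)])
  assume "FL r c = e c" "r c \<noteq> c"
  moreover from this have "c \<noteq> x" using assms by blast
  ultimately show ?thesis using e_la_comm [of x y c] assms by simp
next
  fix z assume z: "FL r c = la z c" "r c \<noteq> c" "r z = z" "z \<in> {1..n}" "r c = z"
  then have "z \<noteq> c" "c \<noteq> x" "z \<noteq> y" using assms by blast+
  then show ?thesis using z assms by (simp add: la_la_comm)
qed simp

text \<open>The new merge plays two roles: it redirects to \<open>x\<close> every earlier merge into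
  \<open>y\<close>, and it fills the slot of \<open>y\<close>, whose factor was trivial.\<close>

lemma R_ro:
  assumes "idem_map n r" "x \<in> {1..n}" "y \<in> {1..n}" "x \<noteq> y" "r x = x" "r y = y"
  shows "R r \<cdot> ro x y = R (merge x y r)"
proof -
  let ?r = "merge x y r"
  \<comment> \<open>The product to be reached, with the slot of \<open>y\<close> still
    empty.\<close>
  let ?f = "(FR ?r)(y := \<epsilon>)"
  have *: "FR r c \<cdot> ro x y = ?f c \<cdot> ro x y \<and> ?f c \<cdot> ro x y = ro x y \<cdot> ?f c" if c: "c \<in> {1..n}" for c
  proof -
    consider "c = y" | "c \<noteq> y" "r c = y" | "c \<noteq> y" "r c \<noteq> y" by blast
    then show ?thesis
    proof cases
      case 1 then show ?thesis using assms by (simp add: FR_def)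
    next
      case 2
      then have d: "c \<noteq> x" using assms(4,5) by metis
      have "FR r c = ro y c" "?f c = ro x c" using 2 d assms by (auto simp: FR_def merge_def)
      moreover have "ro y c \<cdot> ro x y = ro x c \<cdot> ro x y"
        using 2 d c assms by (intro rels_3(1)) auto
      moreover have "ro x c \<cdot> ro x y = ro x y \<cdot> ro x c"
        using 2 d c assms by (intro ro_ro_comm) auto
      ultimately show ?thesis by simp
    next
      case 3
      then have "?f c = FR r c" by (simp add: FR_def merge_def)
      then show ?thesis using FR_ro_comm [OF assms(1) c assms(2-5) 3(2,1)] by simp
    qed
  qed
  have "R r \<cdot> ro x y = lprod ?f ixs \<cdot> ro x y"
    unfolding R_def by (rule lprod_subst) (use * in simp)
  also have "\<dots> = R ?r"
    unfolding R_def
  proof (rule lprod_replace)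
    show "?f y \<cdot> ro x y = FR ?r y" using assms by (simp add: FR_def merge_def)
  next
    fix c assume "c \<in> set ixs" "c \<noteq> y"
    then show "?f c \<cdot> ro x y = ro x y \<cdot> ?f c" using * [of c] by simp
  qed (use assms in simp_all)
  finally show ?thesis .
qed

text \<open>The merge passes to the left of the splittings and turns \<open>la y c\<close> into
  \<open>la x c\<close> on the way. Below, \<open>y\<close> is left as a point, because
  \<open>ro x y = ro x y \<cdot> e y\<close>.\<close>

lemma L_ro:
  assumes "idem_map n s" "x \<in> {1..n}" "y \<in> {1..n}" "x \<noteq> y" "s x = x" "s y = y"
  shows "L s \<cdot> ro x y = ro x y \<cdot> L ((merge x y s)(y := 0))"
    and "idem_map n ((merge x y s)(y := 0))"
proof -
  let ?s = "(merge x y s)(y := 0)"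
  let ?f = "(FL ?s)(y := \<epsilon>)"
  have "merge x y s c \<noteq> y" for c using assms by (simp add: merge_def)
  then show idem: "idem_map n ?s"
    using idem_merge [OF assms(1,2,5,4)] by (intro idem_upd0) auto
  have *: "FL s c \<cdot> ro x y = ro x y \<cdot> ?f c" if c: "c \<in> {1..n}" for c
  proof -
    consider "c = y" | "c \<noteq> y" "s c = y" | "c \<noteq> y" "s c \<noteq> y" by blast
    then show ?thesis
    proof cases
      case 1 then show ?thesis using assms by (simp add: FL_def)
    next
      case 2
      then have d: "c \<noteq> x" using assms(4,5) by metis
      have "FL s c = la y c" "?f c = la x c" using 2 d assms by (auto simp: FL_def merge_def)
      moreover have "la y c \<cdot> ro x y = ro x y \<cdot> la x c"
        using 2 d c assms by (intro rels_3(3)) auto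
      ultimately show ?thesis by simp
    next
      case 3
      then have "?f c = FL s c" by (simp add: FL_def merge_def)
      then show ?thesis using FL_ro_comm [OF assms(1) c assms(2-5) 3(2,1)] by simp
    qed
  qed
  have "L s \<cdot> ro x y = ro x y \<cdot> lprod ?f ixs"
    unfolding L_def by (rule lprod_pass) (use * in simp)
  also have "\<dots> = ro x y \<cdot> (e y \<cdot> lprod ?f ixs)"
    using rels_2(3) [of x y] assms by (simp flip: assoc)
  also have "e y \<cdot> lprod ?f ixs = L ?s"
    unfolding L_def
  proof (rule lprod_replace_left)
    fix c assume "c \<in> set ixs" "c \<noteq> y"
    then show "?f c \<cdot> e y = e y \<cdot> ?f c"
      using FL_e_comm [OF idem, of y c] assms by simp
  next
    show "e y \<cdot> ?f y = FL ?s y" using assms by (simp add: FL_def)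
  qed (use assms in simp_all)
  finally show "L s \<cdot> ro x y = ro x y \<cdot> L ?s" .
qed

text \<open>Within one block the splitting and the merge of \<open>y\<close> cancel to
  \<open>e y\<close>, since \<open>la x y \<cdot> ro x y = e y\<close>. So only the lower encoding
  changes.\<close>

lemma L_ro_same:
  assumes "idem_map n s" "x \<in> {1..n}" "y \<in> {1..n}" "x \<noteq> y" "s x = x" "s y = x"
  shows "L s \<cdot> ro x y = L (s(y := 0))" "idem_map n (s(y := 0))"
proof -
  have ny: "s c \<noteq> y" if "c \<in> {1..n}" for c
    using idem_mapD [OF assms(1) that] assms by (metis not_one_le_zero atLeastAtMost_iff)
  then show "idem_map n (s(y := 0))" using assms(1) by (intro idem_upd0)
  show "L s \<cdot> ro x y = L (s(y := 0))"
    unfolding L_def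
  proof (rule lprod_replace)
    fix c assume "c \<in> set ixs" "c \<noteq> y"
    then show "FL s c \<cdot> ro x y = ro x y \<cdot> FL s c" "FL s c = FL (s(y := 0)) c"
      using FL_ro_comm [OF assms(1) _ assms(2-5)] ny by (simp_all add: FL_def)
  next
    show "FL s y \<cdot> ro x y = FL (s(y := 0)) y"
      using rels_2(11) [of x y] assms by (simp add: FL_def)
  qed (use assms in simp_all)
qed

text \<open>The point \<open>y\<close> contributes the factor \<open>e y\<close>, which is absorbed
  by \<open>la x y\<close>.\<close>

lemma L_la:
  assumes "idem_map n s" "x \<in> {1..n}" "y \<in> {1..n}" "x \<noteq> y" "s x = x" "s y = 0"
  shows "L s \<cdot> la x y = L (s(y := x))"
proof -
  have ny: "s c \<noteq> y" if "c \<in> {1..n}" for c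
    using idem_mapD [OF assms(1) that] assms by (metis not_one_le_zero atLeastAtMost_iff)
  show ?thesis
    unfolding L_def
  proof (rule lprod_replace)
    fix c assume "c \<in> set ixs" "c \<noteq> y"
    then show "FL s c \<cdot> la x y = la x y \<cdot> FL s c" "FL s c = FL (s(y := x)) c"
      using FL_la_comm [OF assms(1) _ assms(2-5)] ny by (simp_all add: FL_def)
  next
    show "FL s y \<cdot> la x y = FL (s(y := x)) y"
      using rels_2(4) [of x y] assms by (simp add: FL_def)
  qed (use assms in simp_all)
qed

definition nf :: "'m \<Rightarrow> bool" where
  "nf m \<longleftrightarrow> (\<exists>r p s. good n r p s \<and> m = nfv r p s)"

text \<open>Discarding \<open>y\<close> discards the line through \<open>y\<close>. The idempotent
  at the lower representative is doubled: one copy moves through \<open>P p\<close> and kills the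
  upper half of the line, the other kills the lower half. That \<open>y\<close> ends up as a point
  is recorded for \<open>nf_la\<close>.\<close>

lemma nf_e:
  assumes "good n r p s" "y \<in> {1..n}"
  obtains r' s' where "good n r' p s'" "s' y = 0" "nfv r p s \<cdot> e y = nfv r' p s'"
proof (cases "s y = 0")
  case True
  have "L s \<cdot> e y = L s"
    using assms True by (intro L_absorb [of _ y]) (auto simp: good_def FL_def e_idem)
  then show ?thesis using that [OF assms(1) True] by (simp add: nfv_def assoc)
next
  case False
  have s: "idem_map n s" "idem_map n r" "p permutes {1..n}" "p ` reps n r = reps n s"
    using assms by (auto simp: good_def)
  define z where "z = s y"
  have z: "z \<in> {1..n}" "s z = z" "z \<in> reps n s"
    using idem_mapD [OF s(1) assms(2) False] by (auto simp: z_def reps_def)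
  obtain w where w: "w \<in> reps n r" "p w = z"
    using z(3) unfolding s(4) [symmetric] by (elim imageE) simp
  then have w': "w \<in> {1..n}" "r w = w" by (auto simp: reps_def)
  have "nfv r p s \<cdot> e y = R r \<cdot> P p \<cdot> (e z \<cdot> e z) \<cdot> L s"
    using L_e [OF s(1) assms(2) False] e_idem [OF z(1)] by (simp add: nfv_def assoc z_def)
  also have "\<dots> = R r \<cdot> (P p \<cdot> e z) \<cdot> (e z \<cdot> L s)" by (simp add: assoc)
  also have "P p \<cdot> e z = e w \<cdot> P p" using comm_P(3) [OF s(3) w'(1)] w(2) by simp
  also have "R r \<cdot> (e w \<cdot> P p) \<cdot> (e z \<cdot> L s) = (R r \<cdot> e w) \<cdot> P p \<cdot> (e z \<cdot> L s)" by (simp add: assoc)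
  also have "\<dots> = nfv (kill w r) p (kill z s)"
    using R_e [OF s(2) w'] L_e_left [OF s(1) z(1,2)] by (simp add: nfv_def)
  finally have "nfv r p s \<cdot> e y = nfv (kill w r) p (kill z s)" .
  moreover have "p ` (reps n r - {w}) = reps n s - {z}"
    unfolding image_set_diff [OF permutes_inj [OF s(3)]] s(4) using w(2) by simp
  then have "good n (kill w r) p (kill z s)"
    unfolding good_def reps_kill using s(3) idem_kill [OF s(1)] idem_kill [OF s(2)] by blast
  moreover have "kill z s y = 0" by (simp add: kill_def z_def)
  ultimately show ?thesis by (rule that [rotated 2])
qed

lemma nf_ee:
  assumes "good n r p s" "x \<in> {1..n}" "y \<in> {1..n}"
  shows "nf (nfv r p s \<cdot> (e x \<cdot> e y))"
proof -
  obtain r1 s1 where 1: "good n r1 p s1" "s1 x = 0" "nfv r p s \<cdot> e x = nfv r1 p s1"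
    by (rule nf_e [OF assms(1,2)])
  obtain r2 s2 where 2: "good n r2 p s2" "s2 y = 0" "nfv r1 p s1 \<cdot> e y = nfv r2 p s2"
    by (rule nf_e [OF 1(1) assms(3)])
  have "nfv r p s \<cdot> (e x \<cdot> e y) = nfv r2 p s2" using 1 2 by (simp flip: assoc)
  then show ?thesis using 2 unfolding nf_def by blast
qed

lemma nf_absorb: "good n r p s \<Longrightarrow> y \<in> {1..n} \<Longrightarrow> s y = 0 \<Longrightarrow> nfv r p s \<cdot> e y = nfv r p s"
  using L_absorb [of s y "e y"] by (simp add: good_def FL_def e_idem nfv_def assoc)

lemma nf_rerep:
  assumes "good n r p s" "y \<in> {1..n}" "s y \<noteq> 0"
  obtains p' where "good n r p' (rerep y s)" "nfv r p s = nfv r p' (rerep y s)"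
proof -
  have s: "idem_map n s" "idem_map n r" "p permutes {1..n}" "p ` reps n r = reps n s"
    using assms by (auto simp: good_def)
  have z: "s y \<in> {1..n}" using idem_mapD [OF s(1) assms(2,3)] by blast
  let ?t = "transpose (s y) y"
  have t: "?t permutes {1..n}" using z assms(2) by (rule transpose_permutes)
  have "nfv r p s = R r \<cdot> (P p \<cdot> P ?t) \<cdot> L (rerep y s)"
    unfolding nfv_def L_rerep [OF s(1) assms(2,3)] by (simp only: assoc)
  then have "nfv r p s = nfv r (?t \<circ> p) (rerep y s)" by (simp only: P_comp [OF s(3) t] nfv_def)
  moreover have "good n r (?t \<circ> p) (rerep y s)"
    unfolding good_def image_comp [symmetric] s(4) reps_rerep [OF s(1) assms(2,3)]
    using s(2) idem_rerep [OF s(1) assms(2,3)] permutes_compose [OF s(3) t] by blast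
  ultimately show ?thesis using that by blast
qed

text \<open>Merging two lower blocks joins two lines, so the merge moves on through
  \<open>P p\<close> and joins the corresponding upper blocks.\<close>

lemma nf_ro_reps:
  assumes "good n r p s" "x \<in> {1..n}" "y \<in> {1..n}" "x \<noteq> y" "s x = x" "s y = y"
  shows "nf (nfv r p s \<cdot> ro x y)"
proof -
  have s: "idem_map n s" "idem_map n r" "p permutes {1..n}" "p ` reps n r = reps n s"
    using assms by (auto simp: good_def)
  have "x \<in> reps n s" "y \<in> reps n s" using assms by (auto simp: reps_def)
  then obtain u v where uv: "u \<in> reps n r" "p u = x" "v \<in> reps n r" "p v = y"
    unfolding s(4) [symmetric] by (elim imageE) simp
  have uv': "u \<in> {1..n}" "r u = u" "v \<in> {1..n}" "r v = v" "u \<noteq> v"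
    using uv assms(4) by (auto simp: reps_def)
  let ?s = "(merge x y s)(y := 0)"
  have "nfv r p s \<cdot> ro x y = R r \<cdot> (P p \<cdot> ro x y) \<cdot> L ?s"
    using L_ro [OF s(1) assms(2-6)] by (simp add: nfv_def assoc)
  also have "P p \<cdot> ro x y = ro u v \<cdot> P p"
    using comm_P(1) [OF s(3) uv'(5,1,3)] uv by simp
  also have "R r \<cdot> (ro u v \<cdot> P p) \<cdot> L ?s = nfv (merge u v r) p ?s"
    using R_ro [OF s(2) uv'(1,3,5,2,4)] by (simp add: nfv_def flip: assoc)
  finally have "nfv r p s \<cdot> ro x y = nfv (merge u v r) p ?s" .
  moreover have "good n (merge u v r) p ?s"
  proof -
    have "reps n ?s = reps n (merge x y s)"
      using assms by (auto simp: reps_def merge_def)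
    also have "\<dots> = reps n s - {y}" using assms by (intro reps_merge)
    finally have "p ` reps n (merge u v r) = reps n ?s"
      using s(4) uv uv' permutes_inj [OF s(3)] by (simp add: reps_merge image_set_diff)
    then show ?thesis
      using s idem_merge [OF s(2) uv'(1,2,5)] L_ro(2) [OF s(1) assms(2-6)] by (simp add: good_def)
  qed
  ultimately show ?thesis unfolding nf_def by blast
qed

text \<open>If \<open>x\<close> or \<open>y\<close> is a point, the merge degenerates to
  \<open>e x \<cdot> e y\<close>. Otherwise \<open>x\<close> is made a representative; then
  \<open>y\<close> either lies in the block of \<open>x\<close> and becomes a point, or is made the
  representative of its own block, where \<open>nf_ro_reps\<close> applies.\<close>

lemma nf_ro:
  assumes "good n r p s" "x \<in> {1..n}" "y \<in> {1..n}" "x \<noteq> y"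
  shows "nf (nfv r p s \<cdot> ro x y)"
proof -
  consider "s x = 0" | "s y = 0" | "s x \<noteq> 0" "s y \<noteq> 0" by blast
  then show ?thesis
  proof cases
    case 1
    have "nfv r p s \<cdot> ro x y = nfv r p s \<cdot> e x \<cdot> ro x y" using nf_absorb [OF assms(1,2) 1] by simp
    also have "\<dots> = nfv r p s \<cdot> (e x \<cdot> e y)" using rels_2(6) [of x y] assms by (simp add: assoc)
    finally show ?thesis using nf_ee [OF assms(1-3)] by simp
  next
    case 2
    have "nfv r p s \<cdot> ro x y = nfv r p s \<cdot> e y \<cdot> ro x y" using nf_absorb [OF assms(1,3) 2] by simp
    also have "\<dots> = nfv r p s \<cdot> (e x \<cdot> e y)" using rels_2(7) [of x y] assms by (simp add: assoc)
    finally show ?thesis using nf_ee [OF assms(1-3)] by simp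
  next
    case 3
    let ?s = "rerep x s"
    obtain p' where p': "good n r p' ?s" "nfv r p s = nfv r p' ?s"
      using nf_rerep [OF assms(1,2) 3(1)] by blast
    have x: "?s x = x" by (simp add: rerep_def)
    have y0: "?s y \<noteq> 0" using 3 assms by (simp add: rerep_def)
    show ?thesis
    proof (cases "?s y = x")
      case True
      have g: "idem_map n r" "idem_map n ?s" "p' permutes {1..n}" "p' ` reps n r = reps n ?s"
        using p' by (simp_all add: good_def)
      note * = L_ro_same [OF g(2) assms(2-4) x True]
      have "reps n (?s(y := 0)) = reps n ?s"
        using True assms(3,4) by (auto simp: reps_def)
      then have "good n r p' (?s(y := 0))" using g * by (simp add: good_def)
      moreover have "nfv r p s \<cdot> ro x y = nfv r p' (?s(y := 0))"
        unfolding p'(2) using * by (simp add: nfv_def assoc)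
      ultimately show ?thesis unfolding nf_def by blast
    next
      case False
      obtain p2 where p2: "good n r p2 (rerep y ?s)" "nfv r p' ?s = nfv r p2 (rerep y ?s)"
        using nf_rerep [OF p'(1) assms(3) y0] by blast
      have "rerep y ?s x = x" using False x by (simp add: rerep_def [of y])
      moreover have "rerep y ?s y = y" by (simp add: rerep_def [of y])
      ultimately show ?thesis using nf_ro_reps [OF p2(1) assms(2-4)] by (simp add: p'(2) p2(2))
    qed
  qed
qed

text \<open>Since \<open>la x y = e y \<cdot> la x y\<close>, the line through \<open>y\<close> is
  discarded before \<open>y\<close> is attached to the block of \<open>x\<close>.\<close>

lemma nf_la:
  assumes "good n r p s" "x \<in> {1..n}" "y \<in> {1..n}" "x \<noteq> y"
  shows "nf (nfv r p s \<cdot> la x y)"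
proof -
  obtain r1 s1 where 1: "good n r1 p s1" "s1 y = 0" "nfv r p s \<cdot> e y = nfv r1 p s1"
    by (rule nf_e [OF assms(1,3)])
  have eq: "nfv r p s \<cdot> la x y = nfv r1 p s1 \<cdot> la x y"
    using rels_2(4) [of x y] assms(2-4) by (simp add: 1(3) [symmetric] assoc)
  show ?thesis
  proof (cases "s1 x = 0")
    case True
    have "nfv r1 p s1 \<cdot> la x y = nfv r1 p s1 \<cdot> e x \<cdot> la x y" using nf_absorb [OF 1(1) assms(2) True] by simp
    also have "\<dots> = nfv r1 p s1 \<cdot> (e x \<cdot> e y)" using rels_2(8) [of x y] assms by (simp add: assoc)
    finally show ?thesis unfolding eq using nf_ee [OF 1(1) assms(2,3)] by simp
  next
    case False
    let ?s = "rerep x s1"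
    obtain p' where p': "good n r1 p' ?s" "nfv r1 p s1 = nfv r1 p' ?s"
      using nf_rerep [OF 1(1) assms(2) False] by blast
    have x: "?s x = x" by (simp add: rerep_def)
    have y: "?s y = 0" using 1(2) False by (simp add: rerep_def)
    have g: "idem_map n r1" "idem_map n ?s" "p' permutes {1..n}" "p' ` reps n r1 = reps n ?s"
      using p' by (simp_all add: good_def)
    have "reps n (?s(y := x)) = reps n ?s"
      using y assms(3,4) by (auto simp: reps_def)
    then have "good n r1 p' (?s(y := x))"
      using g idem_upd [OF g(2) y assms(3) x assms(2)] by (simp add: good_def)
    moreover have "nfv r p s \<cdot> la x y = nfv r1 p' (?s(y := x))"
      unfolding eq p'(2) using L_la [OF g(2) assms(2-4) x y] by (simp add: nfv_def assoc)
    ultimately show ?thesis unfolding nf_def by blast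
  qed
qed

lemma reps_conj:
  assumes "q permutes {1..n}"
  shows "reps n (q \<circ> s \<circ> pinv q) = q ` reps n s"
proof -
  have "x \<in> q ` reps n s" if "x \<in> reps n (q \<circ> s \<circ> pinv q)" for x
  proof
    have x: "x \<in> {1..n}" "q (s (pinv q x)) = x" using that by (auto simp: reps_def)
    then show "x = q (pinv q x)" using permutes_inverses [OF assms] by simp
    have "s (pinv q x) = pinv q x" using x(2) permutes_inverses(2) [OF assms] by metis
    moreover have "pinv q x \<in> {1..n}" using x(1) permutes_in_image [OF permutes_inv [OF assms]] by blast
    ultimately show "pinv q x \<in> reps n s" by (simp add: reps_def)
  qed
  moreover have "q x \<in> reps n (q \<circ> s \<circ> pinv q)" if "x \<in> reps n s" for x
  proof -
    have x: "x \<in> {1..n}" "s x = x" using that by (auto simp: reps_def)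
    then have "q x \<in> {1..n}" using permutes_in_image [OF assms] by blast
    then show ?thesis using x permutes_inverses [OF assms] by (simp add: reps_def)
  qed
  ultimately show ?thesis by blast
qed

lemma nf_P:
  assumes "good n r p s" "q permutes {1..n}"
  shows "nf (nfv r p s \<cdot> P q)"
proof -
  have s: "idem_map n s" "idem_map n r" "p permutes {1..n}" "p ` reps n r = reps n s"
    using assms by (auto simp: good_def)
  let ?s = "q \<circ> s \<circ> pinv q"
  have "nfv r p s \<cdot> P q = R r \<cdot> (P p \<cdot> P q) \<cdot> L ?s"
    using L_P [OF s(1) assms(2)] by (simp only: nfv_def assoc)
  also have "\<dots> = nfv r (q \<circ> p) ?s" using P_comp [OF s(3) assms(2)] by (simp add: nfv_def)
  finally have "nfv r p s \<cdot> P q = nfv r (q \<circ> p) ?s" .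
  moreover have "good n r (q \<circ> p) ?s"
    unfolding good_def using s idem_conj [OF s(1) assms(2)] permutes_compose [OF s(3) assms(2)]
      reps_conj [OF assms(2), of s] image_comp [of q p "reps n r"] by simp
  ultimately show ?thesis unfolding nf_def by blast
qed

lemma nf_val: "w \<in> lists (S_gens n) \<Longrightarrow> nf (val w)"
proof (induction w rule: rev_induct)
  case Nil
  \<comment> \<open>The empty word is the normal form of the discrete encoding, in which every index
    represents itself.\<close>
  have "lprod (FR id) xs = \<epsilon>" "lprod (FL id) xs = \<epsilon>" for xs
    by (induction xs) (simp_all add: FR_def FL_def)
  then have "R id = \<epsilon>" "L id = \<epsilon>" by (simp_all add: R_def L_def)
  then have "val [] = nfv id id id" by (simp add: nfv_def)
  moreover have "good n id id id" by (simp add: good_def idem_map_def permutes_id)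
  ultimately show ?case unfolding nf_def by blast
next
  case (snoc x w)
  then obtain r p s where *: "good n r p s" "val w = nfv r p s" unfolding nf_def by auto
  have x: "x \<in> S_gens n" using snoc by simp
  have eq: "val (w @ [x]) = nfv r p s \<cdot> g x" using * by simp
  show ?case
  proof (cases x)
    case (Sig i)
    then have i: "i \<in> {1..<n}" using x by simp
    then have "transpose i (Suc i) permutes {1..n}" by (intro transpose_permutes) auto
    then show ?thesis unfolding eq unfolding Sig P_Sig [OF i] by (intro nf_P *)
  next
    case (Lam i)
    then have i: "1 \<le> i" "i < n" using x by auto
    then show ?thesis unfolding eq unfolding Lam Lam_eq [OF i] by (intro nf_la *) auto
  next
    case (Rho i)
    then have i: "1 \<le> i" "i < n" using x by auto
    then show ?thesis unfolding eq unfolding Rho Rho_eq [OF i] by (intro nf_ro *) auto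
  next
    case (Idp i)
    then have i: "i \<in> {1..n}" using x by auto
    obtain r' s' where "good n r' p s'" "s' i = 0" "nfv r p s \<cdot> e i = nfv r' p s'"
      by (rule nf_e [OF *(1) i])
    then show ?thesis unfolding eq unfolding Idp nf_def by blast
  qed
qed

section \<open>Independence of the choices in a normal form\<close>

lemma R_fix:
  assumes "idem_map n r" "q permutes {1..n} - reps n r"
  shows "R r \<cdot> P q = R r"
proof -
  \<comment> \<open>An index that is not a representative is a point or is merged into another
    index; in both cases its idempotent is absorbed on the right.\<close>
  have e: "R r \<cdot> e a = R r" if "a \<in> {1..n} - reps n r" for a
  proof -
    have a: "a \<in> {1..n}" "r a \<noteq> a" using that by (auto simp: reps_def)
    have "FR r a \<cdot> e a = FR r a"
    proof (cases "r a = 0")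
      case True
      then show ?thesis using a e_idem by (simp add: FR_def)
    next
      case False
      then show ?thesis using a idem_mapD [OF assms(1) a(1)] rels_2(3) [of "r a" a] by (simp add: FR_def)
    qed
    then show ?thesis using R_absorb [OF assms(1) a(1)] by blast
  qed
  have "finite ({1..n} - reps n r)" by simp
  with assms(2) show ?thesis
  proof (induction rule: permutes_induct)
    case id
    then show ?case by (simp only: P_id unit_right)
  next
    case (swap a b p)
    have ab: "a \<in> {1..n}" "b \<in> {1..n}" using swap by auto
    have p: "p permutes {1..n}" using permutes_subset [OF swap(4)] by blast
    have "R r \<cdot> P (transpose a b \<circ> p) = R r \<cdot> P p \<cdot> P (transpose a b)"
      using P_comp [OF p transpose_permutes [OF ab]] by (simp add: assoc)
    \<comment> \<open>Both idempotents may be inserted, and together they absorb the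
      transposition.\<close>
    also have "\<dots> = R r \<cdot> e a \<cdot> e b \<cdot> P (transpose a b)" using swap e by simp
    also have "\<dots> = R r \<cdot> e a \<cdot> e b" using rels_2(2) [OF swap(3) ab] by (simp add: assoc)
    also have "\<dots> = R r" using swap e by simp
    finally show ?case .
  qed
qed

lemma same_fibres_rerep:
  assumes "same_fibres n r r'" "y \<in> {1..n}" "r y \<noteq> 0" "idem_map n r"
  shows "same_fibres n (rerep y r) r'"
proof -
  have ny: "r x = r y" if "x \<in> {1..n}" "r x = y" for x
    using idem_mapD [OF assms(4) that(1)] that assms(2) by (metis atLeastAtMost_iff not_one_le_zero)
  have "rerep y r x = 0 \<longleftrightarrow> r x = 0" if "x \<in> {1..n}" for x
    using assms(2,3) by (auto simp: rerep_def)
  moreover have "rerep y r x = rerep y r x' \<longleftrightarrow> r x = r x'" if "x \<in> {1..n}" "x' \<in> {1..n}" for x x'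
    using ny [OF that(1)] ny [OF that(2)] unfolding rerep_def by metis
  ultimately show ?thesis using assms(1) unfolding same_fibres_def by metis
qed

text \<open>Representatives of \<open>r\<close> are moved to those of \<open>r'\<close> one block at
  a time, at the cost of one transposition each. The measure counts the representatives of
  \<open>r\<close> that \<open>r'\<close> does not use.\<close>

lemma same_fibres_RL:
  assumes "idem_map n r" "idem_map n r'" "same_fibres n r r'"
  shows "\<exists>q q'. q permutes {1..n} \<and> q' permutes {1..n} \<and> R r = R r' \<cdot> P q \<and> L r = P q' \<cdot> L r'"
  using assms(1,3)
proof (induction "card {z \<in> {1..n}. r z = z \<and> r' z \<noteq> z}" arbitrary: r rule: less_induct)
  case less
  let ?B = "\<lambda>r. {z \<in> {1..n}. r z = z \<and> r' z \<noteq> z}"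
  show ?case
  proof (cases "?B r = {}")
    case True
    have "r x = r' x" if x: "x \<in> {1..n}" for x
    proof (cases "r x = 0")
      case True
      then show ?thesis using less.prems(2) x by (simp add: same_fibres_def)
    next
      case False
      then have "r x \<in> {1..n}" "r (r x) = r x" using idem_mapD [OF less.prems(1) x] by blast+
      then have "r' (r x) = r x" using True by blast
      moreover have "r' (r x) = r' x"
        using less.prems(2) x \<open>r x \<in> {1..n}\<close> \<open>r (r x) = r x\<close> unfolding same_fibres_def by blast
      ultimately show ?thesis by simp
    qed
    then have "R r = R r'" "L r = L r'" by (auto intro: R_cong L_cong)
    then show ?thesis using permutes_id [of "{1..n}"] by (metis P_id unit_left unit_right)
  next
    case False
    then obtain z where z: "z \<in> {1..n}" "r z = z" "r' z \<noteq> z" by blast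
    have z0: "r z \<noteq> 0" using z by auto
    then have "r' z \<noteq> 0" using less.prems(2) z(1) unfolding same_fibres_def by metis
    then have y: "r' z \<in> {1..n}" "r' (r' z) = r' z" using idem_mapD [OF assms(2) z(1)] by blast+
    then have ry: "r (r' z) = z" using less.prems(2) z unfolding same_fibres_def by metis
    have y0: "r (r' z) \<noteq> 0" using ry z by auto
    \<comment> \<open>The block of \<open>z\<close> receives the representative that
      \<open>r'\<close> chooses for it.\<close>
    let ?r = "rerep (r' z) r" and ?t = "transpose z (r' z)"
    have t: "?t permutes {1..n}" using z y by (intro transpose_permutes)
    have "?B ?r \<subset> ?B r"
    proof
      show "?B ?r \<subseteq> ?B r" using y ry by (auto simp: rerep_def split: if_splits)
      have "z \<notin> ?B ?r" using z ry by (simp add: rerep_def)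
      then show "?B ?r \<noteq> ?B r" using z by blast
    qed
    then have "card (?B ?r) < card (?B r)" by (intro psubset_card_mono) auto
    from less.hyps [OF this idem_rerep [OF less.prems(1) y(1) y0] same_fibres_rerep [OF less.prems(2) y(1) y0 less.prems(1)]]
    obtain q q' where q: "q permutes {1..n}" "q' permutes {1..n}" "R ?r = R r' \<cdot> P q" "L ?r = P q' \<cdot> L r'"
      by blast
    have "R r = R ?r \<cdot> P ?t" "L r = P ?t \<cdot> L ?r"
      using R_rerep [OF less.prems(1) y(1) y0] L_rerep [OF less.prems(1) y(1) y0] ry by simp_all
    then have "R r = R r' \<cdot> P (?t \<circ> q)" "L r = P (q' \<circ> ?t) \<cdot> L r'"
      using q P_comp [OF q(1) t] P_comp [OF t q(2)] by (simp_all add: assoc) (simp flip: assoc)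
    then show ?thesis using permutes_compose [OF q(1) t] permutes_compose [OF t q(2)] by blast
  qed
qed

lemma nfv_change:
  assumes "good n r p s" "idem_map n r'" "idem_map n s'" "same_fibres n r r'" "same_fibres n s s'"
  obtains p' where "p' permutes {1..n}" "nfv r p s = nfv r' p' s'"
proof -
  have s: "idem_map n s" "idem_map n r" "p permutes {1..n}" using assms by (auto simp: good_def)
  obtain q where q: "q permutes {1..n}" "R r = R r' \<cdot> P q"
    using same_fibres_RL [OF s(2) assms(2,4)] by blast
  obtain q' where q': "q' permutes {1..n}" "L s = P q' \<cdot> L s'"
    using same_fibres_RL [OF s(1) assms(3,5)] by blast
  have "nfv r p s = R r' \<cdot> (P q \<cdot> P p \<cdot> P q') \<cdot> L s'" by (simp add: nfv_def q q' assoc)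
  also have "P q \<cdot> P p \<cdot> P q' = P (q' \<circ> (p \<circ> q))"
    by (simp add: P_comp q(1) q'(1) s(3) permutes_compose)
  finally have "nfv r p s = nfv r' (q' \<circ> (p \<circ> q)) s'" by (simp add: nfv_def)
  moreover have "q' \<circ> (p \<circ> q) permutes {1..n}" by (intro permutes_compose q(1) q'(1) s(3))
  ultimately show ?thesis using that by blast
qed

text \<open>The quotient of the two permutations fixes all representatives of \<open>r\<close>, so
  \<open>R r\<close> absorbs it.\<close>

lemma nfv_eq:
  assumes "idem_map n r" "p permutes {1..n}" "q permutes {1..n}" "\<And>x. x \<in> reps n r \<Longrightarrow> p x = q x"
  shows "nfv r p s = nfv r q s"
proof -
  have pq: "pinv q \<circ> p permutes {1..n}" using permutes_compose [OF assms(2) permutes_inv [OF assms(3)]] .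
  have "pinv q \<circ> p permutes {1..n} - reps n r"
    using pq by (rule permutes_superset) (use assms(4) permutes_inverses(2) [OF assms(3)] in auto)
  then have "R r \<cdot> P q = R r \<cdot> P (pinv q \<circ> p) \<cdot> P q" using R_fix [OF assms(1)] by simp
  also have "\<dots> = R r \<cdot> P (q \<circ> (pinv q \<circ> p))" using P_comp [OF pq assms(3)] by (simp add: assoc)
  also have "q \<circ> (pinv q \<circ> p) = p" using permutes_inverses(1) [OF assms(3)] by (simp add: fun_eq_iff)
  finally show ?thesis by (simp add: nfv_def)
qed

end

section \<open>The partial action on subsets\<close>

fun act :: "gen \<Rightarrow> nat set \<Rightarrow> nat set option" where
  "act (Sig i) A = Some {x. transpose i (Suc i) x \<in> A}"
| "act (Rho i) A = (if i \<in> A \<longleftrightarrow> Suc i \<in> A then Some (A - {Suc i}) else None)"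
| "act (Lam i) A = (if Suc i \<in> A then None else Some (if i \<in> A then insert (Suc i) A else A))"
| "act (Idp i) A = (if i \<in> A then None else Some A)"

primrec run :: "gen list \<Rightarrow> nat set \<Rightarrow> nat set option" where
  "run [] A = Some A"
| "run (x # w) A = Option.bind (act x A) (run w)"

lemma run_append: "run (u @ v) A = Option.bind (run u A) (run v)"
proof (induction u arbitrary: A)
  case (Cons x u)
  then show ?case by (cases "act x A") simp_all
qed simp

lemma abs_gt1: "\<bar>int i - int j\<bar> > 1 \<longleftrightarrow> Suc i < j \<or> Suc j < i"
  "\<bar>int i - int j\<bar> = 1 \<longleftrightarrow> Suc i = j \<or> Suc j = i"
  by auto

text \<open>Each relation comes down to a comparison of memberships in \<open>A\<close>, so all of
  them are settled by one uniform case analysis.\<close>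

lemma run_sound: "S_rel u v \<Longrightarrow> run u A = run v A"
  by (induction rule: S_rel.induct; auto simp: abs_gt1 transpose_def set_eq_iff split: if_splits)

lemma act_Sig: "act (Sig i) A = Some (transpose i (Suc i) ` A)"
proof -
  have "{x. transpose i (Suc i) x \<in> A} = transpose i (Suc i) ` A"
  proof (intro equalityI subsetI)
    fix x assume "x \<in> {x. transpose i (Suc i) x \<in> A}"
    then have "transpose i (Suc i) x \<in> A" by simp
    then have "transpose i (Suc i) (transpose i (Suc i) x) \<in> transpose i (Suc i) ` A" by (rule imageI)
    then show "x \<in> transpose i (Suc i) ` A" by simp
  qed auto
  then show ?thesis by simp
qed

lemma run_Sig: "run (map Sig u) A = Some (wperm u ` A)"
proof (induction u arbitrary: A)
  case (Cons i u)
  show ?case by (simp only: list.map run.simps act_Sig bind.bind_lunit Cons.IH wperm.simps image_comp)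
qed simp

lemma run_permword: "p permutes {1..n} \<Longrightarrow> run (map Sig (permword n p)) A = Some (p ` A)"
  by (simp only: run_Sig permword(2))

lemma image_pinv:
  assumes "q permutes S"
  shows "x \<in> pinv q ` A \<longleftrightarrow> q x \<in> A"
proof
  assume "q x \<in> A"
  then have "pinv q (q x) \<in> pinv q ` A" by (rule imageI)
  then show "x \<in> pinv q ` A" unfolding permutes_inverses(2) [OF assms] .
next
  assume "x \<in> pinv q ` A"
  then obtain a where "a \<in> A" "x = pinv q a" by (elim imageE) simp
  then show "q x \<in> A" unfolding \<open>x = pinv q a\<close> permutes_inverses(1) [OF assms] by simp
qed

lemma pairw_perm:
  assumes "i \<noteq> j" "i \<in> {1..n}" "j \<in> {1..n}"
  obtains q where "q permutes {1..n}" "q 1 = i" "q 2 = j"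
    "pairw n w i j = map Sig (permword n (pinv q)) @ [w] @ map Sig (permword n q)"
proof -
  let ?f = "\<lambda>x::nat. if x = 1 then i else j"
  have "n \<ge> 2" using assms by auto
  moreover have "inj_on ?f {1,2}" using assms by (auto simp: inj_on_def)
  ultimately obtain q where q: "q permutes {1..n}" "\<And>x. x \<in> {1,2} \<Longrightarrow> q x = ?f x"
    using permutes_extend [of ?f "{1,2}" "{1..n}"] assms by auto
  then have "\<exists>q. q permutes {1..n} \<and> q 1 = i \<and> q 2 = j" by (intro exI [of _ q]) simp
  from someI_ex [OF this] show ?thesis
    by (intro that) (blast | (subst pairw_def, simp only: Let_def))+
qed

lemma run_Rho:
  assumes "i \<noteq> j" "i \<in> {1..n}" "j \<in> {1..n}"
  shows "run (pairw n (Rho 1) i j) A = Some B \<longleftrightarrow> (i \<in> A \<longleftrightarrow> j \<in> A) \<and> B = A - {j}"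
proof -
  obtain q where q: "q permutes {1..n}" "q 1 = i" "q 2 = j"
    "pairw n (Rho 1) i j = map Sig (permword n (pinv q)) @ [Rho 1] @ map Sig (permword n q)"
    by (rule pairw_perm [OF assms])
  have im: "q ` (pinv q ` A - {2}) = A - {j}"
    using q(3) by (simp add: image_set_diff [OF permutes_inj [OF q(1)]] image_f_inv_f [OF permutes_surj [OF q(1)]])
  have m: "1 \<in> pinv q ` A \<longleftrightarrow> i \<in> A" "2 \<in> pinv q ` A \<longleftrightarrow> j \<in> A"
    by (simp_all only: image_pinv [OF q(1)] q(2,3))
  have "run (pairw n (Rho 1) i j) A = (if i \<in> A \<longleftrightarrow> j \<in> A then Some (A - {j}) else None)"
    using m im unfolding q(4) run_append run_permword [OF q(1)] run_permword [OF permutes_inv [OF q(1)]]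
    by (simp add: run_permword [OF q(1)] numeral_2_eq_2)
  then show ?thesis by auto
qed

text \<open>The partial map of \<lambda> is the converse of that of \<rho>; it is written with the
  result \<open>B\<close> as free variable so that splittings mirror merges.\<close>

lemma run_Lam:
  assumes "i \<noteq> j" "i \<in> {1..n}" "j \<in> {1..n}"
  shows "run (pairw n (Lam 1) i j) A = Some B \<longleftrightarrow> (i \<in> B \<longleftrightarrow> j \<in> B) \<and> A = B - {j}"
proof -
  obtain q where q: "q permutes {1..n}" "q 1 = i" "q 2 = j"
    "pairw n (Lam 1) i j = map Sig (permword n (pinv q)) @ [Lam 1] @ map Sig (permword n q)"
    by (rule pairw_perm [OF assms])
  have im: "q ` pinv q ` A = A" "q ` insert 2 (pinv q ` A) = insert j A"
    using q(3) by (simp_all add: image_f_inv_f [OF permutes_surj [OF q(1)]])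
  have m: "1 \<in> pinv q ` A \<longleftrightarrow> i \<in> A" "2 \<in> pinv q ` A \<longleftrightarrow> j \<in> A"
    by (simp_all only: image_pinv [OF q(1)] q(2,3))
  have "run (pairw n (Lam 1) i j) A = (if j \<in> A then None else Some (if i \<in> A then insert j A else A))"
    using m im unfolding q(4) run_append run_permword [OF q(1)] run_permword [OF permutes_inv [OF q(1)]]
    by (simp add: run_permword [OF q(1)] numeral_2_eq_2)
  then show ?thesis using assms(1) by (auto split: if_splits)
qed

text \<open>The local condition at \<open>x\<close> for \<open>A\<close> to be a union of fibres of
  \<open>r\<close> that avoids the points.\<close>

definition sat :: "(nat \<Rightarrow> nat) \<Rightarrow> nat set \<Rightarrow> nat \<Rightarrow> bool" where
  "sat r A x \<longleftrightarrow> (if r x = 0 then x \<notin> A else x \<in> A \<longleftrightarrow> r x \<in> A)"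

lemma run_repw_Rho:
  assumes "idem_map n r" "x \<in> {1..n}"
  shows "run (repw n (Rho 1) r x) A = Some B \<longleftrightarrow> sat r A x \<and> B = (if r x = x then A else A - {x})"
proof -
  consider "r x = x" | "r x = 0" "r x \<noteq> x" | "r x \<noteq> 0" "r x \<noteq> x" by argo
  then show ?thesis
  proof cases
    case 3
    then have "r x \<in> {1..n}" using idem_mapD [OF assms] by blast
    then have "run (repw n (Rho 1) r x) A = Some B \<longleftrightarrow> (r x \<in> A \<longleftrightarrow> x \<in> A) \<and> B = A - {x}"
      using 3 run_Rho [OF 3(2) _ assms(2)] by (simp only: repw_def if_False)
    then show ?thesis using 3 unfolding sat_def by argo
  next
    case 1
    then show ?thesis using assms(2) by (simp add: repw_def sat_def; blast)
  next
    case 2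
    then show ?thesis using assms(2) by (simp add: repw_def sat_def; blast)
  qed
qed

lemma run_repw_Lam:
  assumes "idem_map n r" "x \<in> {1..n}"
  shows "run (repw n (Lam 1) r x) A = Some B \<longleftrightarrow> sat r B x \<and> A = (if r x = x then B else B - {x})"
proof -
  consider "r x = x" | "r x = 0" "r x \<noteq> x" | "r x \<noteq> 0" "r x \<noteq> x" by argo
  then show ?thesis
  proof cases
    case 3
    then have "r x \<in> {1..n}" using idem_mapD [OF assms] by blast
    then have "run (repw n (Lam 1) r x) A = Some B \<longleftrightarrow> (r x \<in> B \<longleftrightarrow> x \<in> B) \<and> A = B - {x}"
      using 3 run_Lam [OF 3(2) _ assms(2)] by (simp only: repw_def if_False)
    then show ?thesis using 3 unfolding sat_def by argo
  next
    case 1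
    then show ?thesis using assms(2) by (simp add: repw_def sat_def; blast)
  next
    case 2
    then show ?thesis using assms(2) by (simp add: repw_def sat_def; blast)
  qed
qed

text \<open>An index that is not a representative occurs in no condition but its own, so its removal
  does not affect the others. This lets the factors be run one after the other.\<close>

lemma sat_Diff:
  assumes "idem_map n r" "x \<in> {1..n}" "r x \<noteq> x" "y \<in> {1..n}" "y \<noteq> x"
  shows "sat r (A - {x}) y \<longleftrightarrow> sat r A y"
proof -
  have "r y \<noteq> x" using idem_mapD [OF assms(1,4)] assms(2,3) by (metis atLeastAtMost_iff not_one_le_zero)
  then show ?thesis using assms(5) by (simp add: sat_def)
qed

lemma run_R:
  assumes "idem_map n r" "distinct xs" "set xs \<subseteq> {1..n}"
  shows "run (concat (map (repw n (Rho 1) r) xs)) A = Some B \<longleftrightarrow>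
    (\<forall>x\<in>set xs. sat r A x) \<and> B = A - {x \<in> set xs. r x \<noteq> x}"
  using assms(2,3)
proof (induction xs arbitrary: A)
  case (Cons x xs)
  then have x: "x \<in> {1..n}" "x \<notin> set xs" "set xs \<subseteq> {1..n}" by auto
  let ?A = "if r x = x then A else A - {x}"
  have s: "sat r ?A y \<longleftrightarrow> sat r A y" if "y \<in> set xs" for y
  proof -
    have "y \<in> {1..n}" "y \<noteq> x" using that x by auto
    then show ?thesis using sat_Diff [OF assms(1) x(1)] by auto
  qed
  have "run (concat (map (repw n (Rho 1) r) (x # xs))) A = Some B \<longleftrightarrow>
      sat r A x \<and> run (concat (map (repw n (Rho 1) r) xs)) ?A = Some B"
    by (simp add: run_append bind_eq_Some_conv run_repw_Rho [OF assms(1) x(1), unfolded One_nat_def])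
  also have "run (concat (map (repw n (Rho 1) r) xs)) ?A = Some B \<longleftrightarrow>
      (\<forall>y\<in>set xs. sat r ?A y) \<and> B = ?A - {y \<in> set xs. r y \<noteq> y}"
    by (rule Cons.IH) (use Cons.prems in simp_all)
  also have "(\<forall>y\<in>set xs. sat r ?A y) \<longleftrightarrow> (\<forall>y\<in>set xs. sat r A y)"
    by (rule ball_cong [OF HOL.refl s])
  also have "?A - {y \<in> set xs. r y \<noteq> y} = A - {y \<in> set (x # xs). r y \<noteq> y}" by auto
  finally show ?case by simp
qed (simp; blast)

text \<open>A splitting is described through its result, so the word is unrolled from its
  end.\<close>

lemma run_L:
  assumes "idem_map n r" "distinct xs" "set xs \<subseteq> {1..n}"
  shows "run (concat (map (repw n (Lam 1) r) xs)) A = Some B \<longleftrightarrow>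
    (\<forall>x\<in>set xs. sat r B x) \<and> A = B - {x \<in> set xs. r x \<noteq> x}"
  using assms(2,3)
proof (induction xs arbitrary: B rule: rev_induct)
  case (snoc x xs)
  then have x: "x \<in> {1..n}" "x \<notin> set xs" "set xs \<subseteq> {1..n}" by auto
  let ?B = "if r x = x then B else B - {x}"
  have s: "sat r ?B y \<longleftrightarrow> sat r B y" if "y \<in> set xs" for y
  proof -
    have "y \<in> {1..n}" "y \<noteq> x" using that x by auto
    then show ?thesis using sat_Diff [OF assms(1) x(1)] by auto
  qed
  have "run (concat (map (repw n (Lam 1) r) (xs @ [x]))) A = Some B \<longleftrightarrow>
      sat r B x \<and> run (concat (map (repw n (Lam 1) r) xs)) A = Some ?B"
    by (auto simp add: run_append bind_eq_Some_conv run_repw_Lam [OF assms(1) x(1), unfolded One_nat_def])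
  also have "run (concat (map (repw n (Lam 1) r) xs)) A = Some ?B \<longleftrightarrow>
      (\<forall>y\<in>set xs. sat r ?B y) \<and> A = ?B - {y \<in> set xs. r y \<noteq> y}"
    by (rule snoc.IH) (use snoc.prems in simp_all)
  also have "(\<forall>y\<in>set xs. sat r ?B y) \<longleftrightarrow> (\<forall>y\<in>set xs. sat r B y)"
    by (rule ball_cong [OF HOL.refl s])
  also have "?B - {y \<in> set xs. r y \<noteq> y} = B - {y \<in> set (xs @ [x]). r y \<noteq> y}" by auto
  finally show ?case by auto
qed auto

text \<open>The sets on both sides of \<open>p\<close> are forced to be the restrictions of
  \<open>A\<close> and \<open>B\<close> to representatives. A normal form thus relates unions of
  upper fibres to unions of lower fibres by way of \<open>p\<close>.\<close>

lemma run_nfw: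
  assumes "idem_map n r" "idem_map n s" "p permutes {1..n}" "A \<subseteq> {1..n}" "B \<subseteq> {1..n}"
  shows "run (nfw n r p s) A = Some B \<longleftrightarrow>
    (\<forall>x\<in>{1..n}. sat r A x) \<and> (\<forall>x\<in>{1..n}. sat s B x) \<and> p ` (A \<inter> reps n r) = B \<inter> reps n s"
proof -
  have i: "distinct [1..<Suc n]" "set [1..<Suc n] = {1..n}" by auto
  have *: "A - {x \<in> {1..n}. r x \<noteq> x} = A \<inter> reps n r" "B - {x \<in> {1..n}. s x \<noteq> x} = B \<inter> reps n s"
    using assms(4,5) by (auto simp: reps_def)
  show ?thesis
    unfolding nfw_def run_append bind_eq_Some_conv
      run_R [OF assms(1) i(1), unfolded i(2), OF order_refl] run_L [OF assms(2) i(1), unfolded i(2), OF order_refl]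
      run_permword [OF assms(3)] * by auto
qed

section \<open>Blocks of a partition\<close>

lemma same_block_sym: "same_block a u v \<Longrightarrow> same_block a v u"
  unfolding same_block_def by blast

lemma same_block_refl: "partition_on Z a \<Longrightarrow> u \<in> Z \<Longrightarrow> same_block a u u"
  unfolding same_block_def partition_on_def by blast

lemma same_block_in: "partition_on Z a \<Longrightarrow> same_block a u v \<Longrightarrow> u \<in> Z \<and> v \<in> Z"
  unfolding same_block_def partition_on_def by blast

lemma partition_on_unique:
  assumes "partition_on Z a" "K \<in> a" "K' \<in> a" "u \<in> K" "u \<in> K'"
  shows "K = K'"
  using assms unfolding partition_on_def disjoint_def by blast

lemma same_block_trans: "partition_on Z a \<Longrightarrow> same_block a u v \<Longrightarrow> same_block a v w \<Longrightarrow> same_block a u w"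
  unfolding same_block_def by (metis partition_on_unique)

section \<open>Products of partitions\<close>

text \<open>The common shape of the chains in the product, on the positions 1 to
  \<open>2 * s\<close>: \<open>q\<close> joins an odd position to the next even one and
  \<open>p\<close> an even one to the next odd one, so the first and the last step belong to
  \<open>q\<close>.\<close>

definition alt :: "('a \<Rightarrow> 'a \<Rightarrow> bool) \<Rightarrow> ('a \<Rightarrow> 'a \<Rightarrow> bool) \<Rightarrow> nat \<Rightarrow> (nat \<Rightarrow> 'a) \<Rightarrow> bool" where
  "alt p q s c \<longleftrightarrow> (\<forall>k\<in>{1..s}. q (c (2 * k - 1)) (c (2 * k))) \<and> (\<forall>k\<in>{1..<s}. p (c (2 * k)) (c (2 * k + 1)))"

text \<open>A path through the two relations in any order is made alternating: a trivial
  \<open>q\<close> step is appended after a \<open>p\<close> step, and transitivity merges a new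
  \<open>q\<close> step into the last one.\<close>

lemma alt_exists:
  assumes "(\<lambda>c d. p c d \<or> q c d)\<^sup>*\<^sup>* c d" "c \<in> X"
    and p: "\<And>c d. p c d \<Longrightarrow> c \<in> X \<and> d \<in> X"
    and q: "\<And>c. c \<in> X \<Longrightarrow> q c c" "\<And>c d. q c d \<Longrightarrow> c \<in> X \<and> d \<in> X" "\<And>c d e. q c d \<Longrightarrow> q d e \<Longrightarrow> q c e"
  shows "\<exists>s\<ge>1. \<exists>f. f 1 = c \<and> f (2 * s) = d \<and> (\<forall>k\<in>{1..2 * s}. f k \<in> X) \<and> alt p q s f"
  using assms(1)
proof (induction rule: rtranclp_induct)
  case base
  show ?case using assms(2) q(1) by (intro exI [of _ 1] conjI exI [of _ "\<lambda>_. c"]) (auto simp: alt_def)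
next
  case (step d d')
  then obtain s f where s: "s \<ge> 1" "f 1 = c" "f (2 * s) = d" "\<forall>k\<in>{1..2 * s}. f k \<in> X" "alt p q s f"
    by blast
  from step(2) show ?case
  proof
    assume d: "p d d'"
    let ?f = "f(2 * s + 1 := d', 2 * s + 2 := d')"
    have "q (?f (2 * k - 1)) (?f (2 * k))" if "k \<in> {1..s + 1}" for k
    proof (cases "k = s + 1")
      case True then show ?thesis using p [OF d] q(1) by simp
    next
      case False
      then have "2 * k - 1 < 2 * s + 1" "2 * k < 2 * s + 1" "k \<in> {1..s}" using that by auto
      then show ?thesis using s(5) by (simp add: alt_def)
    qed
    moreover have "p (?f (2 * k)) (?f (2 * k + 1))" if "k \<in> {1..<s + 1}" for k
    proof (cases "k = s")
      case True then show ?thesis using d s(3) by simp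
    next
      case False
      then have "2 * k + 1 < 2 * s + 1" "k \<in> {1..<s}" using that by auto
      then show ?thesis using s(5) by (simp add: alt_def)
    qed
    ultimately have "alt p q (s + 1) ?f" unfolding alt_def by blast
    moreover have "\<forall>k\<in>{1..2 * (s + 1)}. ?f k \<in> X" using s(4) p [OF d] by (auto simp: le_Suc_eq)
    moreover have "?f 1 = c" using s(1,2) by simp
    moreover have "?f (2 * (s + 1)) = d'" by simp
    moreover have "1 \<le> s + 1" by simp
    ultimately show ?thesis by (intro exI [of _ "s + 1"] exI [of _ ?f] conjI)
  next
    assume d: "q d d'"
    let ?f = "f(2 * s := d')"
    have "q (?f (2 * k - 1)) (?f (2 * k))" if "k \<in> {1..s}" for k
    proof -
      have *: "2 * k - 1 \<noteq> 2 * s" using that by (auto; presburger)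
      have k: "q (f (2 * k - 1)) (f (2 * k))" using s(5) that by (simp add: alt_def)
      show ?thesis
      proof (cases "k = s")
        case True
        then have "q (f (2 * k - 1)) d" using k s(3) by simp
        then show ?thesis using * True q(3) [OF _ d] by simp
      next
        case False
        then show ?thesis using * k by simp
      qed
    qed
    moreover have "p (?f (2 * k)) (?f (2 * k + 1))" if "k \<in> {1..<s}" for k
    proof -
      have "2 * k \<noteq> 2 * s" "2 * k + 1 \<noteq> 2 * s" using that by (simp, presburger)
      then show ?thesis using that s(5) by (simp add: alt_def)
    qed
    ultimately have "alt p q s ?f" unfolding alt_def by blast
    moreover have "\<forall>k\<in>{1..2 * s}. ?f k \<in> X" using s(4) q(2) [OF d] by auto
    moreover have "?f 1 = c" using s(1,2) by auto
    moreover have "?f (2 * s) = d'" by simp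
    ultimately show ?thesis using s(1) by (intro exI [of _ s] exI [of _ ?f] conjI)
  qed
qed

text \<open>Odd positions are included because the chains between the two outer rows stop
  there.\<close>

lemma alt_path:
  assumes "alt p q s f" "1 \<le> k" "k \<le> s"
  shows "(\<lambda>c d. p c d \<or> q c d)\<^sup>*\<^sup>* (f 1) (f (2 * k - 1))"
    and "(\<lambda>c d. p c d \<or> q c d)\<^sup>*\<^sup>* (f 1) (f (2 * k))"
proof -
  let ?E = "\<lambda>c d. p c d \<or> q c d"
  have q: "q (f (2 * k - 1)) (f (2 * k))" if "1 \<le> k" "k \<le> s" for k
    using assms(1) that by (simp add: alt_def)
  have *: "?E\<^sup>*\<^sup>* (f 1) (f (2 * k - 1)) \<and> ?E\<^sup>*\<^sup>* (f 1) (f (2 * k))"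
    using assms(2,3)
  proof (induction k rule: nat_induct_at_least)
    case base
    then show ?case using q [of 1] by auto
  next
    case (Suc k)
    then have "p (f (2 * k)) (f (2 * k + 1))" using assms(1) by (simp add: alt_def)
    moreover have "?E\<^sup>*\<^sup>* (f 1) (f (2 * k))" using Suc by simp
    ultimately have 1: "?E\<^sup>*\<^sup>* (f 1) (f (2 * Suc k - 1))" by (simp add: rtranclp.rtrancl_into_rtrancl)
    have "q (f (2 * Suc k - 1)) (f (2 * Suc k))" using q [of "Suc k"] Suc by simp
    then have "?E\<^sup>*\<^sup>* (f 1) (f (2 * Suc k))" using rtranclp.rtrancl_into_rtrancl [OF 1] by blast
    with 1 show ?case by blast
  qed
  then show "?E\<^sup>*\<^sup>* (f 1) (f (2 * k - 1))" "?E\<^sup>*\<^sup>* (f 1) (f (2 * k))" by blast+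
qed

lemma alt_pathE:
  assumes "alt p q s f" "1 \<le> s" "E = (\<lambda>c d. p c d \<or> q c d)\<^sup>*\<^sup>*"
  shows "E (f 1) (f (2 * s))"
  using alt_path(2) [OF assms(1,2)] assms(3) by simp

text \<open>In a product \<open>a \<cdot> b\<close> the middle row is glued by \<open>lower_rel a\<close> and \<open>upper_rel b\<close>; \<open>mid a b u c\<close>
  says that the point \<open>u\<close> of the outer rows meets the middle row in \<open>c\<close>.\<close>

definition lower_rel :: "('a + 'a) set set \<Rightarrow> 'a \<Rightarrow> 'a \<Rightarrow> bool" where
  "lower_rel a c d \<longleftrightarrow> same_block a (Inr c) (Inr d)"

definition upper_rel :: "('a + 'a) set set \<Rightarrow> 'a \<Rightarrow> 'a \<Rightarrow> bool" where
  "upper_rel b c d \<longleftrightarrow> same_block b (Inl c) (Inl d)"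

definition conn :: "('a + 'a) set set \<Rightarrow> ('a + 'a) set set \<Rightarrow> 'a \<Rightarrow> 'a \<Rightarrow> bool" where
  "conn a b = (\<lambda>c d. lower_rel a c d \<or> upper_rel b c d)\<^sup>*\<^sup>*"

definition mid :: "('a + 'a) set set \<Rightarrow> ('a + 'a) set set \<Rightarrow> 'a + 'a \<Rightarrow> 'a \<Rightarrow> bool" where
  "mid a b u c \<longleftrightarrow> (case u of Inl x \<Rightarrow> same_block a (Inl x) (Inr c) | Inr y \<Rightarrow> same_block b (Inl c) (Inr y))"

context
  fixes X :: "'a set" and a b :: "('a + 'a) set set"
  assumes ab: "a \<in> IP X" "b \<in> IP X"
begin

lemma part: "partition_on (X <+> X) a" "partition_on (X <+> X) b"
  using ab by (auto simp: IP_def)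

lemma lower_rel_in: "lower_rel a c d \<Longrightarrow> c \<in> X \<and> d \<in> X" and upper_rel_in: "upper_rel b c d \<Longrightarrow> c \<in> X \<and> d \<in> X"
  using same_block_in [OF part(1), of "Inr c" "Inr d"] same_block_in [OF part(2), of "Inl c" "Inl d"]
  by (auto simp: lower_rel_def upper_rel_def)

lemma lower_rel_refl: "c \<in> X \<Longrightarrow> lower_rel a c c" and upper_rel_refl: "c \<in> X \<Longrightarrow> upper_rel b c c"
  using same_block_refl [OF part(1), of "Inr c"] same_block_refl [OF part(2), of "Inl c"]
  by (auto simp: lower_rel_def upper_rel_def)

lemma lower_rel_trans: "lower_rel a c d \<Longrightarrow> lower_rel a d f \<Longrightarrow> lower_rel a c f" and upper_rel_trans: "upper_rel b c d \<Longrightarrow> upper_rel b d f \<Longrightarrow> upper_rel b c f"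
  using same_block_trans [OF part(1)] same_block_trans [OF part(2)] unfolding lower_rel_def upper_rel_def by blast+

lemma mid_in: "mid a b u c \<Longrightarrow> u \<in> X <+> X \<and> c \<in> X"
  unfolding mid_def using same_block_in [OF part(1)] same_block_in [OF part(2)]
  by (fastforce split: sum.splits)

lemma conn_sym: "conn a b c d \<Longrightarrow> conn a b d c"
  unfolding conn_def by (rule sympD [OF symp_rtranclp])
    (auto simp: symp_def lower_rel_def upper_rel_def intro: same_block_sym)

lemma conn_trans: "conn a b c d \<Longrightarrow> conn a b d f \<Longrightarrow> conn a b c f"
  unfolding conn_def by (rule rtranclp_trans)

lemma conn_swap: "conn a b = (\<lambda>c d. upper_rel b c d \<or> lower_rel a c d)\<^sup>*\<^sup>*"
  unfolding conn_def by (intro arg_cong [of _ _ rtranclp] ext) blast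

lemma chain_exists:
  assumes "conn a b c d" "c \<in> X"
  shows "\<exists>s\<ge>1. \<exists>f. f 1 = c \<and> f (2 * s) = d \<and> (\<forall>k\<in>{1..2 * s}. f k \<in> X) \<and> alt (lower_rel a) (upper_rel b) s f"
  by (rule alt_exists [OF assms(1) [unfolded conn_def] assms(2)])
    (erule lower_rel_in upper_rel_refl upper_rel_in | erule (1) upper_rel_trans)+

lemma chain_exists_swap:
  assumes "conn a b c d" "c \<in> X"
  shows "\<exists>s\<ge>1. \<exists>f. f 1 = c \<and> f (2 * s) = d \<and> (\<forall>k\<in>{1..2 * s}. f k \<in> X) \<and> alt (upper_rel b) (lower_rel a) s f"
  by (rule alt_exists [OF assms(1) [unfolded conn_swap] assms(2)])
    (erule upper_rel_in lower_rel_refl lower_rel_in | erule (1) lower_rel_trans)+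

lemma line_block:
  assumes "K \<in> a \<or> K \<in> b"
  obtains x y where "Inl x \<in> K" "Inr y \<in> K"
proof -
  have "is_line K" using assms ab by (auto simp: IP_def)
  then show ?thesis using that by (auto simp: is_line_def)
qed

text \<open>All blocks are lines, so nothing in the outer rows is cut off from the middle row. This
  reduces the product to connectivity in the middle.\<close>

lemma mid_ex:
  assumes "u \<in> X <+> X"
  obtains c where "mid a b u c"
proof (cases u)
  case (Inl x)
  then obtain K where K: "K \<in> a" "Inl x \<in> K" using assms part(1) unfolding partition_on_def by blast
  obtain c where "Inr c \<in> K" using line_block K(1) by metis
  then show ?thesis using that K Inl by (auto simp: mid_def same_block_def)
next
  case (Inr y)
  then obtain K where K: "K \<in> b" "Inr y \<in> K" using assms part(2) unfolding partition_on_def by blast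
  obtain c where "Inl c \<in> K" using line_block K(1) by metis
  then show ?thesis using that K Inr by (auto simp: mid_def same_block_def)
qed

lemma mid_ex_Inl:
  assumes "c \<in> X"
  obtains x where "mid a b (Inl x) c"
proof -
  obtain K where K: "K \<in> a" "Inr c \<in> K" using assms part(1) unfolding partition_on_def by blast
  obtain x where "Inl x \<in> K" using line_block K(1) by metis
  then show ?thesis using that K by (auto simp: mid_def same_block_def)
qed

lemma mid_ex_Inr:
  assumes "c \<in> X"
  obtains y where "mid a b (Inr y) c"
proof -
  obtain K where K: "K \<in> b" "Inl c \<in> K" using assms part(2) unfolding partition_on_def by blast
  obtain y where "Inr y \<in> K" using line_block K(1) by metis
  then show ?thesis using that K by (auto simp: mid_def same_block_def)
qed

lemma mid_conn: "mid a b u c \<Longrightarrow> mid a b u d \<Longrightarrow> conn a b c d"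
proof -
  assume *: "mid a b u c" "mid a b u d"
  have "lower_rel a c d \<or> upper_rel b c d"
  proof (cases u)
    case (Inl x)
    then show ?thesis using * same_block_trans [OF part(1) same_block_sym, of "Inl x"]
      unfolding mid_def lower_rel_def by simp
  next
    case (Inr y)
    then show ?thesis using * same_block_trans [OF part(2) _ same_block_sym, of "Inl c" "Inr y"]
      unfolding mid_def upper_rel_def by simp
  qed
  then show ?thesis unfolding conn_def by blast
qed

text \<open>Chains become connectivity in the middle row between points of contact; the other two
  kinds of chain receive the same description.\<close>

lemma upper_chain_iff:
  "upper_chain X a b x y \<longleftrightarrow> (\<exists>c d. mid a b (Inl x) c \<and> mid a b (Inl y) d \<and> conn a b c d)"
proof
  assume "upper_chain X a b x y"
  then obtain s c where s: "s \<ge> 1" "same_block a (Inl x) (Inr (c 1))" "alt (lower_rel a) (upper_rel b) s c"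
    "same_block a (Inr (c (2 * s))) (Inl y)"
    unfolding upper_chain_def alt_def lower_rel_def upper_rel_def by blast
  have "conn a b (c 1) (c (2 * s))" using alt_pathE [OF s(3,1)] conn_def by blast
  moreover have "mid a b (Inl x) (c 1)" "mid a b (Inl y) (c (2 * s))" using s same_block_sym by (auto simp: mid_def)
  ultimately show "\<exists>c d. mid a b (Inl x) c \<and> mid a b (Inl y) d \<and> conn a b c d" by blast
next
  assume "\<exists>c d. mid a b (Inl x) c \<and> mid a b (Inl y) d \<and> conn a b c d"
  then obtain c d where cd: "mid a b (Inl x) c" "mid a b (Inl y) d" "conn a b c d" by blast
  have "c \<in> X" using mid_in cd by blast
  from chain_exists [OF cd(3) this]
  obtain s f where s: "s \<ge> 1" "f 1 = c" "f (2 * s) = d" "\<forall>k\<in>{1..2 * s}. f k \<in> X" "alt (lower_rel a) (upper_rel b) s f"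
    by blast
  have "same_block a (Inl x) (Inr (f 1))" "same_block a (Inr (f (2 * s))) (Inl y)"
    using cd s same_block_sym by (auto simp: mid_def)
  then show "upper_chain X a b x y"
    using s unfolding upper_chain_def alt_def lower_rel_def upper_rel_def by blast
qed

lemma lower_chain_iff:
  "lower_chain X a b x y \<longleftrightarrow> (\<exists>c d. mid a b (Inr x) c \<and> mid a b (Inr y) d \<and> conn a b c d)"
proof
  assume "lower_chain X a b x y"
  then obtain s c where s: "s \<ge> 1" "same_block b (Inr x) (Inl (c 1))" "alt (upper_rel b) (lower_rel a) s c"
    "same_block b (Inl (c (2 * s))) (Inr y)"
    unfolding lower_chain_def alt_def lower_rel_def upper_rel_def by blast
  have "conn a b (c 1) (c (2 * s))" using alt_pathE [OF s(3,1)] conn_swap by blast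
  moreover have "mid a b (Inr x) (c 1)" "mid a b (Inr y) (c (2 * s))" using s same_block_sym by (auto simp: mid_def)
  ultimately show "\<exists>c d. mid a b (Inr x) c \<and> mid a b (Inr y) d \<and> conn a b c d" by blast
next
  assume "\<exists>c d. mid a b (Inr x) c \<and> mid a b (Inr y) d \<and> conn a b c d"
  then obtain c d where cd: "mid a b (Inr x) c" "mid a b (Inr y) d" "conn a b c d" by blast
  have "c \<in> X" using mid_in cd by blast
  from chain_exists_swap [OF cd(3) this]
  obtain s f where s: "s \<ge> 1" "f 1 = c" "f (2 * s) = d" "\<forall>k\<in>{1..2 * s}. f k \<in> X" "alt (upper_rel b) (lower_rel a) s f"
    by blast
  have "same_block b (Inr x) (Inl (f 1))" "same_block b (Inl (f (2 * s))) (Inr y)"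
    using cd s same_block_sym by (auto simp: mid_def)
  then show "lower_chain X a b x y"
    using s unfolding lower_chain_def alt_def lower_rel_def upper_rel_def by blast
qed

lemma cross_chain_iff:
  "cross_chain X a b x y \<longleftrightarrow> (\<exists>c d. mid a b (Inl x) c \<and> mid a b (Inr y) d \<and> conn a b c d)"
proof
  assume "cross_chain X a b x y"
  then obtain s :: nat and c where s: "s \<ge> 1" "\<forall>k\<in>{1..2 * s - 1}. c k \<in> X" "same_block a (Inl x) (Inr (c 1))"
    "\<forall>k\<in>{1..<s}. upper_rel b (c (2 * k - 1)) (c (2 * k)) \<and> lower_rel a (c (2 * k)) (c (2 * k + 1))"
    "same_block b (Inl (c (2 * s - 1))) (Inr y)"
    unfolding cross_chain_def lower_rel_def upper_rel_def by blast
  \<comment> \<open>A chain between the two rows has odd length; repeating its last element adds a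
    trivial step of \<open>b\<close> and gives the even length that \<open>alt\<close>
    expects.\<close>
  let ?c = "c(2 * s := c (2 * s - 1))"
  have *: "2 * s - 1 \<in> {1..2 * s - 1}" using s(1) by auto
  have "alt (lower_rel a) (upper_rel b) s ?c"
    unfolding alt_def
  proof (intro conjI ballI)
    fix k assume k: "k \<in> {1..s}"
    then have "2 * k - 1 \<noteq> 2 * s" by (auto; presburger)
    then show "upper_rel b (?c (2 * k - 1)) (?c (2 * k))"
      using s(4) k * s(2) upper_rel_refl by (cases "k = s") auto
  next
    fix k assume k: "k \<in> {1..<s}"
    then have "2 * k \<noteq> 2 * s" "2 * k + 1 \<noteq> 2 * s" by (simp, presburger)
    then show "lower_rel a (?c (2 * k)) (?c (2 * k + 1))" using s(4) k by simp
  qed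
  from alt_path(1) [OF this s(1) order_refl]
  have "conn a b (?c 1) (?c (2 * s - 1))" by (simp only: conn_def)
  moreover have "?c 1 = c 1" "?c (2 * s - 1) = c (2 * s - 1)" using s(1) by auto
  ultimately have "conn a b (c 1) (c (2 * s - 1))" by simp
  moreover have "mid a b (Inl x) (c 1)" "mid a b (Inr y) (c (2 * s - 1))" using s by (auto simp: mid_def)
  ultimately show "\<exists>c d. mid a b (Inl x) c \<and> mid a b (Inr y) d \<and> conn a b c d" by blast
next
  assume "\<exists>c d. mid a b (Inl x) c \<and> mid a b (Inr y) d \<and> conn a b c d"
  then obtain c d where cd: "mid a b (Inl x) c" "mid a b (Inr y) d" "conn a b c d" by blast
  have "c \<in> X" using mid_in cd by blast
  from chain_exists [OF cd(3) this]
  obtain s f where s: "s \<ge> 1" "f 1 = c" "f (2 * s) = d" "\<forall>k\<in>{1..2 * s}. f k \<in> X" "alt (lower_rel a) (upper_rel b) s f"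
    by blast
  \<comment> \<open>Conversely, a trivial step of \<open>a\<close> at \<open>d\<close> makes the
    length odd, so the parameter of the chain becomes \<open>s + 1\<close>.\<close>
  let ?f = "f(2 * s + 1 := d)"
  have d: "d \<in> X" using mid_in cd by blast
  have "same_block a (Inl x) (Inr (?f 1))" "same_block b (Inl (?f (2 * (s + 1) - 1))) (Inr y)"
    using cd s by (auto simp: mid_def)
  moreover have "\<forall>k\<in>{1..2 * (s + 1) - 1}. ?f k \<in> X" using s(4) d by auto
  moreover have "upper_rel b (?f (2 * k - 1)) (?f (2 * k)) \<and> lower_rel a (?f (2 * k)) (?f (2 * k + 1))"
    if k: "k \<in> {1..<s + 1}" for k
  proof -
    have "upper_rel b (f (2 * k - 1)) (f (2 * k))" using s(5) k by (simp add: alt_def)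
    then have "upper_rel b (?f (2 * k - 1)) (?f (2 * k))" using k by auto
    moreover have "lower_rel a (?f (2 * k)) (?f (2 * k + 1))"
    proof (cases "k = s")
      case True then show ?thesis using s(3) lower_rel_refl [OF d] by simp
    next
      case False
      then have "k \<in> {1..<s}" using k by auto
      then show ?thesis using s(5) by (simp add: alt_def)
    qed
    ultimately show ?thesis by blast
  qed
  ultimately show "cross_chain X a b x y"
    unfolding cross_chain_def lower_rel_def [symmetric] upper_rel_def [symmetric]
    by (intro exI [of _ "s + 1"] exI [of _ ?f] conjI ballI) (use s in auto)
qed

text \<open>Two elements of one block of a factor share a contact in the middle row, so the clause
  about single blocks fits the description by connectivity as well, and all four cases of the
  definition take one form.\<close>

lemma ip_rel_iff:
  assumes "u \<in> X <+> X" "v \<in> X <+> X"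
  shows "ip_rel X a b u v \<longleftrightarrow> (\<exists>c d. mid a b u c \<and> mid a b v d \<and> conn a b c d)"
proof (cases u; cases v)
  fix x y assume uv: "u = Inl x" "v = Inl y"
  have "\<exists>c d. mid a b u c \<and> mid a b v d \<and> conn a b c d" if "same_block a (Inl x) (Inl y)"
  proof -
    obtain c where c: "mid a b u c" by (rule mid_ex [OF assms(1)])
    then have "mid a b v c"
      using that uv same_block_trans [OF part(1) same_block_sym [OF that], of "Inr c"] by (simp add: mid_def)
    with c show ?thesis using mid_conn by blast
  qed
  then show ?thesis unfolding uv ip_rel.simps upper_chain_iff by blast
next
  fix x y assume uv: "u = Inr x" "v = Inr y"
  have "\<exists>c d. mid a b u c \<and> mid a b v d \<and> conn a b c d" if "same_block b (Inr x) (Inr y)"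
  proof -
    obtain c where c: "mid a b u c" by (rule mid_ex [OF assms(1)])
    then have "mid a b v c"
      using that uv same_block_trans [OF part(2) _ that, of "Inl c"] by (simp add: mid_def)
    with c show ?thesis using mid_conn by blast
  qed
  then show ?thesis unfolding uv ip_rel.simps lower_chain_iff by blast
next
  fix x y assume uv: "u = Inl x" "v = Inr y"
  show ?thesis unfolding uv ip_rel.simps cross_chain_iff by blast
next
  fix x y assume uv: "u = Inr x" "v = Inl y"
  show ?thesis unfolding uv ip_rel.simps cross_chain_iff using conn_sym by blast
qed

lemma equiv_ip_rel: "equiv (X <+> X) {(u, v). u \<in> X <+> X \<and> v \<in> X <+> X \<and> ip_rel X a b u v}" (is "equiv _ ?r")
proof (rule equivI)
  show "?r \<subseteq> (X <+> X) \<times> (X <+> X)" by auto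
  show "refl_on (X <+> X) ?r"
  proof (rule refl_onI)
    fix u assume u: "u \<in> X <+> X"
    obtain c where "mid a b u c" by (rule mid_ex [OF u])
    then have "ip_rel X a b u u" unfolding ip_rel_iff [OF u u] using mid_conn by blast
    then show "(u, u) \<in> ?r" using u by simp
  qed
  show "sym ?r"
  proof (rule symI)
    fix u v assume uv: "(u, v) \<in> ?r"
    then have in2: "u \<in> X <+> X" "v \<in> X <+> X" and "ip_rel X a b u v" by simp_all
    then have "ip_rel X a b v u"
      unfolding ip_rel_iff [OF in2] ip_rel_iff [OF in2(2,1)] using conn_sym by blast
    then show "(v, u) \<in> ?r" using in2 by simp
  qed
  show "trans ?r"
  proof (rule transI)
    fix u v w assume uv: "(u, v) \<in> ?r" and vw: "(v, w) \<in> ?r"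
    have in3: "u \<in> X <+> X" "v \<in> X <+> X" "w \<in> X <+> X" using uv vw by simp_all
    have "ip_rel X a b u v" "ip_rel X a b v w" using uv vw by simp_all
    then obtain c d c' d' where 1: "mid a b u c" "mid a b v d" "conn a b c d"
      and 2: "mid a b v c'" "mid a b w d'" "conn a b c' d'"
      unfolding ip_rel_iff [OF in3(1,2)] ip_rel_iff [OF in3(2,3)] by blast
    have "conn a b c d'" using conn_trans [OF conn_trans [OF 1(3) mid_conn [OF 1(2) 2(1)]] 2(3)] .
    then have "ip_rel X a b u w" unfolding ip_rel_iff [OF in3(1,3)] using 1(1) 2(2) by blast
    then show "(u, w) \<in> ?r" using in3 by simp
  qed
qed

lemma partition_ip_mult: "partition_on (X <+> X) (ip_mult X a b)"
  unfolding ip_mult_def by (rule partition_on_quotient [OF equiv_ip_rel])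

lemma same_block_ip_mult:
  "same_block (ip_mult X a b) u v \<longleftrightarrow> (\<exists>c d. mid a b u c \<and> mid a b v d \<and> conn a b c d)" (is "?l \<longleftrightarrow> ?r")
proof -
  have "?l \<longleftrightarrow> u \<in> X <+> X \<and> v \<in> X <+> X \<and> ip_rel X a b u v"
  proof
    assume ?l
    then obtain K where K: "K \<in> ip_mult X a b" "u \<in> K" "v \<in> K" unfolding same_block_def by blast
    have "{u, v} \<subseteq> K" using K by simp
    from in_quotient_imp_in_rel [OF equiv_ip_rel K(1) [unfolded ip_mult_def] this]
    show "u \<in> X <+> X \<and> v \<in> X <+> X \<and> ip_rel X a b u v" by (simp only: mem_Collect_eq case_prod_conv)
  next
    assume r: "u \<in> X <+> X \<and> v \<in> X <+> X \<and> ip_rel X a b u v"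
    define S where "S = {(u, v). u \<in> X <+> X \<and> v \<in> X <+> X \<and> ip_rel X a b u v}"
    have u: "u \<in> S `` {u}" unfolding S_def
      by (rule equiv_class_self [OF equiv_ip_rel]) (rule conjunct1 [OF r])
    have "(u, v) \<in> S" unfolding S_def using r by (simp only: mem_Collect_eq case_prod_conv)
    then have v: "v \<in> S `` {u}" by (rule ImageI) simp
    have "S `` {u} \<in> ip_mult X a b" unfolding ip_mult_def S_def [symmetric]
      by (rule quotientI) (rule conjunct1 [OF r])
    then show ?l unfolding same_block_def using u v by (intro bexI conjI)
  qed
  also have "\<dots> \<longleftrightarrow> ?r"
  proof
    assume r: "u \<in> X <+> X \<and> v \<in> X <+> X \<and> ip_rel X a b u v"
    then show ?r unfolding ip_rel_iff [OF conjunct1 [OF r] conjunct1 [OF conjunct2 [OF r]]] by (elim conjE)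
  next
    assume r: ?r
    then obtain c d where "mid a b u c" "mid a b v d" by (elim exE conjE)
    then have uv: "u \<in> X <+> X" "v \<in> X <+> X" by (simp_all only: mid_in)
    show "u \<in> X <+> X \<and> v \<in> X <+> X \<and> ip_rel X a b u v" using uv r ip_rel_iff [OF uv] by (intro conjI) simp_all
  qed
  finally show ?thesis .
qed

text \<open>Every class meets the middle row, and every middle point is in contact with both outer
  rows.\<close>

lemma ip_mult_in_IP: "ip_mult X a b \<in> IP X"
proof -
  have "is_line K" if K: "K \<in> ip_mult X a b" for K
  proof -
    obtain u where u: "u \<in> K" using K partition_ip_mult unfolding partition_on_def by (metis ex_in_conv)
    have uX: "u \<in> X <+> X" using u K partition_ip_mult unfolding partition_on_def by blast
    obtain c where c: "mid a b u c" by (rule mid_ex [OF uX])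
    have cX: "c \<in> X" using c mid_in by blast
    obtain x where x: "mid a b (Inl x) c" by (rule mid_ex_Inl [OF cX])
    obtain y where y: "mid a b (Inr y) c" by (rule mid_ex_Inr [OF cX])
    from x y have "same_block (ip_mult X a b) u (Inl x)" "same_block (ip_mult X a b) u (Inr y)"
      using c mid_conn same_block_ip_mult by blast+
    then have "Inl x \<in> K" "Inr y \<in> K"
      using K u partition_on_unique [OF partition_ip_mult] unfolding same_block_def by blast+
    then show ?thesis by (auto simp: is_line_def)
  qed
  then show ?thesis using partition_ip_mult by (simp add: IP_def)
qed

end

text \<open>Unions of blocks, split into their upper and lower halves.\<close>

definition sat_pairs :: "'a set \<Rightarrow> ('a + 'a) set set \<Rightarrow> ('a set \<times> 'a set) set" where
  "sat_pairs X a = {(A, B). A \<subseteq> X \<and> B \<subseteq> X \<and> (\<forall>u v. same_block a u v \<longrightarrow> (u \<in> A <+> B \<longleftrightarrow> v \<in> A <+> B))}"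

text \<open>Membership in an intermediate set is constant along connections in the middle row, which
  gives one inclusion. For the other, the intermediate set consists of all middle points in contact
  with the given outer sets.\<close>

lemma sat_pairs_mult:
  assumes "a \<in> IP X" "b \<in> IP X"
  shows "sat_pairs X (ip_mult X a b) = sat_pairs X a O sat_pairs X b"
proof (intro equalityI subrelI)
  fix A C assume "(A, C) \<in> sat_pairs X a O sat_pairs X b"
  then obtain B where B: "(A, B) \<in> sat_pairs X a" "(B, C) \<in> sat_pairs X b" by blast
  have m: "u \<in> A <+> C \<longleftrightarrow> c \<in> B" if "mid a b u c" for u c
  proof (cases u)
    case (Inl x)
    then have "Inl x \<in> A <+> B \<longleftrightarrow> Inr c \<in> A <+> B" using that B(1) unfolding mid_def sat_pairs_def by auto
    then show ?thesis using Inl by auto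
  next
    case (Inr y)
    then have "Inl c \<in> B <+> C \<longleftrightarrow> Inr y \<in> B <+> C" using that B(2) unfolding mid_def sat_pairs_def by auto
    then show ?thesis using Inr by auto
  qed
  have st: "c \<in> B \<longleftrightarrow> d \<in> B" if "lower_rel a c d \<or> upper_rel b c d" for c d
    using that
  proof
    assume "lower_rel a c d"
    then have "Inr c \<in> A <+> B \<longleftrightarrow> Inr d \<in> A <+> B" using B(1) unfolding lower_rel_def sat_pairs_def by auto
    then show ?thesis by auto
  next
    assume "upper_rel b c d"
    then have "Inl c \<in> B <+> C \<longleftrightarrow> Inl d \<in> B <+> C" using B(2) unfolding upper_rel_def sat_pairs_def by auto
    then show ?thesis by auto
  qed
  have E: "c \<in> B \<longleftrightarrow> d \<in> B" if "conn a b c d" for c d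
    using that unfolding conn_def by (induction rule: rtranclp_induct) (use st in blast)+
  have "u \<in> A <+> C \<longleftrightarrow> v \<in> A <+> C" if "same_block (ip_mult X a b) u v" for u v
    using that m E unfolding same_block_ip_mult [OF assms] by blast
  then show "(A, C) \<in> sat_pairs X (ip_mult X a b)" using B unfolding sat_pairs_def by blast
next
  fix A C assume AC: "(A, C) \<in> sat_pairs X (ip_mult X a b)"
  define B where "B = {c. \<exists>u\<in>A <+> C. mid a b u c}"
  have BX: "B \<subseteq> X" unfolding B_def using mid_in [OF assms] by blast
  have m: "u \<in> A <+> C \<longleftrightarrow> c \<in> B" if "mid a b u c" for u c
  proof
    assume "c \<in> B"
    then obtain v where v: "v \<in> A <+> C" "mid a b v c" unfolding B_def by blast
    have "same_block (ip_mult X a b) u v"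
      using that v(2) mid_conn [OF assms v(2) v(2)] same_block_ip_mult [OF assms] by blast
    then show "u \<in> A <+> C" using AC v(1) unfolding sat_pairs_def by blast
  qed (use that in \<open>unfold B_def, blast\<close>)
  have *: "A \<subseteq> X" "C \<subseteq> X" using AC by (auto simp: sat_pairs_def)
  have "(A, B) \<in> sat_pairs X a"
  proof -
    have e: "\<exists>x. mid a b (Inl x) c \<and> (w \<in> A <+> B \<longleftrightarrow> Inl x \<in> A <+> C) \<and> same_block a w (Inr c)"
      if "w \<in> X <+> X" "same_block a w (Inr c)" for w c
    proof (cases w)
      case (Inl x)
      then show ?thesis using that by (auto simp: mid_def)
    next
      case (Inr d)
      then have d: "d \<in> X" using that by blast
      obtain x where x: "mid a b (Inl x) d" by (rule mid_ex_Inl [OF assms d])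
      then have "mid a b (Inl x) c"
        using that(2) Inr same_block_trans [OF part(1) [OF assms], of "Inl x" "Inr d" "Inr c"] by (simp add: mid_def)
      moreover have "w \<in> A <+> B \<longleftrightarrow> Inl x \<in> A <+> C" using m [OF x] Inr by auto
      ultimately show ?thesis using that by blast
    qed
    have "w \<in> A <+> B \<longleftrightarrow> c \<in> B" if "same_block a w (Inr c)" for w c
      using e [of w c] that same_block_in [OF part(1) [OF assms] that] m by blast
    moreover have "\<exists>c. same_block a w (Inr c)" if w: "w \<in> X <+> X" for w
    proof (cases w)
      case Inl
      obtain c where "mid a b w c" by (rule mid_ex [OF assms w])
      then show ?thesis using Inl by (auto simp: mid_def)
    next
      case (Inr d)
      then show ?thesis using same_block_refl [OF part(1) [OF assms] w] by blast
    qed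
    ultimately have "u \<in> A <+> B \<longleftrightarrow> v \<in> A <+> B" if "same_block a u v" for u v
      using that same_block_in [OF part(1) [OF assms] that] same_block_trans [OF part(1) [OF assms] same_block_sym [OF that]]
      by metis
    then show ?thesis using * BX by (simp add: sat_pairs_def)
  qed
  moreover have "(B, C) \<in> sat_pairs X b"
  proof -
    have e: "\<exists>y. mid a b (Inr y) c \<and> (w \<in> B <+> C \<longleftrightarrow> Inr y \<in> A <+> C) \<and> same_block b w (Inl c)"
      if "w \<in> X <+> X" "same_block b w (Inl c)" for w c
    proof (cases w)
      case (Inr y)
      then show ?thesis using that same_block_sym by (auto simp: mid_def)
    next
      case (Inl d)
      then have d: "d \<in> X" using that by blast
      obtain y where y: "mid a b (Inr y) d" by (rule mid_ex_Inr [OF assms d])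
      then have "mid a b (Inr y) c"
        using same_block_sym [OF that(2)] Inl same_block_trans [OF part(2) [OF assms], of "Inl c" "Inl d" "Inr y"] by (simp add: mid_def)
      moreover have "w \<in> B <+> C \<longleftrightarrow> Inr y \<in> A <+> C" using m [OF y] Inl by auto
      ultimately show ?thesis using that by blast
    qed
    have "w \<in> B <+> C \<longleftrightarrow> c \<in> B" if "same_block b w (Inl c)" for w c
      using e [of w c] that same_block_in [OF part(2) [OF assms] that] m by blast
    moreover have "\<exists>c. same_block b w (Inl c)" if w: "w \<in> X <+> X" for w
    proof (cases w)
      case Inr
      obtain c where "mid a b w c" by (rule mid_ex [OF assms w])
      then show ?thesis using Inr same_block_sym by (auto simp: mid_def)
    next
      case (Inl d)
      then show ?thesis using same_block_refl [OF part(2) [OF assms] w] by blast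
    qed
    ultimately have "u \<in> B <+> C \<longleftrightarrow> v \<in> B <+> C" if "same_block b u v" for u v
      using that same_block_in [OF part(2) [OF assms] that] same_block_trans [OF part(2) [OF assms] same_block_sym [OF that]]
      by metis
    then show ?thesis using * BX by (simp add: sat_pairs_def)
  qed
  ultimately show "(A, C) \<in> sat_pairs X a O sat_pairs X b" by blast
qed

lemma ip_mult_zero:
  assumes "a \<in> IP X" "b \<in> IP X" "z \<in> X" "same_block a (Inl z) (Inr z)" "same_block b (Inl z) (Inr z)"
  shows "same_block (ip_mult X a b) (Inl z) (Inr z)"
proof -
  have "mid a b (Inl z) z" "mid a b (Inr z) z" using assms by (simp_all add: mid_def)
  then show ?thesis using same_block_ip_mult [OF assms(1,2)] mid_conn [OF assms(1,2)] by blast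
qed

section \<open>The faithful action of the monoid of lines and points\<close>

text \<open>A point can satisfy only the first alternative, so it belongs to no admissible pair of
  sets.\<close>

definition fits :: "('a + 'a) set \<Rightarrow> 'a set \<Rightarrow> 'a set \<Rightarrow> bool" where
  "fits K A B \<longleftrightarrow> K \<inter> (A <+> B) = {} \<or> is_line K \<and> K \<subseteq> A <+> B"

definition line_pairs :: "'a set \<Rightarrow> ('a + 'a) set set \<Rightarrow> ('a set \<times> 'a set) set" where
  "line_pairs X c = {(A, B). A \<subseteq> X \<and> B \<subseteq> X \<and> (\<forall>K\<in>c. fits K A B)}"

lemma PIP_partition: "c \<in> PIP X \<Longrightarrow> partition_on (X <+> X) c"
  by (simp add: PIP_def)

lemma PIP_point:
  assumes "c \<in> PIP X" "K \<in> c" "\<not> is_line K"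
  obtains u where "K = {u}"
proof -
  have "card K = 1" using assms by (auto simp: PIP_def is_point_def)
  then show ?thesis using that by (auto simp: card_1_singleton_iff)
qed

lemma not_line_single [simp]: "\<not> is_line {u}"
  by (auto simp: is_line_def)

lemma partition_block:
  assumes "partition_on Z a" "u \<in> Z"
  obtains K where "K \<in> a" "u \<in> K"
  using assms unfolding partition_on_def by blast

lemma partition_sub: "partition_on Z a \<Longrightarrow> K \<in> a \<Longrightarrow> K \<subseteq> Z"
  unfolding partition_on_def by blast

lemma partition_nonempty: "partition_on Z a \<Longrightarrow> K \<in> a \<Longrightarrow> \<exists>u. u \<in> K"
  unfolding partition_on_def by (metis all_not_in_conv)

lemma halves: "Inl -` K <+> Inr -` K = K"
proof (intro equalityI subsetI)
  fix u assume "u \<in> K" then show "u \<in> Inl -` K <+> Inr -` K" by (cases u) auto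
qed auto

lemma line_in_line_pairs:
  assumes "c \<in> PIP X" "K \<in> c" "is_line K"
  shows "(Inl -` K, Inr -` K) \<in> line_pairs X c"
proof -
  have sub: "K \<subseteq> X <+> X" using partition_sub [OF PIP_partition] assms by blast
  have "fits K' (Inl -` K) (Inr -` K)" if "K' \<in> c" for K'
  proof (cases "K' = K")
    case False
    then have "K' \<inter> K = {}" using partition_on_unique [OF PIP_partition [OF assms(1)] that assms(2)] by blast
    then show ?thesis unfolding fits_def halves by blast
  qed (use assms in \<open>simp add: fits_def halves\<close>)
  moreover have "Inl -` K \<subseteq> X" "Inr -` K \<subseteq> X" using sub by auto
  ultimately show ?thesis by (simp add: line_pairs_def)
qed

text \<open>Lines are the minimal nonempty pairs. A line \<open>K\<close> of \<open>c\<close> is a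
  pair for \<open>d\<close>, so the block of \<open>d\<close> at an element of \<open>K\<close> is a
  line inside \<open>K\<close>; by the same argument \<open>K\<close> lies inside that line.\<close>

lemma line_pairs_lines:
  assumes "c \<in> PIP X" "d \<in> PIP X" "line_pairs X c = line_pairs X d" "K \<in> c" "is_line K"
  shows "K \<in> d"
proof -
  have 1: "(Inl -` K, Inr -` K) \<in> line_pairs X d" using line_in_line_pairs assms by blast
  obtain u where u: "u \<in> K" using assms(5) by (auto simp: is_line_def)
  then have "u \<in> X <+> X" using partition_sub [OF PIP_partition] assms by blast
  then obtain K' where K': "K' \<in> d" "u \<in> K'" using partition_block [OF PIP_partition [OF assms(2)]] by metis
  then have "fits K' (Inl -` K) (Inr -` K)" using 1 by (simp add: line_pairs_def)
  then have l: "is_line K'" "K' \<subseteq> K" using u K' unfolding fits_def halves by blast+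
  have "(Inl -` K', Inr -` K') \<in> line_pairs X c" using line_in_line_pairs [OF assms(2) K'(1) l(1)] assms(3) by simp
  then have "fits K (Inl -` K') (Inr -` K')" using assms(4) by (simp add: line_pairs_def)
  then have "K \<subseteq> K'" using u K' unfolding fits_def halves by blast
  then show ?thesis using l K' by (metis subset_antisym)
qed

text \<open>Once the lines agree, the points are what is left over.\<close>

lemma line_pairs_sub:
  assumes "c \<in> PIP X" "d \<in> PIP X" "line_pairs X c = line_pairs X d"
  shows "c \<subseteq> d"
proof
  fix K assume K: "K \<in> c"
  show "K \<in> d"
  proof (cases "is_line K")
    case True then show ?thesis using line_pairs_lines assms K by blast
  next
    case False
    obtain u where u: "K = {u}" by (rule PIP_point [OF assms(1) K False])
    then have uX: "u \<in> X <+> X" using partition_sub [OF PIP_partition [OF assms(1)] K] by simp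
    obtain K' where K': "K' \<in> d" "u \<in> K'" by (rule partition_block [OF PIP_partition [OF assms(2)] uX])
    have "\<not> is_line K'"
    proof
      assume l: "is_line K'"
      then have "K' \<in> c" using line_pairs_lines [OF assms(2,1) assms(3) [symmetric] K'(1)] by blast
      then have "K' = K" using partition_on_unique [OF PIP_partition [OF assms(1)] _ K K'(2)] u by blast
      then show False using l False by simp
    qed
    then obtain v where "K' = {v}" by (rule PIP_point [OF assms(2) K'(1)])
    then show ?thesis using K' u by simp
  qed
qed

lemma line_pairs_inj: "c \<in> PIP X \<Longrightarrow> d \<in> PIP X \<Longrightarrow> line_pairs X c = line_pairs X d \<Longrightarrow> c = d"
  using line_pairs_sub by (metis subset_antisym)

lemma Plus_insert0: "insert 0 X <+> insert 0 X = {Inl 0, Inr 0} \<union> (X <+> X)"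
  by auto

lemma pip_hat_IP:
  assumes "c \<in> PIP X" "0 \<notin> X"
  shows "pip_hat c \<in> IP (insert 0 X)"
proof -
  let ?Z = "{Inl 0, Inr 0} \<union> {u. {u} \<in> c}"
  define W where "W = X <+> X"
  have YW: "insert 0 X <+> insert 0 X = {Inl 0, Inr 0} \<union> W" unfolding W_def by (rule Plus_insert0)
  have W0: "Inl 0 \<notin> W" "Inr 0 \<notin> W" using assms(2) by (auto simp: W_def)
  have part: "partition_on W c" using PIP_partition [OF assms(1)] by (simp add: W_def)
  have sub: "K \<subseteq> W" if "K \<in> c" for K using partition_sub [OF part that] .
  have "u \<in> W" if "{u} \<in> c" for u using sub [OF that] by simp
  then have Z: "?Z \<subseteq> {Inl 0, Inr 0} \<union> W" by blast
  define Z where "Z = ?Z"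
  have hat: "pip_hat c = {A \<in> c. is_line A} \<union> {Z}" by (simp add: pip_hat_def Z_def)
  have disjZ: "K \<inter> ?Z = {}" if "K \<in> c" "is_line K" for K
  proof -
    have "Inl 0 \<notin> K" "Inr 0 \<notin> K" using sub [OF that(1)] W0 by blast+
    moreover have "u \<notin> K" if "{u} \<in> c" for u
    proof
      assume "u \<in> K"
      then have "K = {u}" using partition_on_unique [OF part \<open>K \<in> c\<close> that] by simp
      then show False using \<open>is_line K\<close> by simp
    qed
    ultimately show ?thesis by blast
  qed
  have "partition_on ({Inl 0, Inr 0} \<union> W) (pip_hat c)"
  proof (rule partition_onI)
    have "u \<in> \<Union> (pip_hat c)" if u: "u \<in> W" for u
    proof -
      obtain K where K: "K \<in> c" "u \<in> K" by (rule partition_block [OF part u])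
      show ?thesis
      proof (cases "is_line K")
        case True then show ?thesis using K unfolding hat by blast
      next
        case False
        then obtain v where "K = {v}" by (rule PIP_point [OF assms(1) K(1)])
        then have "u \<in> Z" unfolding Z_def using K by simp
        then show ?thesis unfolding hat by blast
      qed
    qed
    moreover have "Inl 0 \<in> Z" "Inr 0 \<in> Z" by (simp_all add: Z_def)
    moreover have "\<Union> (pip_hat c) \<subseteq> {Inl 0, Inr 0} \<union> W" using Z sub unfolding hat Z_def [symmetric] by blast
    ultimately show "\<Union> (pip_hat c) = {Inl 0, Inr 0} \<union> W" unfolding hat by blast
  next
    have dZ: "K \<inter> Z = {}" if "K \<in> pip_hat c" "K \<noteq> Z" for K
      using disjZ [of K, folded Z_def] that unfolding hat by blast
    fix p q assume pq: "p \<in> pip_hat c" "q \<in> pip_hat c" "p \<noteq> q"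
    consider "p = Z" | "q = Z" | "p \<in> c" "q \<in> c" using pq unfolding hat by blast
    then show "disjnt p q"
    proof cases
      case 1 then show ?thesis using dZ [OF pq(2)] pq(3) unfolding disjnt_def by blast
    next
      case 2 then show ?thesis using dZ [OF pq(1)] pq(3) unfolding disjnt_def by blast
    next
      case 3 then show ?thesis using pq(3) partition_on_unique [OF part 3] unfolding disjnt_def by blast
    qed
  next
    have "Z \<noteq> {}" unfolding Z_def by simp
    then show "{} \<notin> pip_hat c" unfolding hat using partition_nonempty [OF part] by blast
  qed
  moreover have "Inl 0 \<in> Z" "Inr 0 \<in> Z" by (simp_all add: Z_def)
  then have "is_line Z" unfolding is_line_def by blast
  then have "is_line K" if "K \<in> pip_hat c" for K
    using that unfolding hat by blast
  ultimately show ?thesis by (simp add: IP_def YW)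
qed

text \<open>The block of 0 collects the points of \<open>c\<close>, so the unions of blocks that
  avoid 0 are the unions of lines of \<open>c\<close>.\<close>

lemma line_pairs_hat:
  assumes "c \<in> PIP X" "0 \<notin> X"
  shows "line_pairs X c = {(A, B) \<in> sat_pairs (insert 0 X) (pip_hat c). 0 \<notin> A}"
proof -
  define Z where "Z = {Inl 0, Inr 0} \<union> {u. {u} \<in> c}"
  have hat: "pip_hat c = {A \<in> c. is_line A} \<union> {Z}" by (simp add: pip_hat_def Z_def)
  have Z0: "Inl 0 \<in> Z" by (simp add: Z_def)
  note part = PIP_partition [OF assms(1)]
  have "(A, B) \<in> line_pairs X c \<longleftrightarrow> (A, B) \<in> sat_pairs (insert 0 X) (pip_hat c) \<and> 0 \<notin> A" for A B
  proof
    assume AB: "(A, B) \<in> line_pairs X c"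
    then have *: "A \<subseteq> X" "B \<subseteq> X" "\<And>K. K \<in> c \<Longrightarrow> fits K A B" by (simp_all add: line_pairs_def)
    define G where "G = A <+> B"
    have G0: "Inl 0 \<notin> G" "Inr 0 \<notin> G" using *(1,2) assms(2) by (auto simp: G_def)
    have fits: "K \<inter> G = {} \<or> K \<subseteq> G" if "K \<in> c" for K
      using *(3) [OF that] unfolding fits_def G_def [symmetric] by blast
    have Z: "w \<notin> G" if w: "w \<in> Z" for w
    proof -
      consider "w = Inl 0" | "w = Inr 0" | "{w} \<in> c" using w unfolding Z_def by blast
      then show ?thesis
      proof cases
        case 3
        from *(3) [OF this] show ?thesis unfolding fits_def G_def [symmetric] by simp
      qed (simp_all add: G0)
    qed
    have "u \<in> G \<longleftrightarrow> v \<in> G" if uv: "same_block (pip_hat c) u v" for u v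
    proof -
      obtain K where K: "K \<in> pip_hat c" "u \<in> K" "v \<in> K" using uv unfolding same_block_def by (elim bexE conjE)
      then consider "K \<in> c" | "K = Z" unfolding hat by blast
      then show ?thesis
      proof cases
        case 1 then show ?thesis using fits [OF 1] K(2,3) by blast
      next
        case 2 then show ?thesis using Z K(2,3) by simp
      qed
    qed
    moreover have "A \<subseteq> insert 0 X" "B \<subseteq> insert 0 X" "0 \<notin> A" using *(1,2) assms(2) by blast+
    ultimately show "(A, B) \<in> sat_pairs (insert 0 X) (pip_hat c) \<and> 0 \<notin> A"
      unfolding sat_pairs_def G_def by simp
  next
    assume AB: "(A, B) \<in> sat_pairs (insert 0 X) (pip_hat c) \<and> 0 \<notin> A"
    define G where "G = A <+> B"
    have s: "\<And>u v. same_block (pip_hat c) u v \<Longrightarrow> u \<in> G \<longleftrightarrow> v \<in> G"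
      "A \<subseteq> insert 0 X" "B \<subseteq> insert 0 X" using AB unfolding sat_pairs_def G_def by simp_all
    have G0: "Inl 0 \<notin> G" using AB by (auto simp: G_def)
    have sb: "u \<in> G \<longleftrightarrow> v \<in> G" if "K \<in> pip_hat c" "u \<in> K" "v \<in> K" for K u v
      by (rule s(1)) (use that in \<open>unfold same_block_def, intro bexI conjI\<close>)
    have Zh: "Z \<in> pip_hat c" by (simp add: hat)
    have Z: "w \<notin> G" if "w \<in> Z" for w
      using sb [OF Zh that Z0] G0 by simp
    have "Inr 0 \<notin> G" by (rule Z) (simp add: Z_def)
    then have "0 \<notin> B" by (auto simp: G_def)
    then have "A \<subseteq> X" "B \<subseteq> X" using s(2,3) AB by blast+
    moreover have "fits K A B" if K: "K \<in> c" for K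
    proof (cases "is_line K")
      case True
      then have "K \<in> pip_hat c" using K unfolding hat by blast
      from sb [OF this] have "K \<inter> G = {} \<or> K \<subseteq> G" by blast
      then show ?thesis using True unfolding fits_def G_def [symmetric] by blast
    next
      case False
      then obtain v where v: "K = {v}" by (rule PIP_point [OF assms(1) K])
      have "v \<notin> G" by (rule Z) (use K v in \<open>simp add: Z_def\<close>)
      then show ?thesis unfolding fits_def v G_def [symmetric] by simp
    qed
    ultimately show "(A, B) \<in> line_pairs X c" unfolding line_pairs_def by simp
  qed
  then show ?thesis by auto
qed

lemma pip_hat_inj:
  assumes "c \<in> PIP X" "d \<in> PIP X" "0 \<notin> X" "pip_hat c = pip_hat d"
  shows "c = d"
  by (rule line_pairs_inj [OF assms(1,2)])
    (simp only: line_pairs_hat [OF assms(1,3)] line_pairs_hat [OF assms(2,3)] assms(4))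

text \<open>The preimage keeps all blocks except that of 0, from which 0 and 0' are removed and
  whose remaining elements become points.\<close>

lemma pip_hat_surj:
  assumes "m \<in> IP (insert 0 X)" "0 \<notin> X" "same_block m (Inl 0) (Inr 0)"
  shows "\<exists>d\<in>PIP X. pip_hat d = m"
proof -
  define W where "W = X <+> X"
  define Q where "Q = {Inl (0::nat), Inr (0::nat)}"
  have YW: "insert 0 X <+> insert 0 X = Q \<union> W" unfolding W_def Q_def by (rule Plus_insert0)
  have W0: "Q \<inter> W = {}" using assms(2) by (auto simp: W_def Q_def)
  have part: "partition_on (Q \<union> W) m" and line: "\<And>K. K \<in> m \<Longrightarrow> is_line K"
    using assms(1) by (simp_all add: IP_def YW)
  obtain Z where Z: "Z \<in> m" "Inl 0 \<in> Z" "Inr 0 \<in> Z"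
    using assms(3) unfolding same_block_def by (elim bexE conjE)
  have ZO: "Q \<subseteq> Z" using Z by (simp add: Q_def)
  define S where "S = (\<lambda>u. {u}) ` (Z - Q)"
  define M where "M = {K \<in> m. K \<noteq> Z}"
  have disj: "K \<inter> Z = {}" if "K \<in> M" for K
    using partition_on_unique [OF part _ Z(1), of K] that unfolding M_def by blast
  have sub: "K \<subseteq> W" if "K \<in> M" for K
  proof -
    have "K \<subseteq> Q \<union> W" using partition_sub [OF part, of K] that unfolding M_def by blast
    then show ?thesis using disj [OF that] ZO by blast
  qed
  have subZ: "Z - Q \<subseteq> W" using partition_sub [OF part Z(1)] by blast
  have "partition_on W (M \<union> S)"
  proof (rule partition_onI)
    have "\<Union> S = Z - Q" unfolding S_def by blast
    moreover have "\<Union> M \<subseteq> W" using sub by blast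
    moreover have "W \<subseteq> \<Union> M \<union> (Z - Q)"
    proof
      fix u assume u: "u \<in> W"
      then have "u \<in> Q \<union> W" by blast
      then obtain K where K: "K \<in> m" "u \<in> K" by (rule partition_block [OF part])
      show "u \<in> \<Union> M \<union> (Z - Q)"
      proof (cases "K = Z")
        case True then show ?thesis using K(2) u W0 by blast
      next
        case False then show ?thesis using K unfolding M_def by blast
      qed
    qed
    ultimately show "\<Union> (M \<union> S) = W" using subZ by blast
  next
    have MS: "K \<inter> L = {}" if "K \<in> M" "L \<in> S" for K L
    proof -
      have "L \<subseteq> Z" using that(2) unfolding S_def by blast
      then show ?thesis using disj [OF that(1)] by blast
    qed
    fix p q assume pq: "p \<in> M \<union> S" "q \<in> M \<union> S" "p \<noteq> q"
    consider "p \<in> M" "q \<in> M" | "p \<in> M" "q \<in> S" | "p \<in> S" "q \<in> M" | "p \<in> S" "q \<in> S" using pq by blast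
    then show "disjnt p q"
    proof cases
      case 1
      then have "p \<in> m" "q \<in> m" unfolding M_def by simp_all
      then show ?thesis using pq(3) partition_on_unique [OF part, of p q] unfolding disjnt_def by blast
    next
      case 4 then show ?thesis using pq(3) unfolding S_def disjnt_def by (elim imageE) simp
    qed (use MS in \<open>auto simp: disjnt_def\<close>)
  next
    have "K \<noteq> {}" if "K \<in> M" for K using partition_nonempty [OF part, of K] that unfolding M_def by blast
    moreover have "K \<noteq> {}" if "K \<in> S" for K using that unfolding S_def by blast
    ultimately show "{} \<notin> M \<union> S" by blast
  qed
  moreover have "is_line K \<or> is_point K" if "K \<in> M \<union> S" for K
    using that
  proof
    assume "K \<in> M" then show ?thesis using line unfolding M_def by simp
  next
    assume "K \<in> S" then show ?thesis unfolding S_def by (elim imageE) (simp add: is_point_def)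
  qed
  ultimately have "M \<union> S \<in> PIP X" by (simp add: PIP_def W_def)
  moreover have "pip_hat (M \<union> S) = m"
  proof -
    have single: "{u} \<notin> M" for u
    proof
      assume "{u} \<in> M"
      then have "{u} \<in> m" unfolding M_def by simp
      from line [OF this] show False by simp
    qed
    have "\<not> is_line K" if "K \<in> S" for K using that unfolding S_def by (elim imageE) simp
    moreover have "is_line K" if "K \<in> M" for K using that line unfolding M_def by simp
    ultimately have 1: "{A \<in> M \<union> S. is_line A} = M" by blast
    have 2: "{u. {u} \<in> M \<union> S} = Z - Q" using single unfolding S_def by auto
    have "pip_hat (M \<union> S) = M \<union> {Q \<union> (Z - Q)}" unfolding pip_hat_def 1 2 Q_def ..
    also have "Q \<union> (Z - Q) = Z" using ZO by blast
    also have "M \<union> {Z} = m" using Z(1) unfolding M_def by blast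
    finally show ?thesis .
  qed
  ultimately show ?thesis by blast
qed

lemma pip_hat_zero: "same_block (pip_hat c) (Inl 0) (Inr 0)"
  unfolding same_block_def pip_hat_def
  by (rule bexI [of _ "{Inl 0, Inr 0} \<union> {u. {u} \<in> c}"]) simp_all

text \<open>Injectivity and surjectivity of the hat give the definite description in the product its
  meaning; the composition law is \<open>sat_pairs_mult\<close> restricted to the pairs that avoid
  0.\<close>

lemma pip_mult_props:
  assumes "a \<in> PIP X" "b \<in> PIP X" "0 \<notin> X"
  shows "pip_mult X a b \<in> PIP X" "line_pairs X (pip_mult X a b) = line_pairs X a O line_pairs X b"
proof -
  note IPs = pip_hat_IP [OF assms(1,3)] pip_hat_IP [OF assms(2,3)]
  let ?m = "ip_mult (insert 0 X) (pip_hat a) (pip_hat b)"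
  have "same_block ?m (Inl 0) (Inr 0)"
    using ip_mult_zero [OF IPs _ pip_hat_zero pip_hat_zero] by blast
  from pip_hat_surj [OF ip_mult_in_IP [OF IPs] assms(3) this]
  obtain d where d: "d \<in> PIP X" "pip_hat d = ?m" by blast
  have "pip_mult X a b = d"
    unfolding pip_mult_def
  proof (rule the_equality)
    show "d \<in> PIP X \<and> pip_hat d = ?m" using d by blast
    fix c assume "c \<in> PIP X \<and> pip_hat c = ?m"
    then show "c = d" using pip_hat_inj [OF _ d(1) assms(3), of c] d(2) by simp
  qed
  then show "pip_mult X a b \<in> PIP X" using d by simp
  \<comment> \<open>0 and 0' share a block, so avoidance of 0 passes from the first set to the
    intermediate one.\<close>
  have z: "0 \<in> A \<longleftrightarrow> 0 \<in> B" if "(A, B) \<in> sat_pairs Y (pip_hat c)" for A B Y c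
  proof -
    have "\<forall>u v. same_block (pip_hat c) u v \<longrightarrow> (u \<in> A <+> B \<longleftrightarrow> v \<in> A <+> B)"
      using that unfolding sat_pairs_def by simp
    then have "Inl 0 \<in> A <+> B \<longleftrightarrow> Inr 0 \<in> A <+> B" using pip_hat_zero [of c] by simp
    then show ?thesis by auto
  qed
  have "line_pairs X d = {(A, C) \<in> sat_pairs (insert 0 X) (pip_hat a) O sat_pairs (insert 0 X) (pip_hat b). 0 \<notin> A}"
    unfolding line_pairs_hat [OF d(1) assms(3)] d(2) sat_pairs_mult [OF IPs] ..
  also have "\<dots> = line_pairs X a O line_pairs X b"
  proof (intro equalityI subrelI)
    fix A C assume AC: "(A, C) \<in> {(A, C) \<in> sat_pairs (insert 0 X) (pip_hat a) O sat_pairs (insert 0 X) (pip_hat b). 0 \<notin> A}"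
    then have A0: "0 \<notin> A" by simp
    from AC obtain B where B: "(A, B) \<in> sat_pairs (insert 0 X) (pip_hat a)" "(B, C) \<in> sat_pairs (insert 0 X) (pip_hat b)"
      by (simp only: mem_Collect_eq case_prod_conv) (elim conjE relcompEpair)
    have B0: "0 \<notin> B" using z [OF B(1)] A0 by simp
    have "(A, B) \<in> line_pairs X a" using A0 B(1) by (simp add: line_pairs_hat [OF assms(1,3)])
    moreover have "(B, C) \<in> line_pairs X b" using B0 B(2) by (simp add: line_pairs_hat [OF assms(2,3)])
    ultimately show "(A, C) \<in> line_pairs X a O line_pairs X b" by (rule relcompI)
  next
    fix A C assume AC: "(A, C) \<in> line_pairs X a O line_pairs X b"
    then obtain B where B: "(A, B) \<in> line_pairs X a" "(B, C) \<in> line_pairs X b" by (elim relcompEpair)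
    then have "(A, B) \<in> sat_pairs (insert 0 X) (pip_hat a)" "(B, C) \<in> sat_pairs (insert 0 X) (pip_hat b)" "0 \<notin> A"
      unfolding line_pairs_hat [OF assms(1,3)] line_pairs_hat [OF assms(2,3)] by blast+
    then show "(A, C) \<in> {(A, C) \<in> sat_pairs (insert 0 X) (pip_hat a) O sat_pairs (insert 0 X) (pip_hat b). 0 \<notin> A}"
      by (intro CollectI case_prodI conjI relcompI)
  qed
  finally show "line_pairs X (pip_mult X a b) = line_pairs X a O line_pairs X b"
    using \<open>pip_mult X a b = d\<close> by simp
qed

section \<open>The partitions assigned to the generators and their action\<close>

lemma fits_simps:
  "fits {Inl i, Inr j} A B \<longleftrightarrow> (i \<in> A \<longleftrightarrow> j \<in> B)"
  "fits {Inr i, Inl j} A B \<longleftrightarrow> (j \<in> A \<longleftrightarrow> i \<in> B)"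
  "fits {Inl i, Inl j, Inr k} A B \<longleftrightarrow> (i \<in> A \<longleftrightarrow> j \<in> A) \<and> (i \<in> A \<longleftrightarrow> k \<in> B)"
  "fits {Inl i, Inr j, Inr k} A B \<longleftrightarrow> (i \<in> A \<longleftrightarrow> j \<in> B) \<and> (i \<in> A \<longleftrightarrow> k \<in> B)"
  "fits {Inr i} A B \<longleftrightarrow> i \<notin> B"
  "fits {Inl i} A B \<longleftrightarrow> i \<notin> A"
  by (auto simp: fits_def is_line_def)

lemma partition_on_Un:
  assumes "partition_on A P" "partition_on B Q" "A \<inter> B = {}"
  shows "partition_on (A \<union> B) (P \<union> Q)"
proof (rule partition_onI)
  have sub: "\<Union> P = A" "\<Union> Q = B" using assms by (simp_all add: partition_on_def)
  then show "\<Union> (P \<union> Q) = A \<union> B" by blast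
  fix p q assume pq: "p \<in> P \<union> Q" "q \<in> P \<union> Q" "p \<noteq> q"
  consider "p \<in> P" "q \<in> P" | "p \<in> P" "q \<in> Q" | "p \<in> Q" "q \<in> P" | "p \<in> Q" "q \<in> Q" using pq by blast
  then show "disjnt p q"
  proof cases
    case 1 then show ?thesis using partition_on_unique [OF assms(1) 1] pq(3) unfolding disjnt_def by blast
  next
    case 4 then show ?thesis using partition_on_unique [OF assms(2) 4] pq(3) unfolding disjnt_def by blast
  next
    case 2
    then have "p \<subseteq> A" "q \<subseteq> B" using sub by blast+
    then show ?thesis using assms(3) unfolding disjnt_def by blast
  next
    case 3
    then have "p \<subseteq> B" "q \<subseteq> A" using sub by blast+
    then show ?thesis using assms(3) unfolding disjnt_def by blast
  qed
next
  show "{} \<notin> P \<union> Q" using assms by (simp add: partition_on_def)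
qed

lemma partition_on_pairs: "partition_on (Y <+> Y) ((\<lambda>t. {Inl t, Inr t}) ` Y)"
  by (rule partition_onI) (auto simp: disjnt_def)

lemma other_lines_eq: "other_lines n i = (\<lambda>t. {Inl t, Inr t}) ` ({1..n} - {i, i + 1})"
  unfolding other_lines_def by blast

lemma Plus_Un: "(A <+> A) \<union> (B <+> B) = (A \<union> B) <+> (A \<union> B)"
  by auto

lemma Plus_disjoint: "A \<inter> B = {} \<Longrightarrow> (A <+> A) \<inter> (B <+> B) = {}"
  by auto

text \<open>A generator is a partition over \<open>i, i + 1\<close> together with identity lines
  elsewhere, so only the part \<open>P\<close> has to be checked.\<close>

lemma PIP_other_lines:
  assumes "i \<in> {1..<n}" "partition_on ({i, i + 1} <+> {i, i + 1}) P" "\<And>K. K \<in> P \<Longrightarrow> is_line K \<or> is_point K"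
  shows "P \<union> other_lines n i \<in> PIP {1..n}"
proof -
  let ?Y = "{1..n} - {i, i + 1}"
  have "partition_on (({i, i + 1} <+> {i, i + 1}) \<union> (?Y <+> ?Y)) (P \<union> other_lines n i)"
    unfolding other_lines_eq by (rule partition_on_Un [OF assms(2) partition_on_pairs], rule Plus_disjoint) blast
  moreover have "{i, i + 1} \<union> ?Y = {1..n}" using assms(1) by auto
  then have "({i, i + 1} <+> {i, i + 1}) \<union> (?Y <+> ?Y) = {1..n} <+> {1..n}"
    unfolding Plus_Un by (simp only:)
  moreover have "is_line K" if "K \<in> other_lines n i" for K
    using that unfolding other_lines_eq is_line_def by (elim imageE) blast
  then have "\<forall>K\<in>P \<union> other_lines n i. is_line K \<or> is_point K" using assms(3) by blast
  ultimately show ?thesis unfolding PIP_def by simp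
qed

lemma partition_on_two: "K \<inter> L = {} \<Longrightarrow> K \<noteq> {} \<Longrightarrow> L \<noteq> {} \<Longrightarrow> K \<union> L = Z \<Longrightarrow> partition_on Z {K, L}"
  by (auto simp: partition_on_def disjoint_def)

lemma Plus_pair: "{i, j} <+> {i, j} = {Inl i, Inl j, Inr i, Inr j}"
  by auto

lemma is_lineI: "Inl i \<in> K \<Longrightarrow> Inr j \<in> K \<Longrightarrow> is_line K"
  unfolding is_line_def by blast

lemma s_elt_PIP:
  assumes "i \<in> {1..<n}"
  shows "s_elt n i \<in> PIP {1..n}"
  unfolding s_elt_def
proof (rule PIP_other_lines [OF assms])
  show "partition_on ({i, i + 1} <+> {i, i + 1}) {{Inl i, Inr (i + 1)}, {Inr i, Inl (i + 1)}}"
    unfolding Plus_pair by (rule partition_on_two) (simp_all, blast?)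
  have "is_line {Inl i, Inr (i + 1)}" by (rule is_lineI [of i _ "i + 1"]) simp_all
  moreover have "is_line {Inr i, Inl (i + 1)} \<or> is_point {Inr i, Inl (i + 1)}"
    by (rule disjI1, rule is_lineI [of "i + 1" _ i]) (simp_all)
  ultimately show "is_line K \<or> is_point K" if "K \<in> {{Inl i, Inr (i + 1)}, {Inr i, Inl (i + 1)}}" for K
    using that by blast
qed

lemma r_elt_PIP:
  assumes "i \<in> {1..<n}"
  shows "r_elt n i \<in> PIP {1..n}"
  unfolding r_elt_def
proof (rule PIP_other_lines [OF assms])
  show "partition_on ({i, i + 1} <+> {i, i + 1}) {{Inl i, Inl (i + 1), Inr i}, {Inr (i + 1)}}"
    unfolding Plus_pair by (rule partition_on_two) (simp_all, blast?)
  have "is_line {Inl i, Inl (i + 1), Inr i}" by (rule is_lineI [of i _ "i"]) simp_all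
  moreover have "is_line {Inr (i + 1)} \<or> is_point {Inr (i + 1)}"
    by (simp add: is_point_def)
  ultimately show "is_line K \<or> is_point K" if "K \<in> {{Inl i, Inl (i + 1), Inr i}, {Inr (i + 1)}}" for K
    using that by blast
qed

lemma l_elt_PIP:
  assumes "i \<in> {1..<n}"
  shows "l_elt n i \<in> PIP {1..n}"
  unfolding l_elt_def
proof (rule PIP_other_lines [OF assms])
  show "partition_on ({i, i + 1} <+> {i, i + 1}) {{Inl i, Inr i, Inr (i + 1)}, {Inl (i + 1)}}"
    unfolding Plus_pair by (rule partition_on_two) (simp_all, blast?)
  have "is_line {Inl i, Inr i, Inr (i + 1)}" by (rule is_lineI [of i _ "i"]) simp_all
  moreover have "is_line {Inl (i + 1)} \<or> is_point {Inl (i + 1)}"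
    by (simp add: is_point_def)
  ultimately show "is_line K \<or> is_point K" if "K \<in> {{Inl i, Inr i, Inr (i + 1)}, {Inl (i + 1)}}" for K
    using that by blast
qed

lemma one_PIP: "{{Inl t, Inr t} | t. t \<in> {1..n}} \<in> PIP {1..n}"
proof -
  have eq: "{{Inl t, Inr t} | t. t \<in> {1..n}} = (\<lambda>t. {Inl t, Inr t}) ` {1..n}" by blast
  show ?thesis unfolding eq PIP_def using partition_on_pairs by (auto simp: is_line_def)
qed

lemma line_pairs_one: "line_pairs X {{Inl t, Inr t} | t. t \<in> X} = {(A, B). A \<subseteq> X \<and> A = B}"
proof -
  have eq: "{{Inl t, Inr t} | t. t \<in> X} = (\<lambda>t. {Inl t, Inr t}) ` X" by blast
  have "(\<forall>K\<in>{{Inl t, Inr t} | t. t \<in> X}. fits K A B) \<longleftrightarrow> (\<forall>t\<in>X. t \<in> A \<longleftrightarrow> t \<in> B)" for A B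
    unfolding eq by (simp add: fits_simps)
  then show ?thesis unfolding line_pairs_def by (auto simp: subset_iff)
qed

lemma other_lines_fits: "(\<forall>K\<in>other_lines n i. fits K A B) \<longleftrightarrow>
    (\<forall>t\<in>{1..n}. t \<noteq> i \<longrightarrow> t \<noteq> i + 1 \<longrightarrow> (t \<in> A \<longleftrightarrow> t \<in> B))"
  unfolding other_lines_eq by (auto simp: fits_simps)

text \<open>The blocks of a generator produce conditions at \<open>i\<close>, at
  \<open>i + 1\<close> and at all other indices; together these amount to one equation between
  sets.\<close>

lemma set_eq_cases:
  fixes i n :: nat
  assumes "i \<in> {1..<n}" "C \<subseteq> {1..n}"
  shows "B \<subseteq> {1..n} \<and> (i \<in> B \<longleftrightarrow> i \<in> C) \<and> (i + 1 \<in> B \<longleftrightarrow> i + 1 \<in> C) \<and>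
      (\<forall>t\<in>{1..n}. t \<noteq> i \<longrightarrow> t \<noteq> i + 1 \<longrightarrow> (t \<in> C \<longleftrightarrow> t \<in> B)) \<longleftrightarrow> B = C"
proof
  assume *: "B \<subseteq> {1..n} \<and> (i \<in> B \<longleftrightarrow> i \<in> C) \<and> (i + 1 \<in> B \<longleftrightarrow> i + 1 \<in> C) \<and>
      (\<forall>t\<in>{1..n}. t \<noteq> i \<longrightarrow> t \<noteq> i + 1 \<longrightarrow> (t \<in> C \<longleftrightarrow> t \<in> B))"
  have "t \<in> B \<longleftrightarrow> t \<in> C" for t
  proof (cases "t \<in> {1..n}")
    case True
    consider "t = i" | "t = i + 1" | "t \<noteq> i" "t \<noteq> i + 1" by blast
    then show ?thesis using * True by cases blast+
  next
    case False
    then show ?thesis using * assms(2) by blast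
  qed
  then show "B = C" by blast
next
  assume "B = C"
  show "B \<subseteq> {1..n} \<and> (i \<in> B \<longleftrightarrow> i \<in> C) \<and> (i + 1 \<in> B \<longleftrightarrow> i + 1 \<in> C) \<and>
      (\<forall>t\<in>{1..n}. t \<noteq> i \<longrightarrow> t \<noteq> i + 1 \<longrightarrow> (t \<in> C \<longleftrightarrow> t \<in> B))"
    unfolding \<open>B = C\<close> using assms(2) by blast
qed

lemma line_pairs_eqI:
  assumes "\<And>A B. A \<subseteq> X \<Longrightarrow> (B \<subseteq> X \<and> (\<forall>K\<in>c. fits K A B)) = Q A B"
  shows "line_pairs X c = {(A, B). A \<subseteq> X \<and> Q A B}"
  unfolding line_pairs_def using assms by (intro Collect_cong) (simp add: case_prod_unfold, blast)

lemma line_pairs_s: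
  assumes i: "i \<in> {1..<n}"
  shows "line_pairs {1..n} (s_elt n i) = {(A, B). A \<subseteq> {1..n} \<and> act (Sig i) A = Some B}"
proof (rule line_pairs_eqI)
  fix A B assume A: "A \<subseteq> {1..n}"
  show "(B \<subseteq> {1..n} \<and> (\<forall>K\<in>s_elt n i. fits K A B)) = (act (Sig i) A = Some B)"
  proof -
    let ?C = "{x. transpose i (Suc i) x \<in> A}"
    have C: "?C \<subseteq> {1..n}"
    proof
      fix x assume "x \<in> ?C"
      then have x: "transpose i (Suc i) x \<in> {1..n}" using A by blast
      consider "x = i" | "x = Suc i" | "x \<noteq> i" "x \<noteq> Suc i" by blast
      then show "x \<in> {1..n}"
      proof cases
        case 3 then show ?thesis using x by (simp add: transpose_apply_other)
      qed (use i in simp_all)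
    qed
    have "(\<forall>K\<in>s_elt n i. fits K A B) \<longleftrightarrow> (i \<in> B \<longleftrightarrow> i + 1 \<in> A) \<and> (i + 1 \<in> B \<longleftrightarrow> i \<in> A) \<and>
      (\<forall>t\<in>{1..n}. t \<noteq> i \<longrightarrow> t \<noteq> i + 1 \<longrightarrow> (t \<in> A \<longleftrightarrow> t \<in> B))"
      unfolding s_elt_def ball_Un other_lines_fits by (simp only: ball_simps fits_simps) blast
    also have "i + 1 \<in> A \<longleftrightarrow> i \<in> ?C" by simp
    also have "i \<in> A \<longleftrightarrow> i + 1 \<in> ?C" by simp
    also have "(\<forall>t\<in>{1..n}. t \<noteq> i \<longrightarrow> t \<noteq> i + 1 \<longrightarrow> (t \<in> A \<longleftrightarrow> t \<in> B)) \<longleftrightarrow>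
      (\<forall>t\<in>{1..n}. t \<noteq> i \<longrightarrow> t \<noteq> i + 1 \<longrightarrow> (t \<in> ?C \<longleftrightarrow> t \<in> B))"
      by (rule ball_cong [OF HOL.refl]) (auto simp: transpose_apply_other)
    finally show ?thesis
      unfolding act.simps option.inject by (simp only: set_eq_cases [OF i C] eq_commute [of B])
  qed
qed

lemma line_pairs_r:
  assumes i: "i \<in> {1..<n}"
  shows "line_pairs {1..n} (r_elt n i) = {(A, B). A \<subseteq> {1..n} \<and> act (Rho i) A = Some B}"
proof (rule line_pairs_eqI)
  fix A B assume A: "A \<subseteq> {1..n}"
  show "(B \<subseteq> {1..n} \<and> (\<forall>K\<in>r_elt n i. fits K A B)) = (act (Rho i) A = Some B)"
  proof -
    let ?C = "A - {i + 1}"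
    have C: "?C \<subseteq> {1..n}" using A by blast
    have "(\<forall>K\<in>r_elt n i. fits K A B) \<longleftrightarrow> (i \<in> A \<longleftrightarrow> i + 1 \<in> A) \<and> (i \<in> B \<longleftrightarrow> i \<in> A) \<and> i + 1 \<notin> B \<and>
      (\<forall>t\<in>{1..n}. t \<noteq> i \<longrightarrow> t \<noteq> i + 1 \<longrightarrow> (t \<in> A \<longleftrightarrow> t \<in> B))"
      unfolding r_elt_def ball_Un other_lines_fits by (simp only: ball_simps fits_simps) blast
    also have "\<dots> \<longleftrightarrow> (i \<in> A \<longleftrightarrow> i + 1 \<in> A) \<and> (i \<in> B \<longleftrightarrow> i \<in> ?C) \<and> (i + 1 \<in> B \<longleftrightarrow> i + 1 \<in> ?C) \<and>
      (\<forall>t\<in>{1..n}. t \<noteq> i \<longrightarrow> t \<noteq> i + 1 \<longrightarrow> (t \<in> ?C \<longleftrightarrow> t \<in> B))" by auto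
    finally have "B \<subseteq> {1..n} \<and> (\<forall>K\<in>r_elt n i. fits K A B) \<longleftrightarrow> (i \<in> A \<longleftrightarrow> i + 1 \<in> A) \<and> B = ?C"
      by (simp only: conj_left_commute [of "B \<subseteq> {1..n}"] set_eq_cases [OF i C])
    then show ?thesis by auto
  qed
qed

lemma line_pairs_l:
  assumes i: "i \<in> {1..<n}"
  shows "line_pairs {1..n} (l_elt n i) = {(A, B). A \<subseteq> {1..n} \<and> act (Lam i) A = Some B}"
proof (rule line_pairs_eqI)
  fix A B assume A: "A \<subseteq> {1..n}"
  show "(B \<subseteq> {1..n} \<and> (\<forall>K\<in>l_elt n i. fits K A B)) = (act (Lam i) A = Some B)"
  proof -
    let ?C = "if i \<in> A then insert (i + 1) A else A"
    have C: "?C \<subseteq> {1..n}" using A i by simp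
    have "(\<forall>K\<in>l_elt n i. fits K A B) \<longleftrightarrow> i + 1 \<notin> A \<and> (i \<in> B \<longleftrightarrow> i \<in> A) \<and> (i + 1 \<in> B \<longleftrightarrow> i \<in> A) \<and>
      (\<forall>t\<in>{1..n}. t \<noteq> i \<longrightarrow> t \<noteq> i + 1 \<longrightarrow> (t \<in> A \<longleftrightarrow> t \<in> B))"
      unfolding l_elt_def ball_Un other_lines_fits by (simp only: ball_simps fits_simps) blast
    also have "\<dots> \<longleftrightarrow> i + 1 \<notin> A \<and> (i \<in> B \<longleftrightarrow> i \<in> ?C) \<and> (i + 1 \<in> B \<longleftrightarrow> i + 1 \<in> ?C) \<and>
      (\<forall>t\<in>{1..n}. t \<noteq> i \<longrightarrow> t \<noteq> i + 1 \<longrightarrow> (t \<in> ?C \<longleftrightarrow> t \<in> B))" by auto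
    finally have "B \<subseteq> {1..n} \<and> (\<forall>K\<in>l_elt n i. fits K A B) \<longleftrightarrow> i + 1 \<notin> A \<and> B = ?C"
      by (simp only: conj_left_commute [of "B \<subseteq> {1..n}"] set_eq_cases [OF i C])
    then show ?thesis by auto
  qed
qed

section \<open>The isomorphism\<close>

definition graph :: "nat \<Rightarrow> gen list \<Rightarrow> (nat set \<times> nat set) set" where
  "graph n w = {(A, B). A \<subseteq> {1..n} \<and> run w A = Some B}"

text \<open>The hypothesis keeps the intermediate set within \<open>{1..n}\<close>, whereas
  \<open>run\<close> accepts arbitrary sets.\<close>

lemma graph_append:
  assumes "graph n u \<subseteq> UNIV \<times> Pow {1..n}"
  shows "graph n (u @ v) = graph n u O graph n v"
proof (intro equalityI subrelI)
  fix A C assume "(A, C) \<in> graph n (u @ v)"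
  then have A: "A \<subseteq> {1..n}" and "run (u @ v) A = Some C" by (simp_all add: graph_def)
  then obtain B where B: "run u A = Some B" "run v B = Some C"
    unfolding run_append bind_eq_Some_conv by blast
  have "(A, B) \<in> graph n u" using A B(1) by (simp add: graph_def)
  moreover from this have "B \<subseteq> {1..n}" using assms by blast
  then have "(B, C) \<in> graph n v" using B(2) by (simp add: graph_def)
  ultimately show "(A, C) \<in> graph n u O graph n v" by (rule relcompI)
next
  fix A C assume "(A, C) \<in> graph n u O graph n v"
  then obtain B where "(A, B) \<in> graph n u" "(B, C) \<in> graph n v" by (elim relcompEpair)
  then show "(A, C) \<in> graph n (u @ v)" by (simp add: graph_def run_append)
qed

lemma run_single: "run [x] A = act x A"
  by (cases "act x A") simp_all

lemma graph_single: "graph n [x] = {(A, B). A \<subseteq> {1..n} \<and> act x A = Some B}"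
  unfolding graph_def run_single ..

lemma line_pairs_range: "line_pairs X c \<subseteq> UNIV \<times> Pow X"
  unfolding line_pairs_def by blast

text \<open>The assignment prescribes values for \<sigma>, \<lambda> and \<rho> only; the value for
  \<open>Idp i\<close> is read off from the relation that expresses it through the others.\<close>

fun pip_gen :: "nat \<Rightarrow> gen \<Rightarrow> (nat + nat) set set" where
  "pip_gen n (Sig i) = s_elt n i"
| "pip_gen n (Lam i) = l_elt n i"
| "pip_gen n (Rho i) = r_elt n i"
| "pip_gen n (Idp i) = (if i = 1
     then pip_mult {1..n} (s_elt n 1)
       (pip_mult {1..n} (pip_mult {1..n} (l_elt n 1) (r_elt n 1)) (s_elt n 1))
     else pip_mult {1..n} (l_elt n (i - 1)) (r_elt n (i - 1)))"

primrec pip_word :: "nat \<Rightarrow> gen list \<Rightarrow> (nat + nat) set set" where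
  "pip_word n [] = {{Inl t, Inr t} | t. t \<in> {1..n}}"
| "pip_word n (x # w) = pip_mult {1..n} (pip_gen n x) (pip_word n w)"

lemma S_gens_iff:
  assumes "n \<ge> 3"
  shows "Sig i \<in> S_gens n \<longleftrightarrow> i \<in> {1..<n}" "Lam i \<in> S_gens n \<longleftrightarrow> i \<in> {1..<n}"
    "Rho i \<in> S_gens n \<longleftrightarrow> i \<in> {1..<n}" "Idp i \<in> S_gens n \<longleftrightarrow> i \<in> {1..n}"
  using assms by (auto simp: S_gens_def)

lemma Idp_eq_Lam_Rho: "i \<ge> 1 \<Longrightarrow> run [Idp (Suc i)] A = run [Lam i, Rho i] A"
  using run_sound [OF S_rel.intros(29) [of "Suc i"]] by simp

lemma pip_gen_props:
  assumes "n \<ge> 3" "x \<in> S_gens n"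
  shows "pip_gen n x \<in> PIP {1..n} \<and> line_pairs {1..n} (pip_gen n x) = graph n [x]"
proof -
  have z: "0 \<notin> {1..n}" by simp
  have LR: "pip_mult {1..n} (l_elt n i) (r_elt n i) \<in> PIP {1..n} \<and>
      line_pairs {1..n} (pip_mult {1..n} (l_elt n i) (r_elt n i)) = graph n [Idp (Suc i)]" if i: "i \<in> {1..<n}" for i
  proof -
    note m = pip_mult_props [OF l_elt_PIP [OF i] r_elt_PIP [OF i] z]
    have g: "graph n [Lam i] = line_pairs {1..n} (l_elt n i)" "graph n [Rho i] = line_pairs {1..n} (r_elt n i)"
      unfolding graph_single line_pairs_l [OF i] line_pairs_r [OF i] by (rule HOL.refl)+
    have "graph n [Idp (Suc i)] = graph n ([Lam i] @ [Rho i])"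
      unfolding graph_def append.simps using Idp_eq_Lam_Rho i by simp
    also have "\<dots> = graph n [Lam i] O graph n [Rho i]"
      by (rule graph_append) (simp only: g line_pairs_range)
    finally show ?thesis using m by (simp add: g)
  qed
  show ?thesis
  proof (cases x)
    case (Sig i)
    then have i: "i \<in> {1..<n}" using assms by (simp add: S_gens_iff)
    show ?thesis unfolding Sig pip_gen.simps graph_single using s_elt_PIP [OF i] line_pairs_s [OF i] by blast
  next
    case (Lam i)
    then have i: "i \<in> {1..<n}" using assms by (simp add: S_gens_iff)
    show ?thesis unfolding Lam pip_gen.simps graph_single using l_elt_PIP [OF i] line_pairs_l [OF i] by blast
  next
    case (Rho i)
    then have i: "i \<in> {1..<n}" using assms by (simp add: S_gens_iff)
    show ?thesis unfolding Rho pip_gen.simps graph_single using r_elt_PIP [OF i] line_pairs_r [OF i] by blast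
  next
    case (Idp i)
    then have i: "i \<in> {1..n}" using assms by (simp add: S_gens_iff)
    show ?thesis
    proof (cases "i = 1")
      case False
      then obtain j where j: "i = Suc j" "j \<in> {1..<n}" using i by (cases i) auto
      have "pip_gen n x = pip_mult {1..n} (l_elt n j) (r_elt n j)" using Idp False j by simp
      then show ?thesis using LR [OF j(2)] unfolding Idp j(1) by simp
    next
      case True
      have 1: "1 \<in> {1..<n}" using assms(1) by simp
      let ?s = "s_elt n 1" and ?e = "pip_mult {1..n} (l_elt n 1) (r_elt n 1)"
      note e = LR [OF 1]
      note m1 = pip_mult_props [OF conjunct1 [OF e] s_elt_PIP [OF 1] z]
      note m2 = pip_mult_props [OF s_elt_PIP [OF 1] m1(1) z]
      have gs: "graph n [Sig 1] = line_pairs {1..n} ?s"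
        unfolding graph_single line_pairs_s [OF 1] by (rule HOL.refl)
      have ge: "graph n [Idp 2] = line_pairs {1..n} ?e" using e by (simp add: numeral_2_eq_2)
      have "graph n [Idp 1] = graph n ([Sig 1] @ ([Idp 2] @ [Sig 1]))"
        unfolding graph_def append.simps run_sound [OF S_rel.intros(30)] ..
      also have "\<dots> = graph n [Sig 1] O graph n ([Idp 2] @ [Sig 1])"
        by (rule graph_append) (simp only: gs line_pairs_range)
      also have "graph n ([Idp 2] @ [Sig 1]) = graph n [Idp 2] O graph n [Sig 1]"
        by (rule graph_append) (simp only: ge line_pairs_range)
      finally have "graph n [Idp 1] = line_pairs {1..n} (pip_gen n (Idp 1))"
        by (simp only: pip_gen.simps simp_thms if_True gs ge m1(2) m2(2))
      moreover have "pip_gen n (Idp 1) \<in> PIP {1..n}" using m2 by simp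
      ultimately show ?thesis unfolding Idp True by simp
    qed
  qed
qed

text \<open>Product of partitions and composition of partial maps agree letter by letter, so the
  faithful action turns equality of partitions into equality of graphs.\<close>

lemma pip_word_props:
  assumes "n \<ge> 3" "w \<in> lists (S_gens n)"
  shows "pip_word n w \<in> PIP {1..n} \<and> line_pairs {1..n} (pip_word n w) = graph n w"
  using assms(2)
proof (induction w)
  case Nil
  have "line_pairs {1..n} (pip_word n []) = graph n []"
    unfolding pip_word.simps line_pairs_one graph_def by simp
  moreover have "pip_word n [] \<in> PIP {1..n}" unfolding pip_word.simps by (rule one_PIP)
  ultimately show ?case by blast
next
  case (Cons x w)
  have z: "0 \<notin> {1..n}" by simp
  note x = pip_gen_props [OF assms(1) Cons.hyps(1)]
  note m = pip_mult_props [OF conjunct1 [OF x] conjunct1 [OF Cons.IH] z]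
  have "graph n ([x] @ w) = graph n [x] O graph n w"
    by (rule graph_append) (simp only: conjunct2 [OF x, symmetric] line_pairs_range)
  then show ?case using m x Cons.IH by simp
qed

lemma graph_range: "n \<ge> 3 \<Longrightarrow> w \<in> lists (S_gens n) \<Longrightarrow> graph n w \<subseteq> UNIV \<times> Pow {1..n}"
  using pip_word_props line_pairs_range by metis

lemma pip_word_eqI:
  assumes "n \<ge> 3" "w \<in> lists (S_gens n)" "c \<in> PIP {1..n}" "line_pairs {1..n} c = graph n w"
  shows "pip_word n w = c"
  by (rule line_pairs_inj [OF _ assms(3)]) (use pip_word_props [OF assms(1,2)] assms(4) in simp_all)

lemma pip_word_append:
  assumes "n \<ge> 3" "u \<in> lists (S_gens n)" "v \<in> lists (S_gens n)"
  shows "pip_word n (u @ v) = pip_mult {1..n} (pip_word n u) (pip_word n v)"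
proof -
  have z: "0 \<notin> {1..n}" by simp
  note u = pip_word_props [OF assms(1,2)] and v = pip_word_props [OF assms(1,3)]
  note m = pip_mult_props [OF conjunct1 [OF u] conjunct1 [OF v] z]
  show ?thesis
    by (rule pip_word_eqI [OF assms(1) _ m(1)])
      (use assms m(2) u v graph_append [OF graph_range [OF assms(1,2)]] in simp_all)
qed

lemma pip_word_single: "n \<ge> 3 \<Longrightarrow> x \<in> S_gens n \<Longrightarrow> pip_word n [x] = pip_gen n x"
  using pip_gen_props [of n x] by (intro pip_word_eqI) simp_all

section \<open>The presented monoid and its right regular representation\<close>

definition cls :: "nat \<Rightarrow> gen list \<Rightarrow> gen list set" where
  "cls n w = pres_class (S_gens n) S_rel w"

lemma cong_lists: "pres_cong A R u v \<Longrightarrow> u \<in> lists A \<and> v \<in> lists A"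
  by (induction rule: pres_cong.induct) auto

lemma cong_run: "pres_cong A S_rel u v \<Longrightarrow> run u = run v"
proof (induction rule: pres_cong.induct)
  case (base u v)
  then show ?case by (intro ext run_sound)
next
  case (append u v u' v')
  then show ?case by (intro ext) (simp add: run_append)
qed simp_all

lemma cls_eq_iff:
  assumes "u \<in> lists (S_gens n)" "v \<in> lists (S_gens n)"
  shows "cls n u = cls n v \<longleftrightarrow> pres_cong (S_gens n) S_rel u v"
proof
  assume "cls n u = cls n v"
  moreover have "v \<in> cls n v" using pres_cong.refl [OF assms(2)] by (simp add: cls_def pres_class_def)
  ultimately have "v \<in> cls n u" by simp
  then show "pres_cong (S_gens n) S_rel u v" by (simp add: cls_def pres_class_def)
next
  assume "pres_cong (S_gens n) S_rel u v"
  then show "cls n u = cls n v"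
    unfolding cls_def pres_class_def using pres_cong.sym pres_cong.trans by (intro Collect_cong) blast
qed

lemma carrier_S: "carrier (S_monoid n) = cls n ` lists (S_gens n)"
  unfolding S_monoid_def presented_monoid_def cls_def pres_class_def quotient_def by auto

lemma one_S: "\<one>\<^bsub>S_monoid n\<^esub> = cls n []"
  by (simp add: S_monoid_def presented_monoid_def cls_def)

text \<open>All products of members of the two classes are congruent, so the union in the definition
  of the product runs over equal sets.\<close>

lemma mult_S:
  assumes "u \<in> lists (S_gens n)" "v \<in> lists (S_gens n)"
  shows "cls n u \<otimes>\<^bsub>S_monoid n\<^esub> cls n v = cls n (u @ v)"
proof -
  have eq: "cls n (u' @ v') = cls n (u @ v)" if "u' \<in> cls n u" "v' \<in> cls n v" for u' v'
  proof -
    have c: "pres_cong (S_gens n) S_rel u u'" "pres_cong (S_gens n) S_rel v v'"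
      using that by (simp_all add: cls_def pres_class_def)
    have "u' @ v' \<in> lists (S_gens n)" "u @ v \<in> lists (S_gens n)"
      using cong_lists [OF c(1)] cong_lists [OF c(2)] by simp_all
    then show ?thesis using pres_cong.append [OF c] by (metis cls_eq_iff)
  qed
  have ne: "u \<in> cls n u" "v \<in> cls n v"
    using pres_cong.refl [OF assms(1)] pres_cong.refl [OF assms(2)] by (simp_all add: cls_def pres_class_def)
  have "cls n u \<otimes>\<^bsub>S_monoid n\<^esub> cls n v = (\<Union>u'\<in>cls n u. \<Union>v'\<in>cls n v. cls n (u' @ v'))"
    by (simp add: S_monoid_def presented_monoid_def cls_def)
  also have "\<dots> = (\<Union>u'\<in>cls n u. \<Union>v'\<in>cls n v. cls n (u @ v))"
    by (intro SUP_cong HOL.refl) (rule eq)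
  also have "\<dots> = cls n (u @ v)" using ne by blast
  finally show ?thesis .
qed

lemma cong_pip_word:
  assumes "n \<ge> 3" "pres_cong (S_gens n) S_rel u v"
  shows "pip_word n u = pip_word n v"
proof -
  note l = cong_lists [OF assms(2)]
  have "graph n u = graph n v" unfolding graph_def cong_run [OF assms(2)] ..
  then show ?thesis using l pip_word_props [OF assms(1)] by (intro pip_word_eqI [OF assms(1)]) simp_all
qed

text \<open>Right multiplication, extended by the identity outside the carrier so that the relations hold
  as equations between functions on the whole type.\<close>

definition gact :: "nat \<Rightarrow> gen \<Rightarrow> gen list set \<Rightarrow> gen list set" where
  "gact n x C = (if C \<in> carrier (S_monoid n) then C \<otimes>\<^bsub>S_monoid n\<^esub> cls n [x] else C)"

lemma gact_word:
  "u \<in> lists (S_gens n) \<Longrightarrow> w \<in> lists (S_gens n) \<Longrightarrow> word_val (\<lambda>f h. h \<circ> f) id (gact n) u (cls n w) = cls n (w @ u)"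
proof (induction u arbitrary: w)
  case (Cons x u)
  have x: "[x] \<in> lists (S_gens n)" using Cons.prems by simp
  have "cls n w \<in> carrier (S_monoid n)" unfolding carrier_S using Cons.prems(2) by (rule imageI)
  then have "gact n x (cls n w) = cls n (w @ [x])" using mult_S [OF Cons.prems(2) x] by (simp add: gact_def)
  moreover have "w @ [x] \<in> lists (S_gens n)" using x Cons.prems by simp
  ultimately show ?case using Cons.IH [of "w @ [x]"] Cons.prems by simp
qed simp

lemma gact_outside: "C \<notin> carrier (S_monoid n) \<Longrightarrow> word_val (\<lambda>f h. h \<circ> f) id (gact n) u C = C"
  by (induction u) (simp_all add: gact_def)

text \<open>Composition is taken in reverse order so that a word multiplies by its letters from left
  to right. A relation holds at every class because the congruence is closed under prefixing a
  word.\<close>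

lemma S_model_gact:
  assumes "n \<ge> 3"
  shows "S_model n (\<lambda>f h. h \<circ> f) id (gact n)"
proof
  fix u v assume uv: "S_rel u v" "u \<in> lists (S_gens n)" "v \<in> lists (S_gens n)"
  have c: "pres_cong (S_gens n) S_rel u v" using uv by (rule pres_cong.base)
  show "word_val (\<lambda>f h. h \<circ> f) id (gact n) u = word_val (\<lambda>f h. h \<circ> f) id (gact n) v"
  proof
    fix C
    show "word_val (\<lambda>f h. h \<circ> f) id (gact n) u C = word_val (\<lambda>f h. h \<circ> f) id (gact n) v C"
    proof (cases "C \<in> carrier (S_monoid n)")
      case True
      then obtain w where w: "C = cls n w" "w \<in> lists (S_gens n)" unfolding carrier_S by (elim imageE)
      have "pres_cong (S_gens n) S_rel (w @ u) (w @ v)" by (rule pres_cong.append [OF pres_cong.refl [OF w(2)] c])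
      moreover have "w @ u \<in> lists (S_gens n)" "w @ v \<in> lists (S_gens n)" using w uv by simp_all
      ultimately have "cls n (w @ u) = cls n (w @ v)" by (simp add: cls_eq_iff)
      then show ?thesis unfolding w(1) gact_word [OF uv(2) w(2)] gact_word [OF uv(3) w(2)] .
    next
      case False
      then show ?thesis by (simp only: gact_outside [OF False])
    qed
  qed
qed (use assms in \<open>simp_all add: comp_assoc\<close>)

text \<open>The right regular representation is faithful: evaluation at the class of the empty word
  recovers the class of the word.\<close>

lemma cls_eq_val:
  assumes "u \<in> lists (S_gens n)" "v \<in> lists (S_gens n)"
    "word_val (\<lambda>f h. h \<circ> f) id (gact n) u = word_val (\<lambda>f h. h \<circ> f) id (gact n) v"
  shows "cls n u = cls n v"
  using fun_cong [OF assms(3), of "cls n []"] gact_word [OF assms(1), of "[]"] gact_word [OF assms(2), of "[]"]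
  by simp

lemma map_Sig_lists: "n \<ge> 3 \<Longrightarrow> u \<in> lists {1..<n} \<Longrightarrow> map Sig u \<in> lists (S_gens n)"
  by (induction u) (simp_all add: S_gens_iff)

lemma pairw_lists:
  assumes "n \<ge> 3" "w \<in> S_gens n" "i \<noteq> j" "i \<in> {1..n}" "j \<in> {1..n}"
  shows "pairw n w i j \<in> lists (S_gens n)"
proof -
  obtain q where q: "q permutes {1..n}" "q 1 = i" "q 2 = j"
    "pairw n w i j = map Sig (permword n (pinv q)) @ [w] @ map Sig (permword n q)"
    by (rule pairw_perm [OF assms(3-5)])
  show ?thesis unfolding q(4)
    using map_Sig_lists [OF assms(1) permword(1) [OF q(1)]]
      map_Sig_lists [OF assms(1) permword(1) [OF permutes_inv [OF q(1)]]] assms(2) by simp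
qed

lemma repw_lists:
  assumes "n \<ge> 3" "w \<in> S_gens n" "idem_map n r" "x \<in> {1..n}"
  shows "repw n w r x \<in> lists (S_gens n)"
proof -
  consider "r x = x" | "r x = 0" "r x \<noteq> x" | "r x \<noteq> 0" "r x \<noteq> x" by argo
  then show ?thesis
  proof cases
    case 1 then show ?thesis by (simp add: repw_def)
  next
    case 2
    then show ?thesis using assms by (simp add: repw_def S_gens_iff [OF assms(1)])
  next
    case 3
    have "r x \<in> {1..n}" using idem_mapD [OF assms(3,4) 3(1)] by blast
    then show ?thesis using pairw_lists [OF assms(1,2) 3(2) _ assms(4)] 3 by (simp only: repw_def if_False)
  qed
qed

lemma concat_map_lists: "(\<And>x. x \<in> set xs \<Longrightarrow> f x \<in> lists A) \<Longrightarrow> concat (map f xs) \<in> lists A"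
  by (induction xs) simp_all

lemma nfw_lists:
  assumes "n \<ge> 3" "idem_map n r" "idem_map n s" "p permutes {1..n}"
  shows "nfw n r p s \<in> lists (S_gens n)"
proof -
  have g: "Rho 1 \<in> S_gens n" "Lam 1 \<in> S_gens n" using assms(1) by (simp_all add: S_gens_iff)
  have x: "x \<in> {1..n}" if "x \<in> set [1..<Suc n]" for x using that by (simp add: atLeastLessThanSuc_atLeastAtMost del: upt_Suc)
  have "concat (map (repw n (Rho 1) r) [1..<Suc n]) \<in> lists (S_gens n)"
    by (rule concat_map_lists, rule repw_lists [OF assms(1) g(1) assms(2)], rule x)
  moreover have "concat (map (repw n (Lam 1) s) [1..<Suc n]) \<in> lists (S_gens n)"
    by (rule concat_map_lists, rule repw_lists [OF assms(1) g(2) assms(3)], rule x)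
  ultimately show ?thesis unfolding nfw_def
    using map_Sig_lists [OF assms(1) permword(1) [OF assms(4)]] by (simp del: upt_Suc)
qed

section \<open>Completeness of the relations\<close>

definition saturated :: "nat \<Rightarrow> (nat \<Rightarrow> nat) \<Rightarrow> nat set \<Rightarrow> bool" where
  "saturated n r A \<longleftrightarrow> (\<forall>x\<in>{1..n}. sat r A x)"

lemma run_nfw_iff:
  assumes "good n r p s" "A \<subseteq> {1..n}" "B \<subseteq> {1..n}"
  shows "run (nfw n r p s) A = Some B \<longleftrightarrow>
    saturated n r A \<and> saturated n s B \<and> p ` (A \<inter> reps n r) = B \<inter> reps n s"
  unfolding saturated_def by (rule run_nfw) (use assms in \<open>simp_all add: good_def\<close>)

lemma reps_iff: "x \<in> reps n r \<longleftrightarrow> x \<in> {1..n} \<and> r x = x"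
  by (simp only: reps_def mem_Collect_eq)

text \<open>The witness consists of all elements whose lower representative is the image under
  \<open>p\<close> of an upper representative in \<open>A\<close>. With \<open>run_nfw_onto\<close>
  it identifies domain and range of the partial map as the saturated sets.\<close>

lemma run_nfw_total:
  assumes "good n r p s" "A \<subseteq> {1..n}" "saturated n r A"
  shows "\<exists>B\<subseteq>{1..n}. run (nfw n r p s) A = Some B"
proof -
  have s: "idem_map n s" "p ` reps n r = reps n s" using assms(1) unfolding good_def by blast+
  define C where "C = p ` (A \<inter> reps n r)"
  define B where "B = {y \<in> {1..n}. s y \<noteq> 0 \<and> s y \<in> C}"
  have C: "C \<subseteq> reps n s" using s(2) unfolding C_def by blast
  have "sat s B y" if y: "y \<in> {1..n}" for y
  proof (cases "s y = 0")
    case True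
    then have "y \<notin> B" unfolding B_def by simp
    then show ?thesis using True by (simp add: sat_def)
  next
    case False
    have "s y \<in> {1..n}" "s (s y) = s y" using idem_mapD [OF s(1) y False] by blast+
    then have "s y \<in> B \<longleftrightarrow> s y \<in> C" unfolding B_def using False by simp
    moreover have "y \<in> B \<longleftrightarrow> s y \<in> C" unfolding B_def using False y by simp
    ultimately show ?thesis using False by (simp add: sat_def)
  qed
  then have "saturated n s B" by (simp add: saturated_def)
  moreover have "y \<in> B \<inter> reps n s \<longleftrightarrow> y \<in> C" for y
  proof
    assume y: "y \<in> C"
    then have "y \<in> {1..n}" "s y = y" using C reps_iff by blast+
    then have "y \<in> B" unfolding B_def using y by simp
    then show "y \<in> B \<inter> reps n s" using y C by blast
  next
    assume "y \<in> B \<inter> reps n s"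
    then have "s y \<in> C" "s y = y" unfolding B_def reps_def by blast+
    then show "y \<in> C" by (simp only:)
  qed
  then have "p ` (A \<inter> reps n r) = B \<inter> reps n s" unfolding C_def by blast
  moreover have "B \<subseteq> {1..n}" unfolding B_def by blast
  ultimately show ?thesis using run_nfw_iff [OF assms(1,2)] assms(3) by blast
qed

lemma run_nfw_onto:
  assumes "good n r p s" "B \<subseteq> {1..n}" "saturated n s B"
  shows "\<exists>A\<subseteq>{1..n}. run (nfw n r p s) A = Some B"
proof -
  have r: "idem_map n r" "p ` reps n r = reps n s" using assms(1) unfolding good_def by blast+
  define A where "A = {x \<in> {1..n}. r x \<noteq> 0 \<and> p (r x) \<in> B}"
  have "sat r A y" if y: "y \<in> {1..n}" for y
  proof (cases "r y = 0")
    case True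
    then have "y \<notin> A" unfolding A_def by simp
    then show ?thesis using True by (simp add: sat_def)
  next
    case False
    have "r y \<in> {1..n}" "r (r y) = r y" using idem_mapD [OF r(1) y False] by blast+
    then have "r y \<in> A \<longleftrightarrow> p (r y) \<in> B" unfolding A_def using False by simp
    moreover have "y \<in> A \<longleftrightarrow> p (r y) \<in> B" unfolding A_def using False y by simp
    ultimately show ?thesis using False by (simp add: sat_def)
  qed
  then have "saturated n r A" by (simp add: saturated_def)
  moreover have A: "x \<in> A \<longleftrightarrow> p x \<in> B" if "x \<in> reps n r" for x
    using that unfolding A_def reps_def by simp
  have "p ` (A \<inter> reps n r) = B \<inter> reps n s"
  proof (intro equalityI subsetI)
    fix y assume "y \<in> p ` (A \<inter> reps n r)"
    then obtain x where x: "x \<in> A" "x \<in> reps n r" "y = p x" by (elim imageE IntE) simp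
    then have "y \<in> B" using A by simp
    moreover have "y \<in> reps n s" unfolding r(2) [symmetric] x(3) using x(2) by (rule imageI)
    ultimately show "y \<in> B \<inter> reps n s" by simp
  next
    fix y assume y: "y \<in> B \<inter> reps n s"
    then have "y \<in> p ` reps n r" using r(2) by simp
    then obtain x where x: "x \<in> reps n r" "y = p x" by (elim imageE) simp
    then have "x \<in> A \<inter> reps n r" using A y by simp
    then show "y \<in> p ` (A \<inter> reps n r)" unfolding x(2) by (rule imageI)
  qed
  moreover have "A \<subseteq> {1..n}" unfolding A_def by blast
  ultimately show ?thesis using run_nfw_iff [OF assms(1) _ assms(2)] assms(3) by blast
qed

lemma saturated_fibre:
  assumes "idem_map n r" "z \<noteq> 0"
  shows "saturated n r {t \<in> {1..n}. r t = z}"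
proof -
  have "sat r {t \<in> {1..n}. r t = z} y" if y: "y \<in> {1..n}" for y
  proof (cases "r y = 0")
    case True then show ?thesis using assms(2) by (simp add: sat_def)
  next
    case False
    have "r y \<in> {1..n}" "r (r y) = r y" using idem_mapD [OF assms(1) y False] by blast+
    then show ?thesis using y False by (simp add: sat_def)
  qed
  then show ?thesis by (simp add: saturated_def)
qed

text \<open>The fibre of \<open>x\<close> under \<open>r\<close> is saturated for \<open>r\<close>,
  hence for \<open>r'\<close>. So it contains no point of \<open>r'\<close>, and with each element
  it contains the whole fibre under \<open>r'\<close>.\<close>

lemma fibres_le:
  assumes "idem_map n r" "\<And>A. A \<subseteq> {1..n} \<Longrightarrow> saturated n r A \<Longrightarrow> saturated n r' A"
    and x: "x \<in> {1..n}" "r x \<noteq> 0"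
  shows "r' x \<noteq> 0" "\<And>y. y \<in> {1..n} \<Longrightarrow> r' x = r' y \<Longrightarrow> r x = r y"
proof -
  define A where "A = {t \<in> {1..n}. r t = r x}"
  have "A \<subseteq> {1..n}" "saturated n r A" unfolding A_def using saturated_fibre [OF assms(1) x(2)] by blast+
  then have "saturated n r' A" by (rule assms(2))
  then have s: "sat r' A y" if "y \<in> {1..n}" for y using that by (simp add: saturated_def)
  have xA: "x \<in> A" using x(1) by (simp add: A_def)
  show nz: "r' x \<noteq> 0"
  proof
    assume "r' x = 0"
    then show False using xA s [OF x(1)] by (simp add: sat_def)
  qed
  fix y assume y: "y \<in> {1..n}" "r' x = r' y"
  then have nzy: "r' y \<noteq> 0" using nz by simp
  have "x \<in> A \<longleftrightarrow> r' x \<in> A" using s [OF x(1)] unfolding sat_def if_not_P [OF nz] .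
  moreover have "y \<in> A \<longleftrightarrow> r' y \<in> A" using s [OF y(1)] unfolding sat_def if_not_P [OF nzy] .
  ultimately have "y \<in> A" using xA y(2) by simp
  then show "r x = r y" by (simp add: A_def)
qed

lemma same_fibresI:
  assumes "idem_map n r" "idem_map n r'" "\<And>A. A \<subseteq> {1..n} \<Longrightarrow> saturated n r A = saturated n r' A"
  shows "same_fibres n r r'"
proof -
  have le: "\<And>A. A \<subseteq> {1..n} \<Longrightarrow> saturated n r A \<Longrightarrow> saturated n r' A"
    and ge: "\<And>A. A \<subseteq> {1..n} \<Longrightarrow> saturated n r' A \<Longrightarrow> saturated n r A" using assms(3) by simp_all
  note 1 = fibres_le [OF assms(1) le] and 2 = fibres_le [OF assms(2) ge]
  have z: "r x = 0 \<longleftrightarrow> r' x = 0" if "x \<in> {1..n}" for x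
    using 1(1) [of x] 2(1) [of x] that by blast
  have "r x = r y \<longleftrightarrow> r' x = r' y" if "x \<in> {1..n}" "y \<in> {1..n}" for x y
  proof (cases "r x = 0")
    case True
    then show ?thesis using z [OF that(1)] z [OF that(2)] by metis
  next
    case False
    then have "r' x \<noteq> 0" using z [OF that(1)] by simp
    then show ?thesis using 1(2) [of x y] 2(2) [of x y] False that by blast
  qed
  then show ?thesis using z unfolding same_fibres_def by blast
qed

text \<open>The domain of the partial map determines the upper fibres, its range the lower
  ones.\<close>

lemma good_same_fibres:
  assumes "good n r p s" "good n r' p' s'"
    and run: "\<And>A. A \<subseteq> {1..n} \<Longrightarrow> run (nfw n r p s) A = run (nfw n r' p' s') A"
  shows "same_fibres n r r'" "same_fibres n s s'"
proof -
  have id: "idem_map n r" "idem_map n s" "idem_map n r'" "idem_map n s'"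
    using assms(1,2) by (simp_all add: good_def)
  have r: "saturated n r' A" if g: "good n r p s" "good n r' p' s'" "A \<subseteq> {1..n}" "saturated n r A"
    "run (nfw n r p s) A = run (nfw n r' p' s') A" for r p s r' p' s' A
  proof -
    obtain B where "B \<subseteq> {1..n}" "run (nfw n r p s) A = Some B" using run_nfw_total [OF g(1,3,4)] by blast
    then show ?thesis using run_nfw_iff [OF g(2,3)] g(5) by simp
  qed
  show "same_fibres n r r'"
    by (rule same_fibresI [OF id(1,3)]) (use r [OF assms(1,2)] r [OF assms(2,1)] run in metis)
  have s: "saturated n s' B" if g: "good n r p s" "good n r' p' s'" "B \<subseteq> {1..n}" "saturated n s B"
    "\<And>A. A \<subseteq> {1..n} \<Longrightarrow> run (nfw n r p s) A = run (nfw n r' p' s') A" for r p s r' p' s' B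
  proof -
    obtain A where A: "A \<subseteq> {1..n}" "run (nfw n r p s) A = Some B" using run_nfw_onto [OF g(1,3,4)] by blast
    then have "run (nfw n r' p' s') A = Some B" using g(5) by simp
    then show ?thesis using run_nfw_iff [OF g(2) A(1) g(3)] by simp
  qed
  show "same_fibres n s s'"
    by (rule same_fibresI [OF id(2,4)]) (use s [OF assms(1,2) _ _ run] s [OF assms(2,1) _ _ run [symmetric]] in blast)
qed

text \<open>The fibre of \<open>x\<close> contains \<open>x\<close> as its only representative, so
  its image reveals the value of the permutation at \<open>x\<close>.\<close>

lemma nfw_perm_unique:
  assumes "good n r p s" "good n r q s \<or> q permutes {1..n}" "x \<in> reps n r"
    and run: "\<And>A. A \<subseteq> {1..n} \<Longrightarrow> run (nfw n r p s) A = run (nfw n r q s) A"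
  shows "q x = p x"
proof -
  have id: "idem_map n r" "idem_map n s" using assms(1) by (simp_all add: good_def)
  have q: "q permutes {1..n}" using assms(2) good_def by blast
  let ?A = "{t \<in> {1..n}. r t = x}"
  have x: "x \<in> {1..n}" "r x = x" using assms(3) by (simp_all only: reps_iff)
  then have x0: "x \<noteq> 0" by auto
  have A: "?A \<subseteq> {1..n}" by blast
  obtain B where B: "B \<subseteq> {1..n}" "run (nfw n r p s) ?A = Some B"
    using run_nfw_total [OF assms(1) A saturated_fibre [OF id(1) x0]] by blast
  have "?A \<inter> reps n r = {x}" using x by (auto simp: reps_iff)
  moreover have "p ` (?A \<inter> reps n r) = B \<inter> reps n s"
    using run_nfw_iff [OF assms(1) A B(1)] B(2) by simp
  moreover have "q ` (?A \<inter> reps n r) = B \<inter> reps n s"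
    using run_nfw [OF id q A B(1)] B(2) run [OF A] by simp
  ultimately have "p ` {x} = q ` {x}" by simp
  then show ?thesis by simp
qed

text \<open>Both words are replaced by normal forms. Equal action gives equal fibres, so one normal
  form can be rewritten with the encodings of the other at the cost of a new permutation
  \<open>q\<close>; then \<open>q\<close> and \<open>p'\<close> agree on the representatives, which
  suffices by \<open>nfv_eq\<close>.\<close>

lemma completeness:
  assumes "n \<ge> 3" "u \<in> lists (S_gens n)" "v \<in> lists (S_gens n)"
    and run: "\<And>A. A \<subseteq> {1..n} \<Longrightarrow> run u A = run v A"
  shows "cls n u = cls n v"
proof -
  interpret M: S_model n "\<lambda>f h. h \<circ> f" id "gact n" by (rule S_model_gact [OF assms(1)])
  have run_eq: "run u' = run v'" if "cls n u' = cls n v'" "u' \<in> lists (S_gens n)" "v' \<in> lists (S_gens n)" for u' v'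
    using that cong_run cls_eq_iff by blast
  have nf: "\<exists>r p s. good n r p s \<and> cls n w = cls n (nfw n r p s) \<and> nfw n r p s \<in> lists (S_gens n)"
    if w: "w \<in> lists (S_gens n)" for w
  proof -
    obtain r p s where g: "good n r p s" "M.val w = M.nfv r p s"
      using M.nf_val [OF w] unfolding M.nf_def by blast
    have l: "nfw n r p s \<in> lists (S_gens n)" using g(1) by (intro nfw_lists [OF assms(1)]) (simp_all add: good_def)
    have "cls n w = cls n (nfw n r p s)" by (rule cls_eq_val [OF w l]) (simp only: g(2) M.val_nfw)
    then show ?thesis using g(1) l by blast
  qed
  obtain r p s where 1: "good n r p s" "cls n u = cls n (nfw n r p s)" "nfw n r p s \<in> lists (S_gens n)"
    using nf [OF assms(2)] by blast
  obtain r' p' s' where 2: "good n r' p' s'" "cls n v = cls n (nfw n r' p' s')" "nfw n r' p' s' \<in> lists (S_gens n)"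
    using nf [OF assms(3)] by blast
  have run12: "run (nfw n r p s) A = run (nfw n r' p' s') A" if "A \<subseteq> {1..n}" for A
    using run [OF that] run_eq [OF 1(2) assms(2) 1(3)] run_eq [OF 2(2) assms(3) 2(3)] by simp
  have id: "idem_map n r'" "idem_map n s'" "p' permutes {1..n}" using 2(1) by (simp_all add: good_def)
  obtain q where q: "q permutes {1..n}" "M.nfv r p s = M.nfv r' q s'"
    by (rule M.nfv_change [OF 1(1) id(1,2) good_same_fibres [OF 1(1) 2(1) run12]])
  have ql: "nfw n r' q s' \<in> lists (S_gens n)" by (rule nfw_lists [OF assms(1) id(1,2) q(1)])
  have c: "cls n (nfw n r p s) = cls n (nfw n r' q s')"
    by (rule cls_eq_val [OF 1(3) ql]) (simp only: M.val_nfw q(2))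
  have "run (nfw n r' p' s') A = run (nfw n r' q s') A" if "A \<subseteq> {1..n}" for A
    using run12 [OF that] run_eq [OF c 1(3) ql] by simp
  then have "q x = p' x" if "x \<in> reps n r'" for x
    using nfw_perm_unique [OF 2(1) _ that] q(1) by blast
  then have "M.nfv r' q s' = M.nfv r' p' s'" by (rule M.nfv_eq [OF id(1) q(1) id(3)])
  then have "cls n (nfw n r' q s') = cls n (nfw n r' p' s')"
    by (intro cls_eq_val [OF ql 2(3)]) (simp only: M.val_nfw)
  then show ?thesis using 1(2) 2(2) c by simp
qed

section \<open>Every partition into lines and points as the value of a normal form\<close>

context
  fixes n :: nat and c :: "(nat + nat) set set"
  assumes n: "n \<ge> 3" and c: "c \<in> PIP {1..n}"
begin

definition blk :: "nat + nat \<Rightarrow> (nat + nat) set" where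
  "blk u = (SOME K. K \<in> c \<and> u \<in> K)"

text \<open>The minimum serves as a definite choice of a representative for the upper half of a
  line.\<close>

definition top_rep :: "(nat + nat) set \<Rightarrow> nat" where
  "top_rep K = Min (Inl -` K)"

definition bot_rep :: "(nat + nat) set \<Rightarrow> nat" where
  "bot_rep K = Min (Inr -` K)"

definition top_map :: "nat \<Rightarrow> nat" where
  "top_map x = (if is_line (blk (Inl x)) then top_rep (blk (Inl x)) else 0)"

definition bot_map :: "nat \<Rightarrow> nat" where
  "bot_map y = (if is_line (blk (Inr y)) then bot_rep (blk (Inr y)) else 0)"

lemma c_part: "partition_on ({1..n} <+> {1..n}) c"
  using PIP_partition [OF c] .

lemma blk_eq: "K \<in> c \<Longrightarrow> u \<in> K \<Longrightarrow> blk u = K"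
  unfolding blk_def by (rule some_equality) (use partition_on_unique [OF c_part] in blast)+

lemma blk_in:
  assumes "u \<in> {1..n} <+> {1..n}"
  shows "blk u \<in> c" "u \<in> blk u"
proof -
  obtain K where K: "K \<in> c" "u \<in> K" by (rule partition_block [OF c_part assms])
  then show "blk u \<in> c" "u \<in> blk u" using blk_eq [OF K] by simp_all
qed

lemma block_sub: "K \<in> c \<Longrightarrow> Inl x \<in> K \<Longrightarrow> x \<in> {1..n}" "K \<in> c \<Longrightarrow> Inr x \<in> K \<Longrightarrow> x \<in> {1..n}"
  using partition_sub [OF c_part, of K] by blast+

lemma line_reps:
  assumes "K \<in> c" "is_line K"
  shows "Inl (top_rep K) \<in> K" "Inr (bot_rep K) \<in> K"
proof -
  have "Inl -` K \<subseteq> {1..n}" "Inr -` K \<subseteq> {1..n}" using block_sub [OF assms(1)] by (auto simp del: atLeastAtMost_iff)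
  then have fin: "finite (Inl -` K)" "finite (Inr -` K)" by (simp_all only: finite_subset finite_atLeastAtMost)
  have ne: "Inl -` K \<noteq> {}" "Inr -` K \<noteq> {}" using assms(2) unfolding is_line_def by blast+
  show "Inl (top_rep K) \<in> K" using Min_in [OF fin(1) ne(1)] unfolding top_rep_def by (rule vimageD)
  show "Inr (bot_rep K) \<in> K" using Min_in [OF fin(2) ne(2)] unfolding bot_rep_def by (rule vimageD)
qed

lemma top_map_line: "K \<in> c \<Longrightarrow> Inl x \<in> K \<Longrightarrow> is_line K \<Longrightarrow> top_map x = top_rep K"
  by (simp add: top_map_def blk_eq)

lemma bot_map_line: "K \<in> c \<Longrightarrow> Inr x \<in> K \<Longrightarrow> is_line K \<Longrightarrow> bot_map x = bot_rep K"
  by (simp add: bot_map_def blk_eq)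

lemma top_map_point: "K \<in> c \<Longrightarrow> Inl x \<in> K \<Longrightarrow> \<not> is_line K \<Longrightarrow> top_map x = 0"
  by (simp add: top_map_def blk_eq)

lemma bot_map_point: "K \<in> c \<Longrightarrow> Inr x \<in> K \<Longrightarrow> \<not> is_line K \<Longrightarrow> bot_map x = 0"
  by (simp add: bot_map_def blk_eq)

lemma rep_range:
  assumes "K \<in> c" "is_line K"
  shows "top_rep K \<in> {1..n}" "bot_rep K \<in> {1..n}"
  using block_sub [OF assms(1)] line_reps [OF assms] by blast+

lemma top_map_cases:
  assumes "x \<in> {1..n}"
  obtains K where "K \<in> c" "Inl x \<in> K" "is_line K" "top_map x = top_rep K"
  | K where "K \<in> c" "Inl x \<in> K" "\<not> is_line K" "top_map x = 0"
proof -
  have "Inl x \<in> {1..n} <+> {1..n}" using assms by (rule InlI)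
  note b = blk_in [OF this]
  show ?thesis
  proof (cases "is_line (blk (Inl x))")
    case True then show ?thesis using that(1) [OF b True top_map_line [OF b True]] by simp
  next
    case False then show ?thesis using that(2) [OF b False top_map_point [OF b False]] by simp
  qed
qed

lemma bot_map_cases:
  assumes "x \<in> {1..n}"
  obtains K where "K \<in> c" "Inr x \<in> K" "is_line K" "bot_map x = bot_rep K"
  | K where "K \<in> c" "Inr x \<in> K" "\<not> is_line K" "bot_map x = 0"
proof -
  have "Inr x \<in> {1..n} <+> {1..n}" using assms by (rule InrI)
  note b = blk_in [OF this]
  show ?thesis
  proof (cases "is_line (blk (Inr x))")
    case True then show ?thesis using that(1) [OF b True bot_map_line [OF b True]] by simp
  next
    case False then show ?thesis using that(2) [OF b False bot_map_point [OF b False]] by simp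
  qed
qed

lemma top_rep_fixed: "K \<in> c \<Longrightarrow> is_line K \<Longrightarrow> top_map (top_rep K) = top_rep K"
  by (rule top_map_line [OF _ line_reps(1)])

lemma bot_rep_fixed: "K \<in> c \<Longrightarrow> is_line K \<Longrightarrow> bot_map (bot_rep K) = bot_rep K"
  by (rule bot_map_line [OF _ line_reps(2)])

lemma idem_top_map: "idem_map n top_map"
  unfolding idem_map_def
proof
  fix x assume "x \<in> {1..n}"
  then show "top_map x \<le> n \<and> (top_map x \<noteq> 0 \<longrightarrow> top_map (top_map x) = top_map x)"
  proof (rule top_map_cases)
    fix K assume K: "K \<in> c" "is_line K" "top_map x = top_rep K"
    show ?thesis using rep_range(1) [OF K(1,2)] unfolding K(3) top_rep_fixed [OF K(1,2)] by simp
  qed simp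
qed

lemma idem_bot_map: "idem_map n bot_map"
  unfolding idem_map_def
proof
  fix x assume "x \<in> {1..n}"
  then show "bot_map x \<le> n \<and> (bot_map x \<noteq> 0 \<longrightarrow> bot_map (bot_map x) = bot_map x)"
  proof (rule bot_map_cases)
    fix K assume K: "K \<in> c" "is_line K" "bot_map x = bot_rep K"
    show ?thesis using rep_range(2) [OF K(1,2)] unfolding K(3) bot_rep_fixed [OF K(1,2)] by simp
  qed simp
qed

lemma reps_top: "reps n top_map = top_rep ` {K \<in> c. is_line K}"
proof (intro equalityI subsetI)
  fix x assume "x \<in> reps n top_map"
  then have x: "x \<in> {1..n}" "top_map x = x" unfolding reps_iff by blast+
  from x(1) show "x \<in> top_rep ` {K \<in> c. is_line K}"
  proof (rule top_map_cases)
    fix K assume "K \<in> c" "is_line K" "top_map x = top_rep K"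
    then show ?thesis using x(2) by (intro image_eqI [of _ _ K]) simp_all
  next
    assume "top_map x = 0"
    then show ?thesis using x by simp
  qed
next
  fix x assume "x \<in> top_rep ` {K \<in> c. is_line K}"
  then obtain K where K: "K \<in> c" "is_line K" "x = top_rep K" by blast
  show "x \<in> reps n top_map" unfolding reps_iff K(3) using rep_range(1) [OF K(1,2)] top_rep_fixed [OF K(1,2)] by (rule conjI)
qed

lemma reps_bot: "reps n bot_map = bot_rep ` {K \<in> c. is_line K}"
proof (intro equalityI subsetI)
  fix x assume "x \<in> reps n bot_map"
  then have x: "x \<in> {1..n}" "bot_map x = x" unfolding reps_iff by blast+
  from x(1) show "x \<in> bot_rep ` {K \<in> c. is_line K}"
  proof (rule bot_map_cases)
    fix K assume "K \<in> c" "is_line K" "bot_map x = bot_rep K"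
    then show ?thesis using x(2) by (intro image_eqI [of _ _ K]) simp_all
  next
    assume "bot_map x = 0"
    then show ?thesis using x by simp
  qed
next
  fix x assume "x \<in> bot_rep ` {K \<in> c. is_line K}"
  then obtain K where K: "K \<in> c" "is_line K" "x = bot_rep K" by blast
  show "x \<in> reps n bot_map" unfolding reps_iff K(3) using rep_range(2) [OF K(1,2)] bot_rep_fixed [OF K(1,2)] by (rule conjI)
qed

lemma rep_inj:
  assumes "K \<in> c" "is_line K" "K' \<in> c" "is_line K'"
  shows "bot_rep K = bot_rep K' \<Longrightarrow> K = K'" "top_rep K = top_rep K' \<Longrightarrow> K = K'"
  using line_reps [OF assms(1,2)] line_reps [OF assms(3,4)] partition_on_unique [OF c_part assms(1,3)] by simp_all

text \<open>Distinct lines have distinct lower representatives, so sending the upper representative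
  of each line to the lower one is injective, and a partial injection extends to a
  permutation.\<close>

lemma rep_perm_exists:
  "\<exists>p. p permutes {1..n} \<and> (\<forall>K\<in>c. is_line K \<longrightarrow> p (top_rep K) = bot_rep K)"
proof -
  let ?f = "\<lambda>x. bot_rep (blk (Inl x))"
  have f: "?f (top_rep K) = bot_rep K" if "K \<in> c" "is_line K" for K
    by (simp only: blk_eq [OF that(1) line_reps(1) [OF that]])
  have inj: "inj_on ?f (reps n top_map)"
  proof (rule inj_onI)
    fix x y assume "x \<in> reps n top_map" "y \<in> reps n top_map" and e: "?f x = ?f y"
    then obtain K K' where K: "K \<in> c" "is_line K" "x = top_rep K" "K' \<in> c" "is_line K'" "y = top_rep K'"
      unfolding reps_top by blast
    have "bot_rep K = bot_rep K'" using e unfolding K(3) K(6) f [OF K(1,2)] f [OF K(4,5)] .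
    then show "x = y" using rep_inj(1) [OF K(1,2,4,5)] K(3,6) by simp
  qed
  have sub: "reps n top_map \<subseteq> {1..n}" unfolding reps_def by blast
  have im: "?f ` reps n top_map \<subseteq> {1..n}"
  proof
    fix y assume "y \<in> ?f ` reps n top_map"
    then obtain K where K: "K \<in> c" "is_line K" "y = ?f (top_rep K)" unfolding reps_top by blast
    show "y \<in> {1..n}" unfolding K(3) f [OF K(1,2)] by (rule rep_range(2) [OF K(1,2)])
  qed
  have "\<exists>q. q permutes {1..n} \<and> (\<forall>x\<in>reps n top_map. q x = ?f x)"
    by (rule permutes_extend [OF inj sub im finite_atLeastAtMost]) blast
  then obtain q where q: "q permutes {1..n}" "\<forall>x\<in>reps n top_map. q x = ?f x" by (elim exE conjE)
  have "q (top_rep K) = bot_rep K" if K: "K \<in> c" "is_line K" for K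
  proof -
    have "top_rep K \<in> reps n top_map" unfolding reps_top by (rule imageI) (simp add: K)
    then show ?thesis using q(2) f [OF K] by simp
  qed
  then show ?thesis using q(1) by blast
qed

text \<open>The normal form is read off from the partition: its fibres are the halves of lines and
  its permutation matches their representatives. Its value is identified through the action: a pair
  of sets fits all blocks precisely when the three conditions of \<open>run_nfw_iff\<close>
  hold.\<close>

lemma pip_word_surj:
  "\<exists>w\<in>lists (S_gens n). pip_word n w = c"
proof -
  obtain p where p: "p permutes {1..n}" "\<forall>K\<in>c. is_line K \<longrightarrow> p (top_rep K) = bot_rep K"
    using rep_perm_exists by (elim exE conjE)
  have p: "p permutes {1..n}" "\<And>K. K \<in> c \<Longrightarrow> is_line K \<Longrightarrow> p (top_rep K) = bot_rep K"
    using p by blast+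
  let ?w = "nfw n top_map p bot_map"
  have "p ` reps n top_map = reps n bot_map"
    unfolding reps_top reps_bot image_image by (rule image_cong) (simp_all add: p(2))
  then have good: "good n top_map p bot_map" unfolding good_def using idem_top_map idem_bot_map p(1) by blast
  have l: "?w \<in> lists (S_gens n)" by (rule nfw_lists [OF n idem_top_map idem_bot_map p(1)])
  have iff: "(\<forall>K\<in>c. fits K A B) \<longleftrightarrow> run ?w A = Some B" if AB: "A \<subseteq> {1..n}" "B \<subseteq> {1..n}" for A B
  proof -
    define G where "G = A <+> B"
    have G: "Inl x \<in> G \<longleftrightarrow> x \<in> A" "Inr x \<in> G \<longleftrightarrow> x \<in> B" for x by (auto simp: G_def)
    have fits: "fits K A B \<longleftrightarrow> K \<inter> G = {} \<or> is_line K \<and> K \<subseteq> G" for K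
      unfolding fits_def G_def ..
    show ?thesis
      unfolding run_nfw_iff [OF good AB]
    proof
      assume *: "\<forall>K\<in>c. fits K A B"
      have all: "u \<in> G \<longleftrightarrow> v \<in> G" if "K \<in> c" "u \<in> K" "v \<in> K" for K u v
      proof -
        have "K \<inter> G = {} \<or> K \<subseteq> G" using * that(1) fits by blast
        then show ?thesis using that(2,3) by blast
      qed
      have none: "u \<notin> G" if "K \<in> c" "u \<in> K" "\<not> is_line K" for K u
      proof -
        have "K \<inter> G = {}" using * that(1,3) fits by blast
        then show ?thesis using that(2) by blast
      qed
      have "sat top_map A x" if "x \<in> {1..n}" for x
        using that
      proof (rule top_map_cases)
        fix K assume K: "K \<in> c" "Inl x \<in> K" "is_line K" "top_map x = top_rep K"
        have nz: "top_map x \<noteq> 0" using rep_range(1) [OF K(1,3)] K(4) by simp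
        have "x \<in> A \<longleftrightarrow> top_rep K \<in> A" using all [OF K(1,2) line_reps(1) [OF K(1,3)]] by (simp only: G)
        then show ?thesis unfolding sat_def if_not_P [OF nz] by (simp only: K(4))
      next
        fix K assume K: "K \<in> c" "Inl x \<in> K" "\<not> is_line K" "top_map x = 0"
        have "x \<notin> A" using none [OF K(1-3)] by (simp only: G not_False_eq_True)
        then show ?thesis unfolding sat_def K(4) by simp
      qed
      moreover have "sat bot_map B x" if "x \<in> {1..n}" for x
        using that
      proof (rule bot_map_cases)
        fix K assume K: "K \<in> c" "Inr x \<in> K" "is_line K" "bot_map x = bot_rep K"
        have nz: "bot_map x \<noteq> 0" using rep_range(2) [OF K(1,3)] K(4) by simp
        have "x \<in> B \<longleftrightarrow> bot_rep K \<in> B" using all [OF K(1,2) line_reps(2) [OF K(1,3)]] by (simp only: G)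
        then show ?thesis unfolding sat_def if_not_P [OF nz] by (simp only: K(4))
      next
        fix K assume K: "K \<in> c" "Inr x \<in> K" "\<not> is_line K" "bot_map x = 0"
        have "x \<notin> B" using none [OF K(1-3)] by (simp only: G not_False_eq_True)
        then show ?thesis unfolding sat_def K(4) by simp
      qed
      moreover have tb: "top_rep K \<in> A \<longleftrightarrow> bot_rep K \<in> B" if "K \<in> c" "is_line K" for K
        using all [OF that(1) line_reps [OF that]] by (simp only: G)
      have "p ` (A \<inter> reps n top_map) = B \<inter> reps n bot_map"
      proof (intro equalityI subsetI)
        fix y assume "y \<in> p ` (A \<inter> reps n top_map)"
        then obtain x where x: "y = p x" "x \<in> A" "x \<in> reps n top_map" by (elim imageE IntE) simp
        then obtain K where K: "K \<in> c" "is_line K" "x = top_rep K" unfolding reps_top by blast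
        have y: "y = bot_rep K" using x(1) K(3) p(2) [OF K(1,2)] by simp
        have "y \<in> B" using tb [OF K(1,2)] x(2) K(3) y by simp
        moreover have "y \<in> reps n bot_map" unfolding reps_bot y by (rule imageI) (simp add: K)
        ultimately show "y \<in> B \<inter> reps n bot_map" by simp
      next
        fix y assume "y \<in> B \<inter> reps n bot_map"
        then have y: "y \<in> B" "y \<in> reps n bot_map" by simp_all
        then obtain K where K: "K \<in> c" "is_line K" "y = bot_rep K" unfolding reps_bot by blast
        have "top_rep K \<in> A" using tb [OF K(1,2)] y(1) K(3) by simp
        moreover have "top_rep K \<in> reps n top_map" unfolding reps_top by (rule imageI) (simp add: K)
        ultimately have "p (top_rep K) \<in> p ` (A \<inter> reps n top_map)" by (intro imageI IntI)
        then show "y \<in> p ` (A \<inter> reps n top_map)" unfolding p(2) [OF K(1,2)] K(3) .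
      qed
      ultimately show "saturated n top_map A \<and> saturated n bot_map B \<and> p ` (A \<inter> reps n top_map) = B \<inter> reps n bot_map"
        unfolding saturated_def by blast
    next
      assume *: "saturated n top_map A \<and> saturated n bot_map B \<and> p ` (A \<inter> reps n top_map) = B \<inter> reps n bot_map"
      then have sA: "\<And>x. x \<in> {1..n} \<Longrightarrow> sat top_map A x" and sB: "\<And>x. x \<in> {1..n} \<Longrightarrow> sat bot_map B x"
        and im: "p ` (A \<inter> reps n top_map) = B \<inter> reps n bot_map"
        unfolding saturated_def by blast+
      show "\<forall>K\<in>c. fits K A B"
      proof
        fix K assume K: "K \<in> c"
        show "fits K A B"
        proof (cases "is_line K")
          case True
          have nz: "top_rep K \<noteq> 0" "bot_rep K \<noteq> 0" using rep_range [OF K True] by auto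
          have t: "x \<in> A \<longleftrightarrow> top_rep K \<in> A" if "Inl x \<in> K" for x
            using sA [OF block_sub(1) [OF K that]]
            unfolding sat_def top_map_line [OF K that True] if_not_P [OF nz(1)] .
          have b: "x \<in> B \<longleftrightarrow> bot_rep K \<in> B" if "Inr x \<in> K" for x
            using sB [OF block_sub(2) [OF K that]]
            unfolding sat_def bot_map_line [OF K that True] if_not_P [OF nz(2)] .
          have rt: "top_rep K \<in> reps n top_map" "bot_rep K \<in> reps n bot_map"
            unfolding reps_top reps_bot by (rule imageI, simp add: K True)+
          have tb: "top_rep K \<in> A \<longleftrightarrow> bot_rep K \<in> B"
          proof
            assume "top_rep K \<in> A"
            then have "p (top_rep K) \<in> p ` (A \<inter> reps n top_map)" using rt(1) by (intro imageI IntI)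
            then show "bot_rep K \<in> B" unfolding im p(2) [OF K True] by simp
          next
            assume "bot_rep K \<in> B"
            then have "p (top_rep K) \<in> p ` (A \<inter> reps n top_map)" unfolding im p(2) [OF K True] using rt(2) by (rule IntI)
            then obtain x where x: "p (top_rep K) = p x" "x \<in> A" by (elim imageE IntE) simp
            then show "top_rep K \<in> A" using permutes_inj [OF p(1)] by (simp add: inj_eq)
          qed
          have "u \<in> G \<longleftrightarrow> top_rep K \<in> A" if "u \<in> K" for u
          proof (cases u)
            case (Inl x)
            then show ?thesis using t [of x] that by (simp add: G)
          next
            case (Inr y)
            then show ?thesis using b [of y] tb that by (simp add: G)
          qed
          then have "K \<inter> G = {} \<or> K \<subseteq> G" by blast
          then show ?thesis unfolding fits using True by blast
        next
          case False
          obtain u where u: "K = {u}" by (rule PIP_point [OF c K False])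
          have "u \<notin> G"
          proof (cases u)
            case (Inl x)
            then have x: "Inl x \<in> K" using u by simp
            have "sat top_map A x" by (rule sA [OF block_sub(1) [OF K x]])
            then show ?thesis using top_map_point [OF K x False] by (simp add: sat_def G Inl)
          next
            case (Inr x)
            then have x: "Inr x \<in> K" using u by simp
            have "sat bot_map B x" by (rule sB [OF block_sub(2) [OF K x]])
            then show ?thesis using bot_map_point [OF K x False] by (simp add: sat_def G Inr)
          qed
          then show ?thesis unfolding fits u by simp
        qed
      qed
    qed
  qed
  have "line_pairs {1..n} c = {(A, B). A \<subseteq> {1..n} \<and> run ?w A = Some B}"
  proof (rule line_pairs_eqI)
    fix A B :: "nat set" assume A: "A \<subseteq> {1..n}"
    have "B \<subseteq> {1..n}" if "run ?w A = Some B"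
    proof -
      have "(A, B) \<in> graph n ?w" using A that by (simp add: graph_def)
      then show ?thesis using graph_range [OF n l] by blast
    qed
    then show "(B \<subseteq> {1..n} \<and> (\<forall>K\<in>c. fits K A B)) = (run ?w A = Some B)" using iff [OF A] by blast
  qed
  then have "pip_word n ?w = c" by (intro pip_word_eqI [OF n l c]) (simp only: graph_def)
  then show ?thesis using l by blast
qed

end

text \<open>The values at the generators \<open>Idp i\<close> are forced by the relations that
  express them through \<sigma>, \<lambda> and \<rho>, so \<open>pip_word\<close> is the only
  candidate for the homomorphism.\<close>

lemma extends_pip_word:
  assumes "n \<ge> 3" "extends_assignment n \<phi>" "w \<in> lists (S_gens n)"
  shows "\<phi> (cls n w) = pip_word n w"
proof -
  have hom: "\<phi> (cls n (u @ v)) = pip_mult {1..n} (\<phi> (cls n u)) (\<phi> (cls n v))"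
    if "u \<in> lists (S_gens n)" "v \<in> lists (S_gens n)" for u v
  proof -
    have "cls n u \<in> carrier (S_monoid n)" unfolding carrier_S by (rule imageI [OF that(1)])
    moreover have "cls n v \<in> carrier (S_monoid n)" unfolding carrier_S by (rule imageI [OF that(2)])
    moreover have "\<phi> \<in> hom (S_monoid n) (PIP_monoid n)" using assms(2) by (simp add: extends_assignment_def)
    ultimately have "\<phi> (cls n u \<otimes>\<^bsub>S_monoid n\<^esub> cls n v) = \<phi> (cls n u) \<otimes>\<^bsub>PIP_monoid n\<^esub> \<phi> (cls n v)"
      by (simp only: hom_mult)
    then show ?thesis by (simp add: mult_S [OF that] PIP_monoid_def)
  qed
  have SLR: "\<phi> (cls n [Sig i]) = s_elt n i" "\<phi> (cls n [Lam i]) = l_elt n i" "\<phi> (cls n [Rho i]) = r_elt n i"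
    if "i \<in> {1..<n}" for i
  proof -
    have "i \<in> {1..n - 1}" using that by auto
    then show "\<phi> (cls n [Sig i]) = s_elt n i" "\<phi> (cls n [Lam i]) = l_elt n i" "\<phi> (cls n [Rho i]) = r_elt n i"
      using assms(2) unfolding extends_assignment_def S_elt_def cls_def by blast+
  qed
  have gl: "[x] \<in> lists (S_gens n)" if "x \<in> S_gens n" for x using that by simp
  have Idp_Suc: "\<phi> (cls n [Idp (Suc i)]) = pip_mult {1..n} (l_elt n i) (r_elt n i)" if i: "i \<in> {1..<n}" for i
  proof -
    have g: "[Idp (Suc i)] \<in> lists (S_gens n)" "[Lam i] \<in> lists (S_gens n)" "[Rho i] \<in> lists (S_gens n)"
      using i by (simp_all add: S_gens_iff [OF assms(1)])
    have "S_rel [Idp (Suc i)] [Lam i, Rho i]" using S_rel.intros(29) [of "Suc i"] i by simp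
    then have "pres_cong (S_gens n) S_rel [Idp (Suc i)] ([Lam i] @ [Rho i])"
      using g by (intro pres_cong.base) simp_all
    then have "cls n [Idp (Suc i)] = cls n ([Lam i] @ [Rho i])" using g by (subst cls_eq_iff) simp_all
    then show ?thesis using hom [OF g(2,3)] SLR [OF i] by simp
  qed
  have gen: "\<phi> (cls n [x]) = pip_gen n x" if x: "x \<in> S_gens n" for x
  proof (cases x)
    case (Sig i)
    then show ?thesis using x SLR(1) by (simp add: S_gens_iff [OF assms(1)])
  next
    case (Lam i)
    then show ?thesis using x SLR(2) by (simp add: S_gens_iff [OF assms(1)])
  next
    case (Rho i)
    then show ?thesis using x SLR(3) by (simp add: S_gens_iff [OF assms(1)])
  next
    case (Idp i)
    then have i: "i \<in> {1..n}" using x by (simp only: S_gens_iff [OF assms(1)])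
    show ?thesis
    proof (cases "i = 1")
      case False
      then obtain j where j: "i = Suc j" "j \<in> {1..<n}" using i by (cases i) auto
      then show ?thesis using Idp_Suc [OF j(2)] False Idp by simp
    next
      case True
      have 1: "1 \<in> {1..<n}" using assms(1) by simp
      have g: "[Idp 1] \<in> lists (S_gens n)" "[Sig 1] \<in> lists (S_gens n)" "[Idp 2] \<in> lists (S_gens n)"
        using assms(1) by (simp_all add: S_gens_iff [OF assms(1)])
      then have g2: "[Idp 2] @ [Sig 1] \<in> lists (S_gens n)" by simp
      have "pres_cong (S_gens n) S_rel [Idp 1] ([Sig 1] @ ([Idp 2] @ [Sig 1]))"
        using g S_rel.intros(30) by (intro pres_cong.base) simp_all
      then have "cls n [Idp 1] = cls n ([Sig 1] @ ([Idp 2] @ [Sig 1]))" using g by (subst cls_eq_iff) simp_all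
      also have "\<phi> \<dots> = pip_mult {1..n} (s_elt n 1) (pip_mult {1..n} (\<phi> (cls n [Idp 2])) (s_elt n 1))"
        unfolding hom [OF g(2) g2] hom [OF g(3,2)] SLR(1) [OF 1] ..
      also have "\<phi> (cls n [Idp 2]) = pip_mult {1..n} (l_elt n 1) (r_elt n 1)"
        using Idp_Suc [OF 1] by (simp only: Suc_1)
      finally show ?thesis unfolding Idp True by (simp only: pip_gen.simps simp_thms if_True)
    qed
  qed
  show ?thesis
    using assms(3)
  proof (induction w)
    case Nil
    have "\<phi> \<one>\<^bsub>S_monoid n\<^esub> = \<one>\<^bsub>PIP_monoid n\<^esub>" using assms(2) by (simp add: extends_assignment_def)
    then show ?case by (simp add: one_S PIP_monoid_def)
  next
    case (Cons x w)
    have "\<phi> (cls n ([x] @ w)) = pip_mult {1..n} (\<phi> (cls n [x])) (\<phi> (cls n w))"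
      by (rule hom [OF gl [OF Cons.hyps(1)] Cons.hyps(2)])
    then show ?case using gen [OF Cons.hyps(1)] Cons.IH by simp
  qed
qed

text \<open>Equal partitions have equal graphs, so injectivity is \<open>completeness\<close>;
  surjectivity is \<open>pip_word_surj\<close>.\<close>

lemma extends_iso:
  assumes "n \<ge> 3" "extends_assignment n \<phi>"
  shows "\<phi> \<in> iso (S_monoid n) (PIP_monoid n)"
proof -
  note ev = extends_pip_word [OF assms]
  have hom: "\<phi> \<in> hom (S_monoid n) (PIP_monoid n)" using assms(2) by (simp add: extends_assignment_def)
  have "inj_on \<phi> (carrier (S_monoid n))"
  proof (rule inj_onI)
    fix C D assume CD: "C \<in> carrier (S_monoid n)" "D \<in> carrier (S_monoid n)" "\<phi> C = \<phi> D"
    obtain u where u: "C = cls n u" "u \<in> lists (S_gens n)" using CD(1) unfolding carrier_S by (elim imageE)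
    obtain v where v: "D = cls n v" "v \<in> lists (S_gens n)" using CD(2) unfolding carrier_S by (elim imageE)
    have "pip_word n u = pip_word n v" using CD(3) ev [OF u(2)] ev [OF v(2)] u(1) v(1) by simp
    then have g: "graph n u = graph n v"
      using pip_word_props [OF assms(1) u(2)] pip_word_props [OF assms(1) v(2)] by metis
    have "run u A = run v A" if A: "A \<subseteq> {1..n}" for A
    proof -
      have "run u A = Some B \<longleftrightarrow> run v A = Some B" for B
        using A g unfolding graph_def set_eq_iff by auto
      then show ?thesis by (metis not_Some_eq)
    qed
    then show "C = D" unfolding u(1) v(1) by (rule completeness [OF assms(1) u(2) v(2)])
  qed
  moreover have "\<phi> ` carrier (S_monoid n) = carrier (PIP_monoid n)"
  proof
    show "\<phi> ` carrier (S_monoid n) \<subseteq> carrier (PIP_monoid n)" using hom by (auto simp: hom_def)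
    show "carrier (PIP_monoid n) \<subseteq> \<phi> ` carrier (S_monoid n)"
    proof
      fix c assume "c \<in> carrier (PIP_monoid n)"
      then have "c \<in> PIP {1..n}" by (simp add: PIP_monoid_def)
      from pip_word_surj [OF assms(1) this] obtain w where w: "w \<in> lists (S_gens n)" "pip_word n w = c" by blast
      have "c = \<phi> (cls n w)" using ev [OF w(1)] w(2) by simp
      then show "c \<in> \<phi> ` carrier (S_monoid n)" unfolding carrier_S using w(1) by blast
    qed
  qed
  ultimately show ?thesis using hom by (simp add: iso_def bij_betw_def)
qed

text \<open>Congruent words have equal graphs and a partition is determined by its graph, so
  \<open>pip_word\<close> is constant on congruence classes and descends to them.\<close>

lemma extends_exists:
  assumes "n \<ge> 3"
  shows "\<exists>\<phi>. extends_assignment n \<phi>"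
proof -
  define \<phi> where "\<phi> C = pip_word n (SOME w. w \<in> lists (S_gens n) \<and> C = cls n w)" for C
  have phi: "\<phi> (cls n w) = pip_word n w" if w: "w \<in> lists (S_gens n)" for w
  proof -
    define v where "v = (SOME v. v \<in> lists (S_gens n) \<and> cls n w = cls n v)"
    have "v \<in> lists (S_gens n) \<and> cls n w = cls n v" unfolding v_def by (rule someI [of _ w]) (simp only: w simp_thms)
    then have v: "v \<in> lists (S_gens n)" "cls n w = cls n v" by blast+
    have "pip_word n w = pip_word n v" using v(2) cls_eq_iff [OF w v(1)] by (intro cong_pip_word [OF assms]) simp
    then show ?thesis by (simp only: \<phi>_def v_def)
  qed
  have "\<phi> \<in> hom (S_monoid n) (PIP_monoid n)"
  proof (rule homI)
    fix C assume "C \<in> carrier (S_monoid n)"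
    then obtain w where w: "C = cls n w" "w \<in> lists (S_gens n)" unfolding carrier_S by (elim imageE)
    show "\<phi> C \<in> carrier (PIP_monoid n)"
      unfolding w(1) phi [OF w(2)] using pip_word_props [OF assms w(2)] by (simp add: PIP_monoid_def)
  next
    fix C D assume CD: "C \<in> carrier (S_monoid n)" "D \<in> carrier (S_monoid n)"
    obtain u where u: "C = cls n u" "u \<in> lists (S_gens n)" using CD(1) unfolding carrier_S by (elim imageE)
    obtain v where v: "D = cls n v" "v \<in> lists (S_gens n)" using CD(2) unfolding carrier_S by (elim imageE)
    have uv: "u @ v \<in> lists (S_gens n)" using u v by simp
    show "\<phi> (C \<otimes>\<^bsub>S_monoid n\<^esub> D) = \<phi> C \<otimes>\<^bsub>PIP_monoid n\<^esub> \<phi> D"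
      unfolding u(1) v(1) mult_S [OF u(2) v(2)] phi [OF uv] phi [OF u(2)] phi [OF v(2)]
        pip_word_append [OF assms u(2) v(2)] by (simp add: PIP_monoid_def)
  qed
  moreover have "\<phi> \<one>\<^bsub>S_monoid n\<^esub> = \<one>\<^bsub>PIP_monoid n\<^esub>"
    using phi [OF lists.Nil] by (simp add: one_S PIP_monoid_def)
  moreover have "\<phi> (S_elt n (Sig i)) = s_elt n i" "\<phi> (S_elt n (Lam i)) = l_elt n i" "\<phi> (S_elt n (Rho i)) = r_elt n i"
    if i: "i \<in> {1..n - 1}" for i
  proof -
    have g: "Sig i \<in> S_gens n" "Lam i \<in> S_gens n" "Rho i \<in> S_gens n"
      using i assms by (auto simp: S_gens_def)
    have e: "\<phi> (S_elt n x) = pip_gen n x" if "x \<in> S_gens n" for x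
      using phi [of "[x]"] pip_word_single [OF assms that] that by (simp add: S_elt_def cls_def)
    show "\<phi> (S_elt n (Sig i)) = s_elt n i" "\<phi> (S_elt n (Lam i)) = l_elt n i" "\<phi> (S_elt n (Rho i)) = r_elt n i"
      using e [OF g(1)] e [OF g(2)] e [OF g(3)] by simp_all
  qed
  ultimately show ?thesis unfolding extends_assignment_def by blast
qed

theorem theorem1:
  fixes n :: nat
  assumes "n \<ge> 3"
  shows "(\<exists>\<phi>. extends_assignment n \<phi>) \<and>
         (\<forall>\<phi>. extends_assignment n \<phi> \<longrightarrow> \<phi> \<in> iso (S_monoid n) (PIP_monoid n))"
  using extends_exists [OF assms] extends_iso [OF assms] by blast

end
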